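(* Let $0<\alpha<2$, let $T=\mathbb{Z}$ or $T=\mathbb{R}$, and let $\mathbf{X}=(X(t),\,t\in T)$ be a measurable stationary symmetric $\alpha$-stable (S$\alpha$S) process. Then $\mathbf{X}$ is ergodic (equivalently, weakly mixing) if and only if the component $\mathbf{X}^P$ of $\mathbf{X}$ corresponding to a positive flow (the positive part in the positive-null decomposition $\mathbf{X}=\mathbf{X}^P+\mathbf{X}^N$) vanishes.
   Context: **Processes.** $0<\alpha<2$, and $T=\mathbb{Z}$ or $T=\mathbb{R}$. All S$\alpha$S processes are real-valued, or complex-valued and isotropic (rotationally invariant), and are assumed measurable (automatic if $T=\mathbb{Z}$; equivalent to continuity in probability for stationary processes if $T=\mathbb{R}$). **Integral representations.** $M$ is an S$\alpha$S random measure (isotropic in the complex case) on a measurable space $(E,\mathcal{E})$ with $\sigma$-finite control measure $m$, and $f_t\in L^\alpha(m)$; representations $X(t)=\int_Ef_t\,dM$, $t\in T$, are understood in law. In the real case, this means that $E\exp\{i\sum_j\theta_jX(t_j)\}=\exp\{-\int_E|\sum_j\theta_jf_{t_j}|^\alpha dm\}$ for all finite choices of $t_j\in T$, $\theta_j\in\mathbb{R}$; similarly with complex $\theta_j$ in the isotropic complex case. **Flow representations.** A measurable nonsingular flow on $(E,\mathcal{E},m)$ is a (jointly) measurable family $(\phi_t)_{t\in T}$ of maps of $E$ onto $E$ with $\phi_{t+s}(x)=\phi_t(\phi_s(x))$, $\phi_0(x)=x$ for all $s,t\in T$, $x\in E$, and $m\circ\phi_t^{-1}\sim m$ for all $t\in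 T$. A cocycle for $(\phi_t)$ is a measurable family $(a_t)_{t\in T}$ of $\{-1,1\}$-valued (unit-circle-valued in the complex case) functions on $E$ such that for all $s,t\in T$, $a_{t+s}(x)=a_s(x)a_t(\phi_s(x))$ for $m$-a.e. $x$. A flow representation is an integral representation with kernel $f_t=a_t\,(dm\circ\phi_t/dm)^{1/\alpha}\,f\circ\phi_t$ for a single $f\in L^\alpha(m)$. It has full support if $\mathrm{supp}\{f\circ\phi_t,\ t\in T\}=E$, i.e. there is no measurable $A$ with $m(A)>0$ such that for every $t\in T$, $f\circ\phi_t=0$ $m$-a.e. on $A$. Every measurable stationary S$\alpha$S process has a full support flow representation (Rosiński, 1995). **Positive and null parts.** A nonsingular map $\phi$ (a bijection of $E$, measurable in both directions, such that $\phi$ and $\phi^{-1}$ map $m$ to equivalent measures) is positive if there is a finite measure equivalent to $m$ and preserved by $\phi$. A measurable set $B$ is weakly wandering for $\phi$ if there is a sequence $0=n_0<n_1<n_2<\dots$ such that the sets $\phi^{-n_k}B$, $k\ge0$, are disjoint. For each nonsingular $\phi$, $E$ decomposes, uniquely modulo $m$-null sets, into disjoint $\phi$-invariant measurable sets $\mathtt{P}$ and $\mathtt{N}$ such that $\phi|_{\mathtt{P}}$ is positive and $\mathtt{N}=\bigcup_{k\ge0}\phi^{-n_k}B$ for a measurable weakly wandering set $B$ and a sequence $0=n_0<n_1<n_2<\dots$ for which the sets $\phi^{-n_k}B$, $k\ge0$, are disjoint. For a measurable nonsingular flow there are invariant measurable sets $\mathtt{P},\mathtt{N}$ which coincide modulo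 null sets with the positive and null parts of $\phi_t$ for every $t>0$. The flow is positive if $\mathtt{P}=E$, and null if $\mathtt{N}=E$, modulo null sets. **Components of the process.** Given a full support flow representation of $\mathbf{X}$ with positive-null decomposition $E=\mathtt{P}\cup\mathtt{N}$ of its flow, put $X^P(t)=\int_{\mathtt{P}}f_t\,dM$ and $X^N(t)=\int_{\mathtt{N}}f_t\,dM$, $t\in T$. Then $\mathbf{X}=\mathbf{X}^P+\mathbf{X}^N$ is a sum of two independent stationary S$\alpha$S processes generated by a positive flow and a null flow respectively, and the laws of $\mathbf{X}^P$ and $\mathbf{X}^N$ do not depend on the choice of representation. (One may further split $\mathbf{X}^N$ into a part generated by a dissipative flow and a part generated by a conservative null flow; $\mathbf{X}^P$ is the same in this three-component decomposition.) "$\mathbf{X}^P$ vanishes" means that $X^P(t)=0$ a.s. for every $t\in T$. **Ergodicity and weak mixing.** Realize $X(t)=X(0)\circ\theta_t$, $t\in T$, on a probability space $(\Omega,\mathcal{F},P)$ with a measurable group $(\theta_t)_{t\in T}$ of shift operators preserving $P$. $\mathbf{X}$ is ergodic if for all events $A,B\in\sigma(X(t),\,t\in T)$, $$\lim_{L\to\infty}\frac1L\int_{[0,L)\cap T}P(A\cap B\circ\theta_t)\,\lambda(dt)=P(A)P(B),$$ and weakly mixing if for all such $A,B$ $$\lim_{L\to\infty}\frac1L\int_{[0,L)\cap T}\bigl|P(A\cap B\circ\theta_t)-P(A)P(B)\bigr|\,\lambda(dt)=0,$$ where $B\circ\theta_t=\theta_t^{-1}(B)$ and $\lambda$ is Lebesgue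 measure if $T=\mathbb{R}$ and counting measure if $T=\mathbb{Z}$. For stationary S$\alpha$S processes the two properties are known to be equivalent (Podgórski, 1992). *)

theory Defs
  imports "HOL-Probability.Probability"
begin

text \<open>
  Conventions.  The time set is a subset \<open>T\<close> of the reals, either \<open>\<int>\<close> or \<open>UNIV\<close>.  All processes
  and kernels have type complex, with values in a scalar field \<open>K\<close> that is either \<open>\<real>\<close> (real case)
  or \<open>UNIV\<close> (complex isotropic case).  When \<open>K = \<real>\<close>, \<open>Re\<close> is the identity on \<open>K\<close> and the scalars of
  modulus one are \<open>-1\<close> and \<open>1\<close>, so both cases are covered by the same formulas.
\<close>

definition time_measure :: "real set \<Rightarrow> real measure" where
  "time_measure T = (if T = UNIV then lborel else count_space T)"

section \<open>Processes\<close>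

definition process_on :: "real set \<Rightarrow> complex set \<Rightarrow> 'w measure \<Rightarrow> (real \<Rightarrow> 'w \<Rightarrow> complex) \<Rightarrow> bool" where
  "process_on T K P X \<longleftrightarrow> prob_space P \<and>
     (\<forall>t\<in>T. X t \<in> borel_measurable P \<and> (\<forall>\<omega>\<in>space P. X t \<omega> \<in> K))"

definition sample_path :: "real set \<Rightarrow> (real \<Rightarrow> 'w \<Rightarrow> complex) \<Rightarrow> 'w \<Rightarrow> (real \<Rightarrow> complex)" where
  "sample_path T X \<omega> = (\<lambda>t\<in>T. X t \<omega>)"

definition process_law ::
    "real set \<Rightarrow> 'w measure \<Rightarrow> (real \<Rightarrow> 'w \<Rightarrow> complex) \<Rightarrow> (real \<Rightarrow> complex) measure" where
  "process_law T P X = distr P (PiM T (\<lambda>_. borel)) (sample_path T X)"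

definition stationary_process :: "real set \<Rightarrow> 'w measure \<Rightarrow> (real \<Rightarrow> 'w \<Rightarrow> complex) \<Rightarrow> bool" where
  "stationary_process T P X \<longleftrightarrow>
     (\<forall>s\<in>T. process_law T P (\<lambda>t. X (t + s)) = process_law T P X)"

text \<open>
  Measurability is understood up to modification; for a stationary process over the reals this is
  what is equivalent to continuity in probability.
\<close>

definition measurable_process :: "real set \<Rightarrow> 'w measure \<Rightarrow> (real \<Rightarrow> 'w \<Rightarrow> complex) \<Rightarrow> bool" where
  "measurable_process T P X \<longleftrightarrow>
     (\<exists>Y. (\<lambda>(t, \<omega>). Y t \<omega>) \<in> borel_measurable (time_measure T \<Otimes>\<^sub>M P) \<and>
          (\<forall>t\<in>T. AE \<omega> in P. Y t \<omega> = X t \<omega>))"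

definition SaS_variable :: "real \<Rightarrow> 'w measure \<Rightarrow> ('w \<Rightarrow> real) \<Rightarrow> bool" where
  "SaS_variable \<alpha> P Z \<longleftrightarrow> Z \<in> borel_measurable P \<and>
     (\<exists>\<sigma>\<ge>0. \<forall>u. char (distr P borel Z) u = of_real (exp (- ((\<sigma> * \<bar>u\<bar>) powr \<alpha>))))"

text \<open>
  In the complex case the real parts of complex linear combinations of the \<open>X t\<close> are precisely the
  real linear combinations of the real and imaginary parts, and the last clause is isotropy; in the
  real case that clause is symmetry.
\<close>

definition SaS_process ::
    "real set \<Rightarrow> complex set \<Rightarrow> real \<Rightarrow> 'w measure \<Rightarrow> (real \<Rightarrow> 'w \<Rightarrow> complex) \<Rightarrow> bool" where
  "SaS_process T K \<alpha> P X \<longleftrightarrow> process_on T K P X \<and>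
     (\<forall>(n::nat) t \<theta>. (\<forall>j<n. t j \<in> T \<and> \<theta> j \<in> K) \<longrightarrow>
        SaS_variable \<alpha> P (\<lambda>\<omega>. Re (\<Sum>j<n. \<theta> j * X (t j) \<omega>))) \<and>
     (\<forall>z\<in>K. norm z = 1 \<longrightarrow> process_law T P (\<lambda>t \<omega>. z * X t \<omega>) = process_law T P X)"

section \<open>Ergodicity and weak mixing\<close>

definition process_events ::
    "real set \<Rightarrow> 'w measure \<Rightarrow> (real \<Rightarrow> 'w \<Rightarrow> complex) \<Rightarrow> 'w set set" where
  "process_events T P X =
     sigma_sets (space P) {X t -` S \<inter> space P | t S. t \<in> T \<and> S \<in> sets borel}"

text \<open>
  Only the individual shifts \<open>\<theta> t\<close> are required to be measurable.  This covers jointly measurable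
  groups as well as the coordinate shifts on path space, which for \<open>T = UNIV\<close> are not jointly
  measurable with respect to the product \<open>\<sigma>\<close>-algebra.
\<close>

definition shift_realization ::
    "real set \<Rightarrow> 'w measure \<Rightarrow> (real \<Rightarrow> 'w \<Rightarrow> 'w) \<Rightarrow> (real \<Rightarrow> 'w \<Rightarrow> complex) \<Rightarrow> bool" where
  "shift_realization T P \<theta> X \<longleftrightarrow>
     (\<forall>t\<in>T. \<theta> t \<in> measurable P P \<and> distr P P (\<theta> t) = P) \<and>
     (\<forall>\<omega>\<in>space P. \<theta> 0 \<omega> = \<omega>) \<and>
     (\<forall>s\<in>T. \<forall>t\<in>T. \<forall>\<omega>\<in>space P. \<theta> (t + s) \<omega> = \<theta> t (\<theta> s \<omega>)) \<and>
     (\<forall>t\<in>T. \<forall>\<omega>\<in>space P. X t \<omega> = X 0 (\<theta> t \<omega>))"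

definition ergodic_process ::
    "real set \<Rightarrow> 'w measure \<Rightarrow> (real \<Rightarrow> 'w \<Rightarrow> 'w) \<Rightarrow> (real \<Rightarrow> 'w \<Rightarrow> complex) \<Rightarrow> bool" where
  "ergodic_process T P \<theta> X \<longleftrightarrow>
     (\<forall>A\<in>process_events T P X. \<forall>B\<in>process_events T P X.
        ((\<lambda>L. 1 / L * (LINT t:{0..<L} \<inter> T|time_measure T.
             measure P (A \<inter> (\<theta> t -` B \<inter> space P))))
          \<longlongrightarrow> measure P A * measure P B) at_top)"

definition weakly_mixing_process ::
    "real set \<Rightarrow> 'w measure \<Rightarrow> (real \<Rightarrow> 'w \<Rightarrow> 'w) \<Rightarrow> (real \<Rightarrow> 'w \<Rightarrow> complex) \<Rightarrow> bool" where
  "weakly_mixing_process T P \<theta> X \<longleftrightarrow>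
     (\<forall>A\<in>process_events T P X. \<forall>B\<in>process_events T P X.
        ((\<lambda>L. 1 / L * (LINT t:{0..<L} \<inter> T|time_measure T.
             \<bar>measure P (A \<inter> (\<theta> t -` B \<inter> space P)) - measure P A * measure P B\<bar>))
          \<longlongrightarrow> 0) at_top)"

section \<open>Integral representations\<close>

definition L_alpha :: "complex set \<Rightarrow> real \<Rightarrow> 'e measure \<Rightarrow> ('e \<Rightarrow> complex) set" where
  "L_alpha K \<alpha> m = {f. f \<in> borel_measurable m \<and> (\<forall>x\<in>space m. f x \<in> K) \<and>
                        integrable m (\<lambda>x. norm (f x) powr \<alpha>)}"

text \<open>
  Equality in law of the process \<open>X\<close> with the stochastic integrals of \<open>f t\<close> against an SaS random
  measure with control measure \<open>m\<close>, expressed by joint characteristic functions.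
\<close>

definition integral_representation ::
    "real set \<Rightarrow> complex set \<Rightarrow> real \<Rightarrow> 'w measure \<Rightarrow> (real \<Rightarrow> 'w \<Rightarrow> complex) \<Rightarrow>
     'e measure \<Rightarrow> (real \<Rightarrow> 'e \<Rightarrow> complex) \<Rightarrow> bool" where
  "integral_representation T K \<alpha> P X m f \<longleftrightarrow>
     process_on T K P X \<and> sigma_finite_measure m \<and> (\<forall>t\<in>T. f t \<in> L_alpha K \<alpha> m) \<and>
     (\<forall>(n::nat) t \<theta>. (\<forall>j<n. t j \<in> T \<and> \<theta> j \<in> K) \<longrightarrow>
        (LINT \<omega>|P. exp (\<i> * of_real (Re (\<Sum>j<n. \<theta> j * X (t j) \<omega>)))) =
        of_real (exp (- (LINT x|m. norm (\<Sum>j<n. \<theta> j * f (t j) x) powr \<alpha>))))"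

section \<open>Flows, cocycles and flow representations\<close>

definition nonsingular_flow :: "real set \<Rightarrow> 'e measure \<Rightarrow> (real \<Rightarrow> 'e \<Rightarrow> 'e) \<Rightarrow> bool" where
  "nonsingular_flow T m \<phi> \<longleftrightarrow>
     (\<lambda>(t, x). \<phi> t x) \<in> measurable (time_measure T \<Otimes>\<^sub>M m) m \<and>
     (\<forall>t\<in>T. \<phi> t ` space m = space m) \<and>
     (\<forall>s\<in>T. \<forall>t\<in>T. \<forall>x\<in>space m. \<phi> (t + s) x = \<phi> t (\<phi> s x)) \<and>
     (\<forall>x\<in>space m. \<phi> 0 x = x) \<and>
     (\<forall>t\<in>T. null_sets (distr m m (\<phi> t)) = null_sets m)"

definition flow_cocycle ::
    "real set \<Rightarrow> complex set \<Rightarrow> 'e measure \<Rightarrow> (real \<Rightarrow> 'e \<Rightarrow> 'e) \<Rightarrow> (real \<Rightarrow> 'e \<Rightarrow> complex) \<Rightarrow> bool" where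
  "flow_cocycle T K m \<phi> a \<longleftrightarrow>
     (\<lambda>(t, x). a t x) \<in> borel_measurable (time_measure T \<Otimes>\<^sub>M m) \<and>
     (\<forall>t\<in>T. \<forall>x\<in>space m. a t x \<in> K \<and> norm (a t x) = 1) \<and>
     (\<forall>s\<in>T. \<forall>t\<in>T. AE x in m. a (t + s) x = a s x * a t (\<phi> s x))"

text \<open>
  The inverse of \<open>\<phi> t\<close> is \<open>\<phi> (- t)\<close>, so the measure mapping \<open>A\<close> to the \<open>m\<close>-measure of the image of
  \<open>A\<close> under \<open>\<phi> t\<close> is the push-forward of \<open>m\<close> under \<open>\<phi> (- t)\<close>.
\<close>

definition flow_kernel ::
    "real \<Rightarrow> 'e measure \<Rightarrow> (real \<Rightarrow> 'e \<Rightarrow> 'e) \<Rightarrow> (real \<Rightarrow> 'e \<Rightarrow> complex) \<Rightarrow> ('e \<Rightarrow> complex) \<Rightarrow>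
     real \<Rightarrow> 'e \<Rightarrow> complex" where
  "flow_kernel \<alpha> m \<phi> a f t x =
     a t x * of_real (enn2real (RN_deriv m (distr m m (\<phi> (- t))) x) powr (1 / \<alpha>)) * f (\<phi> t x)"

definition full_support :: "real set \<Rightarrow> 'e measure \<Rightarrow> (real \<Rightarrow> 'e \<Rightarrow> 'e) \<Rightarrow> ('e \<Rightarrow> complex) \<Rightarrow> bool" where
  "full_support T m \<phi> f \<longleftrightarrow>
     \<not> (\<exists>A\<in>sets m. emeasure m A > 0 \<and> (\<forall>t\<in>T. AE x in m. x \<in> A \<longrightarrow> f (\<phi> t x) = 0))"

definition full_support_flow_representation ::
    "real set \<Rightarrow> complex set \<Rightarrow> real \<Rightarrow> 'w measure \<Rightarrow> (real \<Rightarrow> 'w \<Rightarrow> complex) \<Rightarrow>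
     'e measure \<Rightarrow> (real \<Rightarrow> 'e \<Rightarrow> 'e) \<Rightarrow> (real \<Rightarrow> 'e \<Rightarrow> complex) \<Rightarrow> ('e \<Rightarrow> complex) \<Rightarrow> bool" where
  "full_support_flow_representation T K \<alpha> P X m \<phi> a f \<longleftrightarrow>
     sigma_finite_measure m \<and> nonsingular_flow T m \<phi> \<and> flow_cocycle T K m \<phi> a \<and>
     f \<in> L_alpha K \<alpha> m \<and>
     integral_representation T K \<alpha> P X m (flow_kernel \<alpha> m \<phi> a f) \<and>
     full_support T m \<phi> f"

section \<open>Positive-null decomposition\<close>

definition nonsingular_map :: "'e measure \<Rightarrow> ('e \<Rightarrow> 'e) \<Rightarrow> bool" where
  "nonsingular_map m \<phi> \<longleftrightarrow> bij_betw \<phi> (space m) (space m) \<and>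
     \<phi> \<in> measurable m m \<and> the_inv_into (space m) \<phi> \<in> measurable m m \<and>
     null_sets (distr m m \<phi>) = null_sets m \<and>
     null_sets (distr m m (the_inv_into (space m) \<phi>)) = null_sets m"

definition positive_map :: "'e measure \<Rightarrow> ('e \<Rightarrow> 'e) \<Rightarrow> bool" where
  "positive_map m \<phi> \<longleftrightarrow> nonsingular_map m \<phi> \<and>
     (\<exists>\<nu>. finite_measure \<nu> \<and> sets \<nu> = sets m \<and> null_sets \<nu> = null_sets m \<and> distr \<nu> \<nu> \<phi> = \<nu>)"

definition weakly_wandering_along ::
    "'e measure \<Rightarrow> ('e \<Rightarrow> 'e) \<Rightarrow> 'e set \<Rightarrow> (nat \<Rightarrow> nat) \<Rightarrow> bool" where
  "weakly_wandering_along m \<phi> B n \<longleftrightarrow> B \<in> sets m \<and> n 0 = 0 \<and> strict_mono n \<and>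
     disjoint_family (\<lambda>k. (\<phi> ^^ n k) -` B \<inter> space m)"

definition positive_null_parts_map ::
    "'e measure \<Rightarrow> ('e \<Rightarrow> 'e) \<Rightarrow> 'e set \<Rightarrow> 'e set \<Rightarrow> bool" where
  "positive_null_parts_map m \<phi> Pos Nul \<longleftrightarrow>
     nonsingular_map m \<phi> \<and>
     Pos \<in> sets m \<and> Nul \<in> sets m \<and> Pos \<inter> Nul = {} \<and> Pos \<union> Nul = space m \<and>
     \<phi> -` Pos \<inter> space m = Pos \<and> \<phi> -` Nul \<inter> space m = Nul \<and>
     positive_map (restrict_space m Pos) \<phi> \<and>
     (\<exists>B n. weakly_wandering_along m \<phi> B n \<and> Nul = (\<Union>k. (\<phi> ^^ n k) -` B \<inter> space m))"

definition positive_null_parts_flow ::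
    "real set \<Rightarrow> 'e measure \<Rightarrow> (real \<Rightarrow> 'e \<Rightarrow> 'e) \<Rightarrow> 'e set \<Rightarrow> 'e set \<Rightarrow> bool" where
  "positive_null_parts_flow T m \<phi> Pos Nul \<longleftrightarrow>
     Pos \<in> sets m \<and> Nul \<in> sets m \<and> Pos \<inter> Nul = {} \<and> Pos \<union> Nul = space m \<and>
     (\<forall>t\<in>T. \<phi> t -` Pos \<inter> space m = Pos \<and> \<phi> t -` Nul \<inter> space m = Nul) \<and>
     (\<forall>t\<in>T. t > 0 \<longrightarrow> (\<exists>Pos' Nul'. positive_null_parts_map m (\<phi> t) Pos' Nul' \<and>
        (Pos - Pos') \<union> (Pos' - Pos) \<in> null_sets m \<and>
        (Nul - Nul') \<union> (Nul' - Nul) \<in> null_sets m))"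

text \<open>
  The components, in law: the integrals of \<open>f t\<close> over the disjoint sets \<open>Pos\<close> and \<open>Nul\<close> against a
  common independently scattered random measure are independent processes, realized on a
  probability space \<open>Q\<close>.  Their sum has the law of the integrals of \<open>f t\<close> over the whole space.
\<close>

definition positive_null_components ::
    "real set \<Rightarrow> complex set \<Rightarrow> real \<Rightarrow> 'e measure \<Rightarrow> (real \<Rightarrow> 'e \<Rightarrow> complex) \<Rightarrow> 'e set \<Rightarrow> 'e set \<Rightarrow>
     'q measure \<Rightarrow> (real \<Rightarrow> 'q \<Rightarrow> complex) \<Rightarrow> (real \<Rightarrow> 'q \<Rightarrow> complex) \<Rightarrow> bool" where
  "positive_null_components T K \<alpha> m f Pos Nul Q XP XN \<longleftrightarrow>
     integral_representation T K \<alpha> Q XP (restrict_space m Pos) f \<and>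
     integral_representation T K \<alpha> Q XN (restrict_space m Nul) f \<and>
     prob_space.indep_var Q (PiM T (\<lambda>_. borel)) (sample_path T XP)
                            (PiM T (\<lambda>_. borel)) (sample_path T XN)"

definition vanishes :: "real set \<Rightarrow> 'q measure \<Rightarrow> (real \<Rightarrow> 'q \<Rightarrow> complex) \<Rightarrow> bool" where
  "vanishes T Q Y \<longleftrightarrow> (\<forall>t\<in>T. AE \<omega> in Q. Y t \<omega> = 0)"

end

theory Submission
  imports Defs
begin

text \<open>
  For \<open>0 < \<alpha> < 2\<close> one has
  \<open>\<bar>\<bar>z + w\<bar>\<^sup>\<alpha> - \<bar>z\<bar>\<^sup>\<alpha> - \<bar>w\<bar>\<^sup>\<alpha>\<bar> \<le> 4 \<bar>z\<bar>\<^bsup>\<alpha>/2\<^esup> \<bar>w\<bar>\<^bsup>\<alpha>/2\<^esup>\<close>, so covariances of characters of the process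
  are controlled by the overlap of \<open>\<bar>g\<bar>\<^sup>\<alpha>\<close> with the translates \<open>\<bar>h \<circ> \<phi>\<^sub>t\<bar>\<^sup>\<alpha> (dm \<circ> \<phi>\<^sub>t/dm)\<close>.  If the
  positive part is null, \<open>m\<close> lives on the disjoint sets \<open>\<phi>\<^sub>1\<^bsup>-n(k)\<^esup> B\<close> for a weakly wandering \<open>B\<close>.
  Each translate has the same total mass, which bounds \<open>\<Sum>\<^sub>j b (t - n(j))\<close>, where \<open>b t\<close> is the mass
  that the translate by \<open>t\<close> puts on \<open>B\<close>; hence \<open>b\<close> has Cesaro mean zero, the overlaps vanish on
  average, and weak mixing passes from characters to all events by \<open>L\<^sup>1\<close>-approximation.

  Conversely, ergodicity makes \<open>\<integral> min \<bar>f\<^sub>u\<bar>\<^sup>\<alpha> \<bar>f\<^sub>t\<bar>\<^sup>\<alpha> dm\<close> vanish on average in \<open>t\<close>, because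
  \<open>\<bar>z + w\<bar>\<^sup>\<alpha> + \<bar>z - w\<bar>\<^sup>\<alpha>\<close> falls short of \<open>2\<bar>z\<bar>\<^sup>\<alpha> + 2\<bar>w\<bar>\<^sup>\<alpha>\<close> by at least
  \<open>(2 - \<alpha>) min \<bar>z\<bar>\<^sup>\<alpha> \<bar>w\<bar>\<^sup>\<alpha>\<close>.  If \<open>\<nu>\<close> is a finite \<open>\<phi>\<^sub>1\<close>-invariant measure on the positive part,
  then \<open>\<nu> {\<bar>f\<^sub>t\<bar>\<^sup>\<alpha> > \<epsilon> d\<nu>/dm}\<close> depends only on \<open>t\<close> modulo 1, while well-chosen times make arbitrarily
  many of these sets almost disjoint; so they are \<open>\<nu>\<close>-null for almost every \<open>t\<close>, and the kernel vanishes there.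
\<close>

section \<open>Inequalities and limits\<close>

text \<open>Both directions run through the single map \<open>\<phi> 1\<close>. Time averages are
  folded modulo 1 into Cesaro sums along \<open>s + real k\<close>. In the null direction these are
  controlled at every offset \<open>s\<close>; ergodicity gives information only at almost every
  \<open>s\<close>. One good offset is enough, because the cocycle relation carries the zeros of one
  \<open>F s\<close> on a flow-invariant set to all times.

  A second obstacle is measurability in \<open>t\<close>: the shifts are not assumed jointly
  measurable, so Fubini does not apply to covariances of events. It applies to characters, through a
  jointly measurable modification of the process. Bounds on covariances are uniform in
  \<open>t\<close>, so measurability, zero mean and zero absolute mean all pass between characters
  and events by one argument about a \<open>closed_class\<close>.

  Ergodicity controls averages of \<open>exp (- I)\<close>, without absolute values, for the
  exponents \<open>I\<close> of \<open>X u + X t\<close> and \<open>X u - X t\<close>. It thus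
  bounds the exponents from one side only; the parallelogram inequality bounds their sum from the
  other.\<close>

lemma abs_norm_powr_add_le:
  fixes z w :: complex
  assumes \<alpha>: "0 < \<alpha>" "\<alpha> < 2"
  shows "\<bar>norm (z + w) powr \<alpha> - norm z powr \<alpha> - norm w powr \<alpha>\<bar>
    \<le> 4 * (norm z powr (\<alpha> / 2) * norm w powr (\<alpha> / 2))"
proof -
  have *: "\<bar>norm (z + w) powr \<alpha> - norm z powr \<alpha> - norm w powr \<alpha>\<bar>
    \<le> 4 * (norm z powr (\<alpha> / 2) * norm w powr (\<alpha> / 2))" if le: "norm w \<le> norm z" for z w :: complex
  proof (cases "z = 0")
    case True
    then show ?thesis using le by simp
  next
    case False
    \<comment> \<open>By homogeneity everything is divided by \<open>norm z\<close>; the triangle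
      inequality then leaves \<open>1 - r \<le> s \<le> 1 + r\<close> with
      \<open>r \<le> 1\<close>.\<close>
    define x r s where "x = norm z" and "r = norm w / norm z" and "s = norm (z + w) / norm z"
    have x: "x > 0" and r: "0 \<le> r" "r \<le> 1" and s0: "s \<ge> 0"
      using False le by (auto simp: x_def r_def s_def)
    have eqs: "norm (z + w) = x * s" "norm w = x * r" using x by (auto simp: x_def r_def s_def)
    have "x * (1 + r) = norm z + norm w" "x * (1 - r) = norm z - norm w"
      by (simp_all only: distrib_left right_diff_distrib eqs(2)) (simp_all add: x_def)
    then have "norm (z + w) \<le> x * (1 + r)" "x * (1 - r) \<le> norm (z + w)"
      using norm_triangle_ineq[of z w] norm_diff_ineq[of z w] by simp_all
    then have s: "s \<le> 1 + r" "1 - r \<le> s" using x by (auto simp: eqs(1))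
    \<comment> \<open>\<open>s powr \<alpha>\<close> lies between 1 and \<open>s\<^sup>2\<close>, so
      squares suffice. Since \<open>r\<close> and \<open>r powr \<alpha>\<close> are both at most
      \<open>r powr (\<alpha> / 2)\<close>, the final constant is 3 + 1 = 4.\<close>
    have le3: "\<bar>s powr \<alpha> - 1\<bar> \<le> 3 * r"
    proof (cases "s \<le> 1")
      case True
      have "s\<^sup>2 \<le> s powr \<alpha>"
        using powr_mono'[of \<alpha> 2 s] \<alpha> True s0 by simp
      moreover have "s powr \<alpha> \<le> 1" using True s0 \<alpha> by (simp add: powr_le1)
      moreover have "(1 - r)\<^sup>2 \<le> s\<^sup>2" using s r by (intro power_mono) auto
      moreover have "1 - 2 * r \<le> (1 - r)\<^sup>2" by (simp add: power2_eq_square algebra_simps)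
      ultimately show ?thesis using r by linarith
    next
      case False
      have "s powr \<alpha> \<le> s\<^sup>2"
        using powr_mono[of \<alpha> 2 s] \<alpha> False by simp
      moreover have "1 \<le> s powr \<alpha>" using False \<alpha> by (simp add: ge_one_powr_ge_zero)
      moreover have "s\<^sup>2 \<le> (1 + r)\<^sup>2" using s s0 by (intro power_mono) auto
      moreover have "(1 + r)\<^sup>2 \<le> 1 + 3 * r"
        using mult_left_mono[of r 1 r] r by (simp add: power2_eq_square algebra_simps)
      ultimately show ?thesis by linarith
    qed
    have "r powr \<alpha> \<le> r powr (\<alpha> / 2)" using powr_mono'[of "\<alpha>/2" \<alpha> r] \<alpha> r by simp
    moreover have "r \<le> r powr (\<alpha> / 2)" using powr_mono'[of "\<alpha>/2" 1 r] \<alpha> r by simp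
    moreover have "r powr \<alpha> \<ge> 0" by simp
    ultimately have "\<bar>s powr \<alpha> - 1 - r powr \<alpha>\<bar> \<le> 4 * r powr (\<alpha> / 2)" using le3 by linarith
    then have "x powr \<alpha> * \<bar>s powr \<alpha> - 1 - r powr \<alpha>\<bar> \<le> x powr \<alpha> * (4 * r powr (\<alpha> / 2))"
      by (intro mult_left_mono) auto
    moreover have "x powr \<alpha> * \<bar>s powr \<alpha> - 1 - r powr \<alpha>\<bar>
      = \<bar>norm (z + w) powr \<alpha> - norm z powr \<alpha> - norm w powr \<alpha>\<bar>"
    proof -
      have "x powr \<alpha> * \<bar>s powr \<alpha> - 1 - r powr \<alpha>\<bar> = \<bar>x powr \<alpha> * (s powr \<alpha> - 1 - r powr \<alpha>)\<bar>"
        by (simp add: abs_mult)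
      then show ?thesis using x r s0 by (simp add: eqs powr_mult right_diff_distrib x_def[symmetric])
    qed
    moreover have "x powr \<alpha> * (4 * r powr (\<alpha> / 2)) = 4 * (norm z powr (\<alpha> / 2) * norm w powr (\<alpha> / 2))"
      using x r by (simp add: eqs powr_mult x_def[symmetric] powr_add[symmetric])
    ultimately show ?thesis by simp
  qed
  show ?thesis
  proof (cases "norm w \<le> norm z")
    case False
    then show ?thesis using *[of z w] by (simp add: add.commute algebra_simps)
  qed (rule *)
qed

text \<open>Concavity: the tangent at 1 lies above the graph. It is the weighted Young inequality
  for \<open>y\<close> and 1.\<close>

lemma powr_le_affine:
  fixes y :: real
  assumes "0 < \<beta>" "\<beta> < 1" "0 \<le> y"
  shows "y powr \<beta> \<le> 1 + \<beta> * (y - 1)"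
proof (cases "y = 0")
  case False
  then show ?thesis
    using Youngs_inequality_0[of \<beta> "1 - \<beta>" y 1] assms by (simp add: algebra_simps)
qed (use assms in simp)

text \<open>Concavity is used twice, with \<open>norm w \<le> norm z\<close>. At \<open>c\<close>,
  by the parallelogram law the mean of the squared norms of \<open>z + w\<close> and
  \<open>z - w\<close>, it bounds the left side by \<open>2 * c powr (\<alpha> / 2)\<close>; at 1 it
  bounds this by \<open>2 * norm z powr \<alpha> + \<alpha> * norm w powr \<alpha>\<close>. The drop
  from 2 to \<alpha> in the second coefficient is the gain \<open>2 - \<alpha>\<close>.\<close>

lemma norm_powr_parallelogram_le:
  fixes z w :: complex
  assumes \<alpha>: "0 < \<alpha>" "\<alpha> < 2"
  shows "norm (z + w) powr \<alpha> + norm (z - w) powr \<alpha>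
    \<le> 2 * (norm z powr \<alpha> + norm w powr \<alpha>) - (2 - \<alpha>) * min (norm z powr \<alpha>) (norm w powr \<alpha>)"
proof -
  have *: "norm (z + w) powr \<alpha> + norm (z - w) powr \<alpha>
    \<le> 2 * (norm z powr \<alpha> + norm w powr \<alpha>) - (2 - \<alpha>) * min (norm z powr \<alpha>) (norm w powr \<alpha>)"
    if le: "norm w \<le> norm z" for z w :: complex
  proof (cases "z = 0")
    case True
    then show ?thesis using le by simp
  next
    case False
    define x r c where "x = norm z" and "r = norm w / norm z" and "c = (norm z)\<^sup>2 + (norm w)\<^sup>2"
    have x: "x > 0" and r: "0 \<le> r" "r \<le> 1" and c0: "c > 0"
      using False le by (auto simp: x_def r_def c_def add_pos_nonneg)
    have w: "norm w = x * r" using x by (auto simp: x_def r_def)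
    have sq: "y powr \<alpha> = (y\<^sup>2) powr (\<alpha> / 2)" if "y \<ge> 0" for y :: real
      using that powr_powr[of y 2 "\<alpha> / 2"] by simp
    have sum: "(norm (z + w))\<^sup>2 + (norm (z - w))\<^sup>2 = 2 * c"
      by (simp only: c_def cmod_power2) (simp add: power2_eq_square algebra_simps)
    have tangent: "y powr (\<alpha> / 2) \<le> c powr (\<alpha> / 2) * (1 + \<alpha> / 2 * (y / c - 1))" if "y \<ge> 0" for y
    proof -
      have "y powr (\<alpha> / 2) = c powr (\<alpha> / 2) * (y / c) powr (\<alpha> / 2)"
        using c0 that by (simp add: powr_divide)
      also have "\<dots> \<le> c powr (\<alpha> / 2) * (1 + \<alpha> / 2 * (y / c - 1))"
        using powr_le_affine[of "\<alpha> / 2" "y / c"] \<alpha> c0 that by (intro mult_left_mono) auto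
      finally show ?thesis .
    qed
    have "norm (z + w) powr \<alpha> + norm (z - w) powr \<alpha>
      \<le> c powr (\<alpha> / 2) * (1 + \<alpha> / 2 * ((norm (z + w))\<^sup>2 / c - 1))
        + c powr (\<alpha> / 2) * (1 + \<alpha> / 2 * ((norm (z - w))\<^sup>2 / c - 1))"
      by (simp only: sq norm_ge_zero) (intro add_mono tangent; simp)
    also have "\<dots> = c powr (\<alpha> / 2) * (2 + \<alpha> / 2 * (((norm (z + w))\<^sup>2 + (norm (z - w))\<^sup>2) / c - 2))"
      by (simp add: algebra_simps add_divide_distrib)
    also have "\<dots> = 2 * c powr (\<alpha> / 2)" using c0 by (simp add: sum)
    also have "2 * c powr (\<alpha> / 2) = 2 * (x powr \<alpha> * (1 + r\<^sup>2) powr (\<alpha> / 2))"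
      using x by (simp add: sq[of x] powr_mult[symmetric] c_def w x_def[symmetric] algebra_simps power_mult_distrib)
    also have "\<dots> \<le> 2 * (x powr \<alpha> * (1 + \<alpha> / 2 * r powr \<alpha>))"
    proof -
      have "(1 + r\<^sup>2) powr (\<alpha> / 2) \<le> 1 + \<alpha> / 2 * r\<^sup>2"
        using powr_le_affine[of "\<alpha> / 2" "1 + r\<^sup>2"] \<alpha> by simp
      moreover have "r\<^sup>2 \<le> r powr \<alpha>" using powr_mono'[of \<alpha> 2 r] \<alpha> r by simp
      ultimately have "(1 + r\<^sup>2) powr (\<alpha> / 2) \<le> 1 + \<alpha> / 2 * r powr \<alpha>"
        using \<alpha> by (smt (verit) mult_left_mono divide_pos_pos)
      then show ?thesis by (intro mult_left_mono) auto
    qed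
    also have "2 * (x powr \<alpha> * (1 + \<alpha> / 2 * r powr \<alpha>)) = 2 * norm z powr \<alpha> + \<alpha> * norm w powr \<alpha>"
      using x r by (simp add: w powr_mult x_def[symmetric] algebra_simps)
    finally have "norm (z + w) powr \<alpha> + norm (z - w) powr \<alpha> \<le> 2 * norm z powr \<alpha> + \<alpha> * norm w powr \<alpha>" .
    moreover have "min (norm z powr \<alpha>) (norm w powr \<alpha>) = norm w powr \<alpha>"
      using le \<alpha> by (auto simp: min_def powr_mono2 intro: antisym)
    ultimately show ?thesis by (simp add: algebra_simps)
  qed
  show ?thesis
  proof (cases "norm w \<le> norm z")
    case False
    then show ?thesis using *[of z w]
      by (simp add: add.commute norm_minus_commute min.commute)
  qed (rule *)
qed

lemma abs_exp_minus_diff_le: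
  fixes x y :: real
  assumes "0 \<le> x" "0 \<le> y"
  shows "\<bar>exp (- x) - exp (- y)\<bar> \<le> \<bar>x - y\<bar>"
proof -
  have *: "exp (- x) - exp (- y) \<le> y - x" if "0 \<le> x" "x \<le> y" for x y :: real
  proof -
    have "exp (- x) - exp (- y) = exp (- x) * (1 - exp (- (y - x)))"
      by (simp add: right_diff_distrib exp_add[symmetric])
    also have "\<dots> \<le> 1 * (1 - exp (- (y - x)))" using that by (intro mult_right_mono) auto
    also have "\<dots> = 1 - exp (x - y)" by simp
    also have "\<dots> \<le> y - x" using exp_ge_add_one_self[of "x - y"] by linarith
    finally show ?thesis .
  qed
  show ?thesis
  proof (cases "x \<le> y")
    case True
    then show ?thesis using *[of x y] assms by simp
  next
    case False
    then show ?thesis using *[of y x] assms by simp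
  qed
qed

text \<open>The comparison function may depend on \<epsilon>. The factor 2 leaves room for the mass
  of \<open>{0..<L} \<inter> T\<close>, which may exceed \<open>L\<close> but not
  \<open>2 * L\<close> once \<open>L \<ge> 1\<close>.\<close>

lemma tendsto_0_approx:
  fixes g :: "'b \<Rightarrow> 'a::real_normed_vector"
  assumes "\<And>\<epsilon>::real. \<epsilon> > 0 \<Longrightarrow> \<exists>h::'b \<Rightarrow> 'a. (h \<longlongrightarrow> 0) F \<and> (\<forall>\<^sub>F x in F. norm (g x) \<le> norm (h x) + 2 * \<epsilon>)"
  shows "(g \<longlongrightarrow> 0) F"
proof (rule tendstoI)
  fix e :: real assume "e > 0"
  then obtain h :: "'b \<Rightarrow> 'a" where h: "(h \<longlongrightarrow> 0) F" "\<forall>\<^sub>F x in F. norm (g x) \<le> norm (h x) + 2 * (e / 4)"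
    using assms[of "e / 4"] by auto
  have "\<forall>\<^sub>F x in F. dist (h x) 0 < e / 2" using h(1) \<open>e > 0\<close> by (intro tendstoD) auto
  with h(2) show "\<forall>\<^sub>F x in F. dist (g x) 0 < e" by eventually_elim (simp add: dist_norm)
qed

text \<open>Recovers an unbounded variable from bounded trigonometric functions of it, hence from
  characters; this serves measurability of the process and, later, vanishing of a variable with
  trivial characteristic function.\<close>

lemma LIMSEQ_mult_sin: "(\<lambda>n. real (Suc n) * sin (x / real (Suc n))) \<longlonglongrightarrow> x"
proof (cases "x = 0")
  case False
  have "((\<lambda>h::real. sin h / h) \<longlongrightarrow> 1) (at 0)"
    using DERIV_D[OF DERIV_sin[of "0::real"]] by simp
  moreover have "filterlim (\<lambda>n. x / real (Suc n)) (at 0) sequentially"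
  proof (rule filterlim_atI)
    have "(\<lambda>n. x * inverse (real (Suc n))) \<longlonglongrightarrow> x * 0"
      by (intro tendsto_mult tendsto_const LIMSEQ_inverse_real_of_nat)
    then show "(\<lambda>n. x / real (Suc n)) \<longlonglongrightarrow> 0" by (simp add: divide_inverse)
  qed (use False in auto)
  ultimately have "(\<lambda>n. sin (x / real (Suc n)) / (x / real (Suc n))) \<longlonglongrightarrow> 1"
    by (rule filterlim_compose)
  from tendsto_mult[OF tendsto_const this, of x] False show ?thesis
    by (simp add: field_simps del: of_nat_Suc)
qed simp

section \<open>Time averages\<close>

locale time_set =
  fixes T :: "real set"
  assumes T_cases: "T = \<int> \<or> T = UNIV"
begin

abbreviation "tm \<equiv> time_measure T"

text \<open>The divisor is \<open>L\<close>, as in the definition of ergodicity, and not the mass of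
  the window; for positive \<open>L\<close> and \<open>T = \<int>\<close> the two differ by less
  than 1.\<close>

definition avg :: "(real \<Rightarrow> 'a::{banach, second_countable_topology}) \<Rightarrow> real \<Rightarrow> 'a" where
  "avg c L = (1 / L) *\<^sub>R (LINT t:{0..<L} \<inter> T|tm. c t)"

lemma T_add [intro]: "s \<in> T \<Longrightarrow> t \<in> T \<Longrightarrow> s + t \<in> T"
  and T_diff [intro]: "s \<in> T \<Longrightarrow> t \<in> T \<Longrightarrow> s - t \<in> T"
  and T_minus [intro]: "s \<in> T \<Longrightarrow> - s \<in> T"
  and T_of_nat [simp, intro]: "real k \<in> T"
  and T_0 [simp, intro]: "0 \<in> T"
  and T_1 [simp, intro]: "1 \<in> T"
  using T_cases by auto

lemma Ints_neq_UNIV: "(\<int> :: real set) \<noteq> UNIV"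
proof
  assume "(\<int> :: real set) = UNIV"
  then have "(1/2 :: real) \<in> \<int>" by simp
  then show False by (auto elim!: Ints_cases)
qed

lemma space_tm [simp]: "space tm = T"
  using T_cases by (auto simp: time_measure_def)

lemma sets_tm: "A \<in> sets borel \<Longrightarrow> A \<inter> T \<in> sets tm"
  using T_cases Ints_neq_UNIV by (auto simp: time_measure_def)

lemma tm_Ints: "T = \<int> \<Longrightarrow> tm = count_space \<int>"
  using Ints_neq_UNIV by (simp add: time_measure_def)

lemma distr_tm_add:
  assumes "s \<in> T"
  shows "(\<lambda>t. t + s) \<in> measurable tm tm" "distr tm tm (\<lambda>t. t + s) = tm"
proof -
  have *: "(\<lambda>t. t + s) \<in> measurable tm tm \<and> distr tm tm (\<lambda>t. t + s) = tm"
  proof (cases "T = UNIV")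
    case True
    moreover have "distr lborel lborel (\<lambda>t. t + s) = lborel"
      using lborel_distr_plus[of s] by (simp add: add.commute cong: distr_cong)
    ultimately show ?thesis by (simp add: time_measure_def)
  next
    case False
    then have T: "T = \<int>" using T_cases by auto
    have "bij_betw (\<lambda>t. t + s) T T"
      by (rule bij_betwI[where g = "\<lambda>t. t - s"]) (use assms in auto)
    then show ?thesis using T assms tm_Ints by (auto simp: distr_bij_count_space)
  qed
  show "(\<lambda>t. t + s) \<in> measurable tm tm" "distr tm tm (\<lambda>t. t + s) = tm" using * by auto
qed

lemma interval_Int_T_sets [measurable, simp]:
  "{a..<b} \<inter> T \<in> sets tm"
  by (intro sets_tm) auto

lemma emeasure_unit: "emeasure tm ({0..<1} \<inter> T) = 1"
proof (cases "T = UNIV")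
  case True
  then show ?thesis by (simp add: time_measure_def)
next
  case False
  then have T: "T = \<int>" using T_cases by auto
  have "{0..<1} \<inter> (\<int> :: real set) = {0}" by (auto elim!: Ints_cases)
  then show ?thesis using T tm_Ints by simp
qed

lemma emeasure_shift:
  "emeasure tm ({real k..<1 + real k} \<inter> T) = 1"
proof -
  have "emeasure tm ({real k..<1 + real k} \<inter> T)
    = emeasure (distr tm tm (\<lambda>t. t + real k)) ({real k..<1 + real k} \<inter> T)"
    by (simp add: distr_tm_add)
  also have "\<dots> = emeasure tm ((\<lambda>t. t + real k) -` ({real k..<1 + real k} \<inter> T) \<inter> T)"
    by (subst emeasure_distr) (auto intro: distr_tm_add)
  also have "(\<lambda>t. t + real k) -` ({real k..<1 + real k} \<inter> T) \<inter> T = {0..<1} \<inter> T"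
    by auto
  finally show ?thesis by (simp add: emeasure_unit)
qed

lemma emeasure_nat: "emeasure tm ({0..<real n} \<inter> T) = of_nat n"
proof (induction n)
  case (Suc n)
  have "{0..<real (Suc n)} \<inter> T = ({0..<real n} \<inter> T) \<union> ({real n..<1 + real n} \<inter> T)" by auto
  then have "emeasure tm ({0..<real (Suc n)} \<inter> T)
    = emeasure tm ({0..<real n} \<inter> T) + emeasure tm ({real n..<1 + real n} \<inter> T)"
    by (simp only:) (rule plus_emeasure[symmetric]; auto)
  then show ?case using Suc by (simp add: emeasure_shift add.commute)
qed simp

lemma emeasure_interval_finite: "emeasure tm ({0..<L} \<inter> T) < \<infinity>"
proof -
  obtain n where "L \<le> real n" using real_arch_simple by blast
  then have "emeasure tm ({0..<L} \<inter> T) \<le> emeasure tm ({0..<real n} \<inter> T)"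
    by (intro emeasure_mono) auto
  also have "\<dots> < \<infinity>" by (simp add: emeasure_nat of_nat_less_top)
  finally show ?thesis .
qed

lemma measure_nat: "measure tm ({0..<real n} \<inter> T) = n"
  by (simp add: measure_def emeasure_nat)

lemma measure_mono_interval: "L \<le> L' \<Longrightarrow> measure tm ({0..<L} \<inter> T) \<le> measure tm ({0..<L'} \<inter> T)"
  using emeasure_interval_finite
  by (intro measure_mono_fmeasurable) (auto simp: fmeasurable_def)

lemma measure_interval:
  assumes "0 \<le> L"
  shows "L - 1 \<le> measure tm ({0..<L} \<inter> T)" "measure tm ({0..<L} \<inter> T) \<le> L + 1"
proof -
  have "measure tm ({0..<real (nat \<lfloor>L\<rfloor>)} \<inter> T) \<le> measure tm ({0..<L} \<inter> T)"
    using assms by (intro measure_mono_interval) simp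
  moreover have "measure tm ({0..<L} \<inter> T) \<le> measure tm ({0..<real (nat \<lceil>L\<rceil>)} \<inter> T)"
    using assms by (intro measure_mono_interval) simp
  moreover have "real (nat \<lfloor>L\<rfloor>) \<ge> L - 1" "real (nat \<lceil>L\<rceil>) \<le> L + 1" using assms by linarith+
  ultimately show "L - 1 \<le> measure tm ({0..<L} \<inter> T)" "measure tm ({0..<L} \<inter> T) \<le> L + 1"
    unfolding measure_nat by linarith+
qed

lemma set_integrable_bounded:
  fixes c :: "real \<Rightarrow> 'a::{banach, second_countable_topology}"
  assumes "c \<in> borel_measurable tm" "\<And>t. t \<in> T \<Longrightarrow> norm (c t) \<le> C"
    "A \<in> sets tm" "emeasure tm A < \<infinity>"
  shows "set_integrable tm A c"
  unfolding set_integrable_def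
  by (rule integrableI_bounded_set[where A = A and B = C]) (use assms in \<open>auto split: split_indicator\<close>)

text \<open>Folds time modulo 1: an integral over \<open>{0..<real n}\<close> becomes an integral
  over offsets \<open>s\<close> in the unit cell of sums along \<open>s + real k\<close>. This is
  what lets the powers of one map govern a flow in real time; for \<open>T = \<int>\<close> the cell
  is just 0.\<close>

lemma integral_interval_nat:
  fixes c :: "real \<Rightarrow> real"
  assumes c: "c \<in> borel_measurable tm" "\<And>t. t \<in> T \<Longrightarrow> norm (c t) \<le> C"
  shows "(LINT t:{0..<real n} \<inter> T|tm. c t) = (\<Sum>k<n. LINT s:{0..<1} \<inter> T|tm. c (s + real k))"
proof (induction n)
  case 0
  then show ?case by (simp add: set_lebesgue_integral_def)
next
  case (Suc n)
  have *: "{0..<real (Suc n)} \<inter> T = ({0..<real n} \<inter> T) \<union> ({real n..<1 + real n} \<inter> T)" by auto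
  have "(LINT t:{0..<real (Suc n)} \<inter> T|tm. c t)
    = (LINT t:{0..<real n} \<inter> T|tm. c t) + (LINT t:{real n..<1 + real n} \<inter> T|tm. c t)"
    unfolding *
    by (rule set_integral_Un) (auto intro!: set_integrable_bounded[OF c] emeasure_interval_finite
        simp: emeasure_shift)
  also have "(LINT t:{real n..<1 + real n} \<inter> T|tm. c t)
    = (LINT t|distr tm tm (\<lambda>t. t + real n). indicator ({real n..<1 + real n} \<inter> T) t *\<^sub>R c t)"
    by (simp add: set_lebesgue_integral_def distr_tm_add)
  also have "\<dots> = (LINT t|tm. indicator ({real n..<1 + real n} \<inter> T) (t + real n) *\<^sub>R c (t + real n))"
    using c by (intro integral_distr) (auto intro: distr_tm_add)
  also have "\<dots> = (LINT s:{0..<1} \<inter> T|tm. c (s + real n))"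
    unfolding set_lebesgue_integral_def
    by (intro Bochner_Integration.integral_cong) (auto split: split_indicator)
  finally show ?case by (simp add: Suc)
qed

text \<open>The Cesaro sums are bounded by \<open>C\<close> on the unit cell, so dominated
  convergence turns convergence at every offset into convergence along integer
  \<open>L\<close>.\<close>

lemma avg_tendsto_0I:
  fixes c :: "real \<Rightarrow> real"
  assumes c: "c \<in> borel_measurable tm" "\<And>t. t \<in> T \<Longrightarrow> 0 \<le> c t" "\<And>t. t \<in> T \<Longrightarrow> c t \<le> C"
    and lim: "\<And>s. s \<in> T \<Longrightarrow> (\<lambda>n. (\<Sum>k<n. c (s + real k)) / real n) \<longlonglongrightarrow> 0"
  shows "(avg c \<longlongrightarrow> 0) at_top"
proof -
  have c': "norm (c t) \<le> C" if "t \<in> T" for t using c(2,3)[OF that] by simp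
  have cm: "(\<lambda>s. c (s + real k)) \<in> borel_measurable tm" for k
    using measurable_compose[OF distr_tm_add(1) c(1), of "real k"] by simp
  let ?U = "{0..<1} \<inter> T"
  have C0: "0 \<le> C" using c(2,3)[OF T_0] by linarith
  have "(\<lambda>n. LINT s:?U|tm. (\<Sum>k<n. c (s + real k)) / real n) \<longlonglongrightarrow> (LINT s:?U|tm. 0)"
    unfolding set_lebesgue_integral_def
  proof (rule integral_dominated_convergence[where w = "\<lambda>s. indicator ?U s *\<^sub>R C"])
    show "integrable tm (\<lambda>s. indicator ?U s *\<^sub>R C)"
      using set_integrable_bounded[of "\<lambda>_. C" "\<bar>C\<bar>" ?U] by (simp add: set_integrable_def emeasure_unit)
    show "AE s in tm. (\<lambda>n. indicator ?U s *\<^sub>R ((\<Sum>k<n. c (s + real k)) / real n)) \<longlonglongrightarrow> indicator ?U s *\<^sub>R 0"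
      by (rule AE_I2) (intro tendsto_scaleR tendsto_const lim; simp)
    show "AE s in tm. norm (indicator ?U s *\<^sub>R ((\<Sum>k<n. c (s + real k)) / real n))
      \<le> indicator ?U s *\<^sub>R C" for n
    proof (rule AE_I2)
      fix s assume s: "s \<in> space tm"
      have "(\<Sum>k<n. c (s + real k)) \<le> (\<Sum>k<n. C)"
        using s by (intro sum_mono c) auto
      moreover have "0 \<le> (\<Sum>k<n. c (s + real k))" using s by (intro sum_nonneg c) auto
      ultimately show "norm (indicator ?U s *\<^sub>R ((\<Sum>k<n. c (s + real k)) / real n)) \<le> indicator ?U s *\<^sub>R C"
        using C0 by (auto split: split_indicator simp: divide_simps mult.commute)
    qed
  qed (auto intro!: borel_measurable_times borel_measurable_indicator borel_measurable_divide
      borel_measurable_sum cm)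
  moreover have "(LINT s:?U|tm. (\<Sum>k<n. c (s + real k)) / real n) = avg c (real n)" for n
  proof -
    have "(LINT s:?U|tm. (\<Sum>k<n. c (s + real k)) / real n)
      = (\<Sum>k<n. LINT s:?U|tm. c (s + real k)) / real n"
    proof -
      have "set_integrable tm ?U (\<lambda>s. c (s + real k))" for k
        by (rule set_integrable_bounded[where C = C])
          (use cm c'[OF T_add[OF _ T_of_nat]] in \<open>auto simp: emeasure_unit\<close>)
      then show ?thesis
        unfolding set_lebesgue_integral_def set_integrable_def
        by (simp add: sum_divide_distrib scaleR_sum_right sum_distrib_left)
    qed
    then show ?thesis by (simp add: integral_interval_nat[OF c(1) c'] avg_def)
  qed
  ultimately have lim_nat: "(\<lambda>n. avg c (real n)) \<longlonglongrightarrow> 0" by (simp add: set_lebesgue_integral_def)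
  \<comment> \<open>Real \<open>L\<close> is rounded up: for a nonnegative integrand this can only
    enlarge the integral, and \<open>\<lceil>L\<rceil> \<le> 2 * L\<close> for
    \<open>L \<ge> 1\<close> costs a factor 2.\<close>
  have "filterlim (\<lambda>L::real. nat \<lceil>L\<rceil>) sequentially at_top"
    unfolding filterlim_at_top
  proof
    fix n :: nat
    show "\<forall>\<^sub>F L::real in at_top. n \<le> nat \<lceil>L\<rceil>"
      using eventually_ge_at_top[of "real n"] by eventually_elim linarith
  qed
  from tendsto_mult[OF tendsto_const filterlim_compose[OF lim_nat this], of 2]
  have "((\<lambda>L::real. 2 * avg c (real (nat \<lceil>L\<rceil>))) \<longlongrightarrow> 0) at_top" by simp
  moreover have "\<forall>\<^sub>F L::real in at_top. norm (avg c L) \<le> 2 * avg c (real (nat \<lceil>L\<rceil>))"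
    using eventually_ge_at_top[of 1]
  proof eventually_elim
    case (elim L)
    define n where "n = nat \<lceil>L\<rceil>"
    have n: "L \<le> real n" "real n \<le> 2 * L" using elim by (auto simp: n_def) linarith
    have int: "set_integrable tm ({0..<L} \<inter> T) c" for L
      by (rule set_integrable_bounded[OF c(1) c' interval_Int_T_sets emeasure_interval_finite])
    have "0 \<le> (LINT t:{0..<L} \<inter> T|tm. c t)"
      unfolding set_lebesgue_integral_def using c(2)
      by (intro integral_nonneg_AE AE_I2) (auto split: split_indicator)
    moreover have "(LINT t:{0..<L} \<inter> T|tm. c t) \<le> (LINT t:{0..<real n} \<inter> T|tm. c t)"
      using int unfolding set_lebesgue_integral_def set_integrable_def
      by (intro integral_mono) (use c(2) n in \<open>auto split: split_indicator\<close>)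
    ultimately have "(LINT t:{0..<L} \<inter> T|tm. c t) / L \<le> (LINT t:{0..<real n} \<inter> T|tm. c t) * (2 / real n)"
      and "0 \<le> (LINT t:{0..<L} \<inter> T|tm. c t)"
      using n elim
      by (auto simp: divide_inverse intro!: mult_mono) (simp add: field_simps)
    then show ?case using elim by (simp add: avg_def n_def[symmetric] field_simps)
  qed
  ultimately show ?thesis by (auto intro: Lim_null_comparison)
qed

text \<open>A partial converse. The offsets whose whole orbit \<open>s + real k\<close> stays at or
  above \<open>\<delta>\<close> form a set \<open>Z\<close> that adds at least
  \<open>\<delta> * measure tm Z\<close> to the integral over every unit interval, so vanishing
  averages force \<open>Z\<close> to be null.\<close>

lemma avg_tendsto_0_AE:
  fixes c :: "real \<Rightarrow> real"
  assumes c: "c \<in> borel_measurable tm" "\<And>t. t \<in> T \<Longrightarrow> 0 \<le> c t" "\<And>t. t \<in> T \<Longrightarrow> c t \<le> C"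
    and lim: "((\<lambda>n. avg c (real n)) \<longlonglongrightarrow> 0)" and \<delta>: "0 < \<delta>"
  shows "AE s in tm. s \<in> {0..<1} \<longrightarrow> (\<exists>k. c (s + real k) < \<delta>)"
proof -
  have c': "norm (c t) \<le> C" if "t \<in> T" for t using c(2,3)[OF that] by simp
  have cm [measurable]: "(\<lambda>s. c (s + real k)) \<in> borel_measurable tm" for k
    using measurable_compose[OF distr_tm_add(1) c(1), of "real k"] by simp
  define Z where "Z = {s \<in> space tm. s \<in> {0..<1} \<inter> T \<and> (\<forall>k. \<delta> \<le> c (s + real k))}"
  have Z [measurable]: "Z \<in> sets tm"
    unfolding Z_def by measurable
  have Zsub: "Z \<subseteq> {0..<1} \<inter> T" by (auto simp: Z_def)
  have Zfin: "emeasure tm Z < \<infinity>"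
    using emeasure_mono[OF Zsub, of tm] emeasure_unit by (auto simp: le_less_trans)
  have "\<delta> * measure tm Z \<le> avg c (real n)" if "n > 0" for n
  proof -
    have "(\<Sum>k<n. \<delta> * measure tm Z) \<le> (\<Sum>k<n. LINT s:{0..<1} \<inter> T|tm. c (s + real k))"
    proof (rule sum_mono)
      fix k
      have "\<delta> * measure tm Z = (LINT s:Z|tm. \<delta>)"
        using Zfin Zsub by (simp add: set_lebesgue_integral_def Int_absorb2)
      also have "\<dots> \<le> (LINT s:{0..<1} \<inter> T|tm. c (s + real k))"
      proof -
        have "set_integrable tm Z (\<lambda>_. \<delta>)"
          by (rule set_integrable_bounded[where C = \<delta>]) (use \<delta> Zfin in auto)
        moreover have "set_integrable tm ({0..<1} \<inter> T) (\<lambda>s. c (s + real k))"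
          by (rule set_integrable_bounded[where C = C]) (use c' in \<open>auto simp: emeasure_unit\<close>)
        ultimately show ?thesis
          unfolding set_lebesgue_integral_def set_integrable_def
          by (intro integral_mono) (use c(2) Zsub in \<open>auto split: split_indicator simp: Z_def\<close>)
      qed
      finally show "\<delta> * measure tm Z \<le> (LINT s:{0..<1} \<inter> T|tm. c (s + real k))" .
    qed
    then show ?thesis
      using that by (simp add: avg_def integral_interval_nat[OF c(1) c'] field_simps)
  qed
  then have "\<delta> * measure tm Z \<le> 0"
    by (intro LIMSEQ_le_const[OF lim] exI[of _ 1]) auto
  then have "measure tm Z = 0" using \<delta> by (simp add: mult_le_0_iff measure_nonneg antisym)
  then have "emeasure tm Z = 0" using Zfin by (simp add: emeasure_eq_ennreal_measure)
  then have "Z \<in> null_sets tm" by auto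
  then show ?thesis
    by (rule AE_I') (auto simp: Z_def not_less)
qed

section \<open>Linearity, monotonicity and stability of averages\<close>

lemma avg_add:
  fixes c d :: "real \<Rightarrow> 'a::{banach, second_countable_topology}"
  assumes "c \<in> borel_measurable tm" "\<And>t. t \<in> T \<Longrightarrow> norm (c t) \<le> C"
    and "d \<in> borel_measurable tm" "\<And>t. t \<in> T \<Longrightarrow> norm (d t) \<le> D"
  shows "avg (\<lambda>t. c t + d t) L = avg c L + avg d L"
  unfolding avg_def
  by (subst set_integral_add(2))
    (use set_integrable_bounded[OF assms(1,2) interval_Int_T_sets emeasure_interval_finite]
      set_integrable_bounded[OF assms(3,4) interval_Int_T_sets emeasure_interval_finite]
      in \<open>auto simp: scaleR_add_right\<close>)

lemma avg_const: "0 < L \<Longrightarrow> avg (\<lambda>_. z) L = (measure tm ({0..<L} \<inter> T) / L) *\<^sub>R z"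
  using emeasure_interval_finite[of L]
  by (simp add: avg_def set_lebesgue_integral_def divide_inverse mult.commute)

lemma avg_mono:
  fixes c d :: "real \<Rightarrow> real"
  assumes "c \<in> borel_measurable tm" "\<And>t. t \<in> T \<Longrightarrow> norm (c t) \<le> C"
    and "d \<in> borel_measurable tm" "\<And>t. t \<in> T \<Longrightarrow> norm (d t) \<le> D"
    and le: "\<And>t. t \<in> T \<Longrightarrow> c t \<le> d t" and L: "0 < L"
  shows "avg c L \<le> avg d L"
  unfolding avg_def set_lebesgue_integral_def
  by (intro scaleR_left_mono integral_mono)
    (use set_integrable_bounded[OF assms(1,2) interval_Int_T_sets emeasure_interval_finite]
      set_integrable_bounded[OF assms(3,4) interval_Int_T_sets emeasure_interval_finite] L le
      in \<open>auto simp: set_integrable_def split: split_indicator\<close>)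

lemma norm_avg_le:
  fixes c :: "real \<Rightarrow> 'a::{banach, second_countable_topology}"
  assumes L: "0 < L"
  shows "norm (avg c L) \<le> avg (\<lambda>t. norm (c t)) L"
  unfolding avg_def set_lebesgue_integral_def
  using integral_norm_bound[of tm "\<lambda>t. indicator ({0..<L} \<inter> T) t *\<^sub>R c t"] L
  by (simp add: divide_right_mono)

lemma norm_avg_le_approx:
  fixes c d :: "real \<Rightarrow> 'a::{banach, second_countable_topology}"
  assumes c: "c \<in> borel_measurable tm" "\<And>t. t \<in> T \<Longrightarrow> norm (c t) \<le> C"
    and d: "d \<in> borel_measurable tm" "\<And>t. t \<in> T \<Longrightarrow> norm (d t) \<le> D"
    and approx: "\<And>t. t \<in> T \<Longrightarrow> norm (c t - d t) \<le> \<epsilon>" and L: "1 \<le> L"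
  shows "norm (avg c L) \<le> norm (avg d L) + 2 * \<epsilon>"
proof -
  have cd: "(\<lambda>t. c t - d t) \<in> borel_measurable tm" using c d by simp
  have \<epsilon>: "0 \<le> \<epsilon>" using approx[OF T_0] norm_ge_zero order_trans by blast
  have "avg c L = avg d L + avg (\<lambda>t. c t - d t) L"
    using avg_add[OF d cd approx, of L] by simp
  moreover have "norm (avg (\<lambda>t. c t - d t) L) \<le> 2 * \<epsilon>"
  proof -
    have "norm (avg (\<lambda>t. c t - d t) L) \<le> avg (\<lambda>t. norm (c t - d t)) L"
      using L by (intro norm_avg_le) simp
    also have "\<dots> \<le> avg (\<lambda>_. \<epsilon>) L"
      using L cd approx \<epsilon> by (intro avg_mono[where C = \<epsilon> and D = \<epsilon>]) auto
    also have "\<dots> = measure tm ({0..<L} \<inter> T) / L * \<epsilon>" using L by (simp add: avg_const)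
    also have "\<dots> \<le> 2 * \<epsilon>"
      using measure_interval(2)[of L] L \<epsilon> by (intro mult_right_mono) (auto simp: divide_simps)
    finally show ?thesis .
  qed
  ultimately show ?thesis using norm_triangle_ineq[of "avg d L" "avg (\<lambda>t. c t - d t) L"] by simp
qed

text \<open>Exactly the closure properties used to pass from covariances of generators to
  covariances of their mean limits. Measurability, zero mean and zero absolute mean are three
  instances.\<close>

definition closed_class :: "(real \<Rightarrow> complex) set \<Rightarrow> bool" where
  "closed_class \<C> \<longleftrightarrow>
     (\<forall>c\<in>\<C>. \<forall>d\<in>\<C>. (\<lambda>t. c t + d t) \<in> \<C>) \<and> (\<forall>z. \<forall>c\<in>\<C>. (\<lambda>t. z * c t) \<in> \<C>) \<and>
     (\<forall>c. (\<forall>\<epsilon>>0. \<exists>d\<in>\<C>. \<forall>t\<in>T. norm (c t - d t) \<le> \<epsilon>) \<longrightarrow> c \<in> \<C>)"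

lemma closed_classD:
  assumes "closed_class \<C>"
  shows "c \<in> \<C> \<Longrightarrow> d \<in> \<C> \<Longrightarrow> (\<lambda>t. c t + d t) \<in> \<C>" "c \<in> \<C> \<Longrightarrow> (\<lambda>t. z * c t) \<in> \<C>"
    "(\<And>\<epsilon>. \<epsilon> > 0 \<Longrightarrow> \<exists>d\<in>\<C>. \<forall>t\<in>T. norm (c t - d t) \<le> \<epsilon>) \<Longrightarrow> c \<in> \<C>"
  using assms unfolding closed_class_def by auto

text \<open>Taking \<open>d\<close> as its own approximant at every precision makes values off
  \<open>T\<close> irrelevant, where the shifts are not controlled.\<close>

lemma closed_class_cong:
  assumes "closed_class \<C>" "d \<in> \<C>" "\<And>t. t \<in> T \<Longrightarrow> c t = d t"
  shows "c \<in> \<C>"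
  by (rule closed_classD(3)[OF assms(1)]) (use assms in \<open>auto intro!: bexI[of _ d]\<close>)

definition bdd :: "(real \<Rightarrow> complex) \<Rightarrow> bool" where
  "bdd c \<longleftrightarrow> (\<exists>C. \<forall>t\<in>T. norm (c t) \<le> C)"

text \<open>Ergodicity puts the covariances of events into this class; weak mixing corresponds to
  \<open>density_zero_class\<close>.\<close>

definition mean_zero_class :: "(real \<Rightarrow> complex) set" where
  "mean_zero_class = {c \<in> borel_measurable tm. bdd c \<and> (avg c \<longlongrightarrow> 0) at_top}"

definition density_zero_class :: "(real \<Rightarrow> complex) set" where
  "density_zero_class =
     {c \<in> borel_measurable tm. bdd c \<and> (avg (\<lambda>t. norm (c t)) \<longlongrightarrow> 0) at_top}"

lemma borel_measurable_uniform_approx: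
  fixes c :: "real \<Rightarrow> complex"
  assumes "\<And>\<epsilon>. \<epsilon> > 0 \<Longrightarrow> \<exists>d\<in>borel_measurable tm. \<forall>t\<in>T. norm (c t - d t) \<le> \<epsilon>"
  shows "c \<in> borel_measurable tm"
proof -
  have "\<exists>d\<in>borel_measurable tm. \<forall>t\<in>T. norm (c t - d t) \<le> inverse (real (Suc n))" for n
    by (intro assms) simp
  then obtain d where d: "\<And>n. d n \<in> borel_measurable tm"
    "\<And>n t. t \<in> T \<Longrightarrow> norm (c t - d n t) \<le> inverse (real (Suc n))" by metis
  show ?thesis
  proof (rule borel_measurable_LIMSEQ_metric[OF d(1)])
    fix t assume "t \<in> space tm"
    then have t: "t \<in> T" by simp
    show "(\<lambda>n. d n t) \<longlonglongrightarrow> c t"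
      by (rule LIM_zero_cancel, rule Lim_null_comparison[OF _ LIMSEQ_inverse_real_of_nat])
        (use d(2)[OF t] in \<open>auto simp: norm_minus_commute\<close>)
  qed
qed

lemma closed_class_measurable: "closed_class (borel_measurable tm)"
  unfolding closed_class_def
proof (intro conjI ballI allI impI)
  fix c :: "real \<Rightarrow> complex"
  assume "\<forall>\<epsilon>>0. \<exists>d\<in>borel_measurable tm. \<forall>t\<in>T. norm (c t - d t) \<le> \<epsilon>"
  then show "c \<in> borel_measurable tm" by (intro borel_measurable_uniform_approx) blast
qed auto

lemma bdd_add: "bdd c \<Longrightarrow> bdd d \<Longrightarrow> bdd (\<lambda>t. c t + d t)"
  unfolding bdd_def
  apply safe
  subgoal for C D
    by (rule exI[of _ "C + D"]) (auto intro: order_trans[OF norm_triangle_ineq] add_mono)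
  done

lemma bdd_scale: "bdd c \<Longrightarrow> bdd (\<lambda>t. z * c t)"
  unfolding bdd_def
  apply safe
  subgoal for C
    by (rule exI[of _ "norm z * C"]) (auto simp: norm_mult mult_left_mono)
  done

lemma bdd_approx: "bdd d \<Longrightarrow> (\<And>t. t \<in> T \<Longrightarrow> norm (c t - d t) \<le> \<epsilon>) \<Longrightarrow> bdd c"
  unfolding bdd_def
  apply safe
  subgoal for C
  proof (rule exI[of _ "C + \<epsilon>"], rule ballI)
    fix t assume "\<And>t. t \<in> T \<Longrightarrow> norm (c t - d t) \<le> \<epsilon>" "\<forall>t\<in>T. norm (d t) \<le> C" "t \<in> T"
    then have "norm (d t) \<le> C" "norm (c t - d t) \<le> \<epsilon>" by blast+
    then show "norm (c t) \<le> C + \<epsilon>" using norm_triangle_sub[of "c t" "d t"] by linarith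
  qed
  done

lemma closed_class_mean_zero: "closed_class mean_zero_class"
  unfolding closed_class_def
proof (intro conjI ballI allI impI)
  fix c d assume "c \<in> mean_zero_class" "d \<in> mean_zero_class"
  then obtain C D where *: "c \<in> borel_measurable tm" "d \<in> borel_measurable tm"
    "\<And>t. t \<in> T \<Longrightarrow> norm (c t) \<le> C" "\<And>t. t \<in> T \<Longrightarrow> norm (d t) \<le> D" "bdd c" "bdd d"
    "(avg c \<longlongrightarrow> 0) at_top" "(avg d \<longlongrightarrow> 0) at_top"
    by (auto simp: mean_zero_class_def bdd_def)
  have "avg (\<lambda>t. c t + d t) = (\<lambda>L. avg c L + avg d L)"
    using avg_add[OF *(1,3,2,4)] by auto
  then show "(\<lambda>t. c t + d t) \<in> mean_zero_class"
    using * tendsto_add[OF *(7,8)] by (auto simp: mean_zero_class_def bdd_add)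
next
  fix z c assume c: "c \<in> mean_zero_class"
  have "avg (\<lambda>t. z * c t) = (\<lambda>L. z * avg c L)"
    by (auto simp: avg_def set_lebesgue_integral_def)
  then show "(\<lambda>t. z * c t) \<in> mean_zero_class"
    using c tendsto_mult[OF tendsto_const, of "avg c" 0 at_top z]
    by (auto simp: mean_zero_class_def bdd_scale)
next
  fix c assume *: "\<forall>\<epsilon>>0. \<exists>d\<in>mean_zero_class. \<forall>t\<in>T. norm (c t - d t) \<le> \<epsilon>"
  have cm: "c \<in> borel_measurable tm"
    by (rule borel_measurable_uniform_approx) (use * in \<open>auto simp: mean_zero_class_def\<close>)
  have bc: "bdd c" using *[rule_format, of 1] by (auto simp: mean_zero_class_def intro: bdd_approx)
  then obtain C where C: "\<And>t. t \<in> T \<Longrightarrow> norm (c t) \<le> C" by (auto simp: bdd_def)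
  have "(avg c \<longlongrightarrow> 0) at_top"
  proof (rule tendsto_0_approx)
    fix \<epsilon> :: real assume "\<epsilon> > 0"
    with * obtain d where d: "d \<in> mean_zero_class" "\<And>t. t \<in> T \<Longrightarrow> norm (c t - d t) \<le> \<epsilon>" by blast
    then obtain D where D: "\<And>t. t \<in> T \<Longrightarrow> norm (d t) \<le> D" by (auto simp: mean_zero_class_def bdd_def)
    have "\<forall>\<^sub>F L in at_top. norm (avg c L) \<le> norm (avg d L) + 2 * \<epsilon>"
      using eventually_ge_at_top[of 1]
      by eventually_elim (use norm_avg_le_approx[OF cm C _ D d(2)] d(1) in \<open>auto simp: mean_zero_class_def\<close>)
    then show "\<exists>h::real \<Rightarrow> complex. (h \<longlongrightarrow> 0) at_top \<and> (\<forall>\<^sub>F L in at_top. norm (avg c L) \<le> norm (h L) + 2 * \<epsilon>)"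
      using d(1) by (auto simp: mean_zero_class_def)
  qed
  then show "c \<in> mean_zero_class" using cm bc by (simp add: mean_zero_class_def)
qed

lemma closed_class_density_zero: "closed_class density_zero_class"
  unfolding closed_class_def
proof (intro conjI ballI allI impI)
  fix c d assume "c \<in> density_zero_class" "d \<in> density_zero_class"
  then obtain C D where *: "c \<in> borel_measurable tm" "d \<in> borel_measurable tm"
    "\<And>t. t \<in> T \<Longrightarrow> norm (c t) \<le> C" "\<And>t. t \<in> T \<Longrightarrow> norm (d t) \<le> D" "bdd c" "bdd d"
    "(avg (\<lambda>t. norm (c t)) \<longlongrightarrow> 0) at_top" "(avg (\<lambda>t. norm (d t)) \<longlongrightarrow> 0) at_top"
    by (auto simp: density_zero_class_def bdd_def)
  have "\<forall>\<^sub>F L in at_top. norm (avg (\<lambda>t. norm (c t + d t)) L) \<le> avg (\<lambda>t. norm (c t)) L + avg (\<lambda>t. norm (d t)) L"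
    using eventually_gt_at_top[of 0]
  proof eventually_elim
    case (elim L)
    have "norm (c t + d t) \<le> C + D" "\<bar>norm (c t) + norm (d t)\<bar> \<le> C + D" if "t \<in> T" for t
      using *(3,4)[OF that] norm_triangle_ineq[of "c t" "d t"] by auto
    then have "avg (\<lambda>t. norm (c t + d t)) L \<le> avg (\<lambda>t. norm (c t) + norm (d t)) L"
      using elim *(1,2) by (intro avg_mono[where C = "C + D" and D = "C + D"]) (auto intro: norm_triangle_ineq)
    also have "\<dots> = avg (\<lambda>t. norm (c t)) L + avg (\<lambda>t. norm (d t)) L"
      using * by (intro avg_add[where C = C and D = D]) auto
    finally show ?case
      using norm_avg_le[OF elim, of "\<lambda>t. norm (c t + d t)"] by simp
  qed
  then have "(avg (\<lambda>t. norm (c t + d t)) \<longlongrightarrow> 0) at_top"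
    using tendsto_add[OF *(7,8)] by (auto intro: Lim_null_comparison)
  then show "(\<lambda>t. c t + d t) \<in> density_zero_class"
    using * by (auto simp: density_zero_class_def bdd_add)
next
  fix z c assume c: "c \<in> density_zero_class"
  have "avg (\<lambda>t. norm (z * c t)) = (\<lambda>L. norm z * avg (\<lambda>t. norm (c t)) L)"
    by (auto simp: avg_def set_lebesgue_integral_def norm_mult mult.left_commute)
  then show "(\<lambda>t. z * c t) \<in> density_zero_class"
    using c tendsto_mult[OF tendsto_const, of "avg (\<lambda>t. norm (c t))" 0 at_top "norm z"]
    by (auto simp: density_zero_class_def bdd_scale)
next
  fix c assume *: "\<forall>\<epsilon>>0. \<exists>d\<in>density_zero_class. \<forall>t\<in>T. norm (c t - d t) \<le> \<epsilon>"
  have cm: "c \<in> borel_measurable tm"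
    by (rule borel_measurable_uniform_approx) (use * in \<open>auto simp: density_zero_class_def\<close>)
  have bc: "bdd c" using *[rule_format, of 1] by (auto simp: density_zero_class_def intro: bdd_approx)
  then obtain C where C: "\<And>t. t \<in> T \<Longrightarrow> norm (c t) \<le> C" by (auto simp: bdd_def)
  have "(avg (\<lambda>t. norm (c t)) \<longlongrightarrow> 0) at_top"
  proof (rule tendsto_0_approx)
    fix \<epsilon> :: real assume "\<epsilon> > 0"
    with * obtain d where d: "d \<in> density_zero_class" "\<And>t. t \<in> T \<Longrightarrow> norm (c t - d t) \<le> \<epsilon>" by blast
    then obtain D where D: "\<And>t. t \<in> T \<Longrightarrow> norm (d t) \<le> D" by (auto simp: density_zero_class_def bdd_def)
    have le: "norm (norm (c t) - norm (d t)) \<le> \<epsilon>" if "t \<in> T" for t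
      using norm_triangle_ineq3[of "c t" "d t"] d(2)[OF that] by simp
    have "\<forall>\<^sub>F L in at_top. norm (avg (\<lambda>t. norm (c t)) L) \<le> norm (avg (\<lambda>t. norm (d t)) L) + 2 * \<epsilon>"
      using eventually_ge_at_top[of 1]
      by eventually_elim
        (rule norm_avg_le_approx[where C = C and D = D], use d(1) cm C D le in \<open>auto simp: density_zero_class_def\<close>)
    then show "\<exists>h::real \<Rightarrow> real. (h \<longlongrightarrow> 0) at_top \<and>
        (\<forall>\<^sub>F L in at_top. norm (avg (\<lambda>t. norm (c t)) L) \<le> norm (h L) + 2 * \<epsilon>)"
      using d(1) by (auto simp: density_zero_class_def)
  qed
  then show "c \<in> density_zero_class" using cm bc by (simp add: density_zero_class_def)
qed

end

section \<open>Approximation in mean by linear spans\<close>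

text \<open>Lists make the two operations on characters syntactic: concatenation multiplies them,
  and mapping over the times shifts them.\<close>

definition lin_comb :: "(complex \<times> real) list \<Rightarrow> (real \<Rightarrow> complex) \<Rightarrow> complex" where
  "lin_comb l x = (\<Sum>(z, t)\<leftarrow>l. z * x t)"

lemma lin_comb_simps [simp]:
  "lin_comb [] x = 0" "lin_comb ((z, t) # l) x = z * x t + lin_comb l x"
  "lin_comb (l @ l') x = lin_comb l x + lin_comb l' x"
  by (simp_all add: lin_comb_def)

lemma lin_comb_map_shift: "lin_comb (map (\<lambda>(z, t). (z, t + s)) l) x = lin_comb l (\<lambda>t. x (t + s))"
  by (induction l) auto

lemma lin_comb_conv_sum: "lin_comb l x = (\<Sum>j<length l. fst (l ! j) * x (snd (l ! j)))"
  by (simp add: lin_comb_def sum_list_sum_nth atLeast0LessThan case_prod_beta)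

lemma lin_comb_cong: "(\<And>z t. (z, t) \<in> set l \<Longrightarrow> x t = y t) \<Longrightarrow> lin_comb l x = lin_comb l y"
  unfolding lin_comb_def by (intro arg_cong[where f = sum_list] map_cong) auto

lemma borel_measurable_lin_comb [measurable (raw)]:
  assumes "\<And>z t. (z, t) \<in> set l \<Longrightarrow> (\<lambda>w. x w t) \<in> borel_measurable M"
  shows "(\<lambda>w. lin_comb l (x w)) \<in> borel_measurable M"
  using assms
proof (induction l)
  case (Cons p l)
  obtain z t where p: "p = (z, t)" by (cases p)
  have "(\<lambda>w. x w t) \<in> borel_measurable M" using Cons.prems by (auto simp: p)
  moreover have "(\<lambda>w. lin_comb l (x w)) \<in> borel_measurable M" using Cons.prems by (intro Cons.IH) auto
  ultimately show ?case by (simp add: p)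
qed simp

text \<open>Generated inductively, so that statements about a bilinear covariance follow by
  induction on one argument at a time.\<close>

inductive_set cspan :: "('w \<Rightarrow> complex) set \<Rightarrow> ('w \<Rightarrow> complex) set" for S where
  base: "F \<in> S \<Longrightarrow> F \<in> cspan S"
| add: "F \<in> cspan S \<Longrightarrow> G \<in> cspan S \<Longrightarrow> (\<lambda>\<omega>. F \<omega> + G \<omega>) \<in> cspan S"
| scale: "F \<in> cspan S \<Longrightarrow> (\<lambda>\<omega>. z * F \<omega>) \<in> cspan S"

lemma cspan_mult:
  assumes S: "\<And>F G. F \<in> S \<Longrightarrow> G \<in> S \<Longrightarrow> (\<lambda>\<omega>. F \<omega> * G \<omega>) \<in> S"
    and F: "F \<in> cspan S" and G: "G \<in> cspan S"
  shows "(\<lambda>\<omega>. F \<omega> * G \<omega>) \<in> cspan S"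
  using F
proof induction
  case (base F)
  from G show ?case
  proof induction
    case (base G)
    then show ?case using \<open>F \<in> S\<close> by (intro cspan.base S)
  next
    case (add G G')
    then show ?case using cspan.add[OF add.IH] by (simp add: distrib_left)
  next
    case (scale G z)
    then show ?case using cspan.scale[OF scale.IH, of z] by (simp add: mult.left_commute)
  qed
next
  case (add F F')
  then show ?case using cspan.add[OF add.IH] by (simp add: distrib_right)
next
  case (scale F z)
  then show ?case using cspan.scale[OF scale.IH, of z] by (simp add: mult.assoc)
qed

lemma cspan_sum:
  assumes "finite I" "S \<noteq> {}" "\<And>i. i \<in> I \<Longrightarrow> F i \<in> S"
  shows "(\<lambda>\<omega>. \<Sum>i\<in>I. c i * F i \<omega>) \<in> cspan S"
  using assms(1,3)
proof (induction I)
  case empty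
  obtain G where "G \<in> S" using assms(2) by auto
  then show ?case using cspan.scale[OF cspan.base, of G S 0] by simp
next
  case (insert i I)
  then show ?case using cspan.add[OF cspan.scale[OF cspan.base, of "F i" S "c i"] insert.IH] by simp
qed

section \<open>Closures in mean and a monotone class argument\<close>

definition bounded_rv :: "'w measure \<Rightarrow> ('w \<Rightarrow> complex) \<Rightarrow> bool" where
  "bounded_rv P F \<longleftrightarrow> F \<in> borel_measurable P \<and> (\<exists>C. \<forall>\<omega>\<in>space P. norm (F \<omega>) \<le> C)"

text \<open>Boundedness is kept because a covariance is continuous in mean in one argument only
  while the other stays bounded.\<close>

definition L1_closure :: "'w measure \<Rightarrow> ('w \<Rightarrow> complex) set \<Rightarrow> ('w \<Rightarrow> complex) set" where
  "L1_closure P S = {F. bounded_rv P F \<and>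
     (\<forall>\<epsilon>>0. \<exists>p\<in>cspan S. (LINT \<omega>|P. norm (F \<omega> - p \<omega>)) \<le> \<epsilon>)}"

lemma bounded_rv_const [simp]: "bounded_rv P (\<lambda>_. z)"
  by (auto simp: bounded_rv_def)

lemma bounded_rv_add: "bounded_rv P F \<Longrightarrow> bounded_rv P G \<Longrightarrow> bounded_rv P (\<lambda>\<omega>. F \<omega> + G \<omega>)"
  unfolding bounded_rv_def
  apply (safe; (intro borel_measurable_add)?; simp?)
  subgoal for C D
    by (rule exI[of _ "C + D"]) (auto intro: order_trans[OF norm_triangle_ineq] add_mono)
  done

lemma bounded_rv_mult: "bounded_rv P F \<Longrightarrow> bounded_rv P G \<Longrightarrow> bounded_rv P (\<lambda>\<omega>. F \<omega> * G \<omega>)"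
  unfolding bounded_rv_def
  apply (safe; (intro borel_measurable_times)?; simp?)
  subgoal for C D
    by (rule exI[of _ "C * D"]) (auto simp: norm_mult intro!: mult_mono')
  done

lemma bounded_rv_scale: "bounded_rv P F \<Longrightarrow> bounded_rv P (\<lambda>\<omega>. z * F \<omega>)"
  using bounded_rv_mult[of P "\<lambda>_. z" F] by simp

lemma bounded_rv_diff: "bounded_rv P F \<Longrightarrow> bounded_rv P G \<Longrightarrow> bounded_rv P (\<lambda>\<omega>. F \<omega> - G \<omega>)"
  using bounded_rv_add[OF _ bounded_rv_scale, of P F G "-1"] by simp

lemma bounded_rv_indicator: "A \<in> sets P \<Longrightarrow> bounded_rv P (indicator A)"
  by (auto simp: bounded_rv_def intro!: exI[of _ 1] split: split_indicator)

lemma bounded_rv_cspan: "F \<in> cspan S \<Longrightarrow> (\<And>G. G \<in> S \<Longrightarrow> bounded_rv P G) \<Longrightarrow> bounded_rv P F"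
  by (induction rule: cspan.induct) (auto intro: bounded_rv_add bounded_rv_scale)

context prob_space
begin

lemma bounded_rv_integrable: "bounded_rv M F \<Longrightarrow> integrable M F"
  unfolding bounded_rv_def by (auto intro!: integrable_const_bound)

lemma L1_closure_bounded: "F \<in> L1_closure M S \<Longrightarrow> bounded_rv M F"
  by (simp add: L1_closure_def)

lemma L1_closure_closed:
  assumes S: "\<And>G. G \<in> S \<Longrightarrow> bounded_rv M G"
    and F: "bounded_rv M F"
    and approx: "\<And>\<epsilon>. \<epsilon> > 0 \<Longrightarrow> \<exists>G\<in>L1_closure M S. (LINT \<omega>|M. norm (F \<omega> - G \<omega>)) \<le> \<epsilon>"
  shows "F \<in> L1_closure M S"
  unfolding L1_closure_def
proof (safe intro!: F)
  fix \<epsilon> :: real assume "\<epsilon> > 0"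
  then obtain G where G: "G \<in> L1_closure M S" "(LINT \<omega>|M. norm (F \<omega> - G \<omega>)) \<le> \<epsilon> / 2"
    using approx[of "\<epsilon> / 2"] by auto
  then obtain p where p: "p \<in> cspan S" "(LINT \<omega>|M. norm (G \<omega> - p \<omega>)) \<le> \<epsilon> / 2"
    using \<open>\<epsilon> > 0\<close> unfolding L1_closure_def by (auto dest!: spec[of _ "\<epsilon> / 2"])
  have bp: "bounded_rv M p" using p(1) S by (rule bounded_rv_cspan)
  have bG: "bounded_rv M G" using G(1) by (rule L1_closure_bounded)
  have int: "integrable M (\<lambda>\<omega>. norm (F \<omega> - G \<omega>))" "integrable M (\<lambda>\<omega>. norm (G \<omega> - p \<omega>))"
    "integrable M (\<lambda>\<omega>. norm (F \<omega> - p \<omega>))"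
    by (intro integrable_norm bounded_rv_integrable bounded_rv_diff F bp bG)+
  have "(LINT \<omega>|M. norm (F \<omega> - p \<omega>)) \<le> (LINT \<omega>|M. norm (F \<omega> - G \<omega>) + norm (G \<omega> - p \<omega>))"
    using int dist_triangle[of "F \<omega>" "p \<omega>" "G \<omega>" for \<omega>]
    by (intro integral_mono Bochner_Integration.integrable_add) (auto simp: dist_norm)
  also have "\<dots> \<le> \<epsilon>" using int G(2) p(2) by simp
  finally show "\<exists>p\<in>cspan S. (LINT \<omega>|M. norm (F \<omega> - p \<omega>)) \<le> \<epsilon>" using p(1) by auto
qed

lemma L1_closure_base:
  assumes "F \<in> cspan S" "\<And>G. G \<in> S \<Longrightarrow> bounded_rv M G"
  shows "F \<in> L1_closure M S"
  unfolding L1_closure_def using bounded_rv_cspan[OF assms] assms(1) by (auto intro!: bexI[of _ F])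

lemma L1_closure_add:
  assumes S: "\<And>G. G \<in> S \<Longrightarrow> bounded_rv M G"
    and F: "F \<in> L1_closure M S" and G: "G \<in> L1_closure M S"
  shows "(\<lambda>\<omega>. F \<omega> + G \<omega>) \<in> L1_closure M S"
  unfolding L1_closure_def
proof safe
  note b = F[THEN L1_closure_bounded] G[THEN L1_closure_bounded]
  then show "bounded_rv M (\<lambda>\<omega>. F \<omega> + G \<omega>)" by (rule bounded_rv_add)
  fix \<epsilon> :: real assume "\<epsilon> > 0"
  then obtain p q where p: "p \<in> cspan S" "(LINT \<omega>|M. norm (F \<omega> - p \<omega>)) \<le> \<epsilon> / 2"
    and q: "q \<in> cspan S" "(LINT \<omega>|M. norm (G \<omega> - q \<omega>)) \<le> \<epsilon> / 2"
    using F G unfolding L1_closure_def by (force dest!: spec[of _ "\<epsilon> / 2"])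
  have bp: "bounded_rv M p" "bounded_rv M q" using p(1) q(1) S by (auto intro: bounded_rv_cspan)
  have int: "integrable M (\<lambda>\<omega>. norm (F \<omega> - p \<omega>))" "integrable M (\<lambda>\<omega>. norm (G \<omega> - q \<omega>))"
    "integrable M (\<lambda>\<omega>. norm (F \<omega> + G \<omega> - (p \<omega> + q \<omega>)))"
    by (intro integrable_norm bounded_rv_integrable bounded_rv_diff bounded_rv_add b bp)+
  have "(LINT \<omega>|M. norm (F \<omega> + G \<omega> - (p \<omega> + q \<omega>)))
    \<le> (LINT \<omega>|M. norm (F \<omega> - p \<omega>) + norm (G \<omega> - q \<omega>))"
    using int by (intro integral_mono Bochner_Integration.integrable_add) (auto simp: norm_diff_triangle_ineq)
  also have "\<dots> \<le> \<epsilon>" using int p(2) q(2) by simp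
  finally show "\<exists>p\<in>cspan S. (LINT \<omega>|M. norm (F \<omega> + G \<omega> - p \<omega>)) \<le> \<epsilon>"
    using cspan.add[OF p(1) q(1)] by (auto intro!: bexI)
qed

lemma LINT_norm_mult_le:
  assumes "bounded_rv M H" "bounded_rv M F" "\<And>\<omega>. \<omega> \<in> space M \<Longrightarrow> norm (F \<omega>) \<le> C"
  shows "(LINT \<omega>|M. norm (F \<omega> * H \<omega>)) \<le> C * (LINT \<omega>|M. norm (H \<omega>))"
proof -
  have "(LINT \<omega>|M. norm (F \<omega> * H \<omega>)) \<le> (LINT \<omega>|M. C * norm (H \<omega>))"
    using assms
    by (intro integral_mono integrable_norm bounded_rv_integrable bounded_rv_mult integrable_mult_right)
      (auto simp: norm_mult mult_right_mono)
  then show ?thesis by simp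
qed

lemma L1_closure_mult_span:
  assumes S: "\<And>G. G \<in> S \<Longrightarrow> bounded_rv M G"
    and mult: "\<And>F G. F \<in> S \<Longrightarrow> G \<in> S \<Longrightarrow> (\<lambda>\<omega>. F \<omega> * G \<omega>) \<in> S"
    and F: "F \<in> L1_closure M S" and q: "q \<in> cspan S"
  shows "(\<lambda>\<omega>. q \<omega> * F \<omega>) \<in> L1_closure M S"
  unfolding L1_closure_def
proof safe
  note bF = F[THEN L1_closure_bounded]
  have bq: "bounded_rv M q" using q S by (rule bounded_rv_cspan)
  then show "bounded_rv M (\<lambda>\<omega>. q \<omega> * F \<omega>)" using bF by (rule bounded_rv_mult)
  obtain C where C: "\<And>\<omega>. \<omega> \<in> space M \<Longrightarrow> norm (q \<omega>) \<le> C" using bq by (auto simp: bounded_rv_def)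
  have C': "norm (q \<omega>) \<le> \<bar>C\<bar> + 1" if "\<omega> \<in> space M" for \<omega> using C[OF that] by simp
  fix \<epsilon> :: real assume "\<epsilon> > 0"
  then have "\<epsilon> / (\<bar>C\<bar> + 1) > 0" by simp
  then obtain p where p: "p \<in> cspan S" "(LINT \<omega>|M. norm (F \<omega> - p \<omega>)) \<le> \<epsilon> / (\<bar>C\<bar> + 1)"
    using F unfolding L1_closure_def by blast
  have "(LINT \<omega>|M. norm (q \<omega> * (F \<omega> - p \<omega>))) \<le> (\<bar>C\<bar> + 1) * (LINT \<omega>|M. norm (F \<omega> - p \<omega>))"
    using p(1) S by (intro LINT_norm_mult_le bounded_rv_diff bF bq C') (auto intro: bounded_rv_cspan)
  also have "\<dots> \<le> (\<bar>C\<bar> + 1) * (\<epsilon> / (\<bar>C\<bar> + 1))" using p(2) by (intro mult_left_mono) auto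
  also have "\<dots> = \<epsilon>" by (simp add: add_nonneg_eq_0_iff)
  finally show "\<exists>p\<in>cspan S. (LINT \<omega>|M. norm (q \<omega> * F \<omega> - p \<omega>)) \<le> \<epsilon>"
  proof (intro bexI[where x = "\<lambda>\<omega>. q \<omega> * p \<omega>"])
    show "(\<lambda>\<omega>. q \<omega> * p \<omega>) \<in> cspan S"
      by (rule cspan_mult) (fact mult q p(1))+
  qed (simp add: right_diff_distrib)
qed

text \<open>Approximants in mean have no common bound, so the two factors cannot be replaced at
  once. Replacing \<open>F\<close> by \<open>p\<close> costs only the bound of \<open>G\<close>, and
  the product of \<open>p\<close> and \<open>G\<close> lies in the closure by
  \<open>L1_closure_mult_span\<close>, since the fixed \<open>p\<close> is bounded.\<close>

lemma L1_closure_mult: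
  assumes S: "\<And>G. G \<in> S \<Longrightarrow> bounded_rv M G"
    and mult: "\<And>F G. F \<in> S \<Longrightarrow> G \<in> S \<Longrightarrow> (\<lambda>\<omega>. F \<omega> * G \<omega>) \<in> S"
    and F: "F \<in> L1_closure M S" and G: "G \<in> L1_closure M S"
  shows "(\<lambda>\<omega>. F \<omega> * G \<omega>) \<in> L1_closure M S"
proof (rule L1_closure_closed[OF S])
  note b = F[THEN L1_closure_bounded] G[THEN L1_closure_bounded]
  then show "bounded_rv M (\<lambda>\<omega>. F \<omega> * G \<omega>)" by (rule bounded_rv_mult)
  obtain C where C: "\<And>\<omega>. \<omega> \<in> space M \<Longrightarrow> norm (G \<omega>) \<le> C" using b(2) by (auto simp: bounded_rv_def)
  have C': "norm (G \<omega>) \<le> \<bar>C\<bar> + 1" if "\<omega> \<in> space M" for \<omega> using C[OF that] by simp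
  fix \<epsilon> :: real assume "\<epsilon> > 0"
  then have "\<epsilon> / (\<bar>C\<bar> + 1) > 0" by simp
  then obtain p where p: "p \<in> cspan S" "(LINT \<omega>|M. norm (F \<omega> - p \<omega>)) \<le> \<epsilon> / (\<bar>C\<bar> + 1)"
    using F unfolding L1_closure_def by blast
  have "(LINT \<omega>|M. norm (G \<omega> * (F \<omega> - p \<omega>))) \<le> (\<bar>C\<bar> + 1) * (LINT \<omega>|M. norm (F \<omega> - p \<omega>))"
    using p(1) S by (intro LINT_norm_mult_le bounded_rv_diff b C') (auto intro: bounded_rv_cspan)
  also have "\<dots> \<le> (\<bar>C\<bar> + 1) * (\<epsilon> / (\<bar>C\<bar> + 1))" using p(2) by (intro mult_left_mono) auto
  also have "\<dots> = \<epsilon>" by (simp add: add_nonneg_eq_0_iff)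
  finally show "\<exists>H\<in>L1_closure M S. (LINT \<omega>|M. norm (F \<omega> * G \<omega> - H \<omega>)) \<le> \<epsilon>"
  proof (intro bexI[where x = "\<lambda>\<omega>. p \<omega> * G \<omega>"])
    show "(\<lambda>\<omega>. p \<omega> * G \<omega>) \<in> L1_closure M S"
      by (rule L1_closure_mult_span) (fact S mult G p(1))+
  qed (simp add: right_diff_distrib mult.commute)
qed

lemma L1_closure_LIMSEQ:
  assumes S: "\<And>G. G \<in> S \<Longrightarrow> bounded_rv M G"
    and F: "\<And>n. F n \<in> L1_closure M S"
    and bnd: "\<And>n \<omega>. \<omega> \<in> space M \<Longrightarrow> norm (F n \<omega>) \<le> C"
    and lim: "\<And>\<omega>. \<omega> \<in> space M \<Longrightarrow> (\<lambda>n. F n \<omega>) \<longlonglongrightarrow> G \<omega>"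
  shows "G \<in> L1_closure M S"
proof (rule L1_closure_closed[OF S])
  have Fm: "F n \<in> borel_measurable M" for n using L1_closure_bounded[OF F] by (simp add: bounded_rv_def)
  have Gm: "G \<in> borel_measurable M" by (rule borel_measurable_LIMSEQ_metric[OF Fm lim])
  have GC: "norm (G \<omega>) \<le> C" if "\<omega> \<in> space M" for \<omega>
    using tendsto_norm[OF lim[OF that]] bnd[OF that] by (intro LIMSEQ_le_const2) auto
  then show bG: "bounded_rv M G" using Gm by (auto simp: bounded_rv_def)
  have "(\<lambda>n. LINT \<omega>|M. norm (G \<omega> - F n \<omega>)) \<longlonglongrightarrow> (LINT \<omega>|M. 0)"
  proof (rule integral_dominated_convergence[where w = "\<lambda>_. 2 * C"])
    show "AE \<omega> in M. (\<lambda>n. norm (G \<omega> - F n \<omega>)) \<longlonglongrightarrow> 0"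
    proof (rule AE_I2)
      fix \<omega> assume "\<omega> \<in> space M"
      then have "(\<lambda>n. norm (G \<omega> - F n \<omega>)) \<longlonglongrightarrow> norm (G \<omega> - G \<omega>)"
        by (intro tendsto_intros lim)
      then show "(\<lambda>n. norm (G \<omega> - F n \<omega>)) \<longlonglongrightarrow> 0" by simp
    qed
    show "AE \<omega> in M. norm (norm (G \<omega> - F n \<omega>)) \<le> 2 * C" for n
      using GC bnd[of _ n] by (intro AE_I2) (smt (verit) norm_triangle_ineq4 real_norm_def norm_ge_zero)
  qed (use Fm Gm in auto)
  then have lim0: "(\<lambda>n. LINT \<omega>|M. norm (G \<omega> - F n \<omega>)) \<longlonglongrightarrow> 0" by simp
  fix \<epsilon> :: real assume "\<epsilon> > 0"
  then obtain n where "(LINT \<omega>|M. norm (G \<omega> - F n \<omega>)) < \<epsilon>"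
    using eventually_happens'[OF sequentially_bot order_tendstoD(2)[OF lim0 \<open>\<epsilon> > 0\<close>]] by blast
  then show "\<exists>H\<in>L1_closure M S. (LINT \<omega>|M. norm (G \<omega> - H \<omega>)) \<le> \<epsilon>"
    using F[of n] by (auto intro!: bexI[of _ "F n"])
qed

end

text \<open>Setting of a functional monotone class argument: the closure of \<open>S\<close> becomes
  an algebra stable under bounded pointwise limits, and the events with indicator in it form a
  \<sigma>-algebra.\<close>

locale mult_class = prob_space +
  fixes S :: "('a \<Rightarrow> complex) set"
  assumes bounded: "G \<in> S \<Longrightarrow> bounded_rv M G"
    and mult: "F \<in> S \<Longrightarrow> G \<in> S \<Longrightarrow> (\<lambda>\<omega>. F \<omega> * G \<omega>) \<in> S"
    and one: "(\<lambda>_. 1) \<in> S"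
begin

abbreviation "cl \<equiv> L1_closure M S"

lemma cl_const: "(\<lambda>_. z) \<in> cl"
  using L1_closure_base[OF cspan.scale[OF cspan.base[OF one], of z] bounded] by simp

lemma cl_mult: "F \<in> cl \<Longrightarrow> G \<in> cl \<Longrightarrow> (\<lambda>\<omega>. F \<omega> * G \<omega>) \<in> cl"
  by (rule L1_closure_mult) (auto intro: bounded mult)

lemma cl_add: "F \<in> cl \<Longrightarrow> G \<in> cl \<Longrightarrow> (\<lambda>\<omega>. F \<omega> + G \<omega>) \<in> cl"
  by (rule L1_closure_add) (auto intro: bounded)

lemma cl_LIMSEQ:
  assumes "\<And>n. F n \<in> cl" "\<And>n \<omega>. \<omega> \<in> space M \<Longrightarrow> norm (F n \<omega>) \<le> C"
    and "\<And>\<omega>. \<omega> \<in> space M \<Longrightarrow> (\<lambda>n. F n \<omega>) \<longlonglongrightarrow> G \<omega>"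
  shows "G \<in> cl"
  by (rule L1_closure_LIMSEQ[OF bounded assms])

lemma cl_diff: "F \<in> cl \<Longrightarrow> G \<in> cl \<Longrightarrow> (\<lambda>\<omega>. F \<omega> - G \<omega>) \<in> cl"
  using cl_add[OF _ cl_mult[OF cl_const[of "-1"]], of F G] by simp

lemma cl_polynomial:
  fixes g :: "real \<Rightarrow> real"
  assumes "real_polynomial_function g" and y: "(\<lambda>\<omega>. complex_of_real (y \<omega>)) \<in> cl"
  shows "(\<lambda>\<omega>. complex_of_real (g (y \<omega>))) \<in> cl"
  using assms(1)
proof induction
  case (linear g)
  then obtain c where "g = (\<lambda>x. x * c)" using real_bounded_linear by auto
  then show ?case using cl_mult[OF y cl_const[of c]] by simp
next
  case (const c)
  then show ?case by (rule cl_const)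
next
  case (add f g)
  then show ?case using cl_add[OF add.IH] by simp
next
  case (mult f g)
  then show ?case using cl_mult[OF mult.IH] by simp
qed

text \<open>Members of the closure are bounded, so \<open>y\<close> takes values in a compact
  interval and Weierstrass approximation applies there.\<close>

lemma cl_continuous:
  fixes g :: "real \<Rightarrow> real"
  assumes g: "continuous_on UNIV g" and y: "(\<lambda>\<omega>. complex_of_real (y \<omega>)) \<in> cl"
  shows "(\<lambda>\<omega>. complex_of_real (g (y \<omega>))) \<in> cl"
proof -
  obtain C where C: "\<And>\<omega>. \<omega> \<in> space M \<Longrightarrow> \<bar>y \<omega>\<bar> \<le> C"
    and ym: "(\<lambda>\<omega>. complex_of_real (y \<omega>)) \<in> borel_measurable M"
    using L1_closure_bounded[OF y] by (auto simp: bounded_rv_def)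
  have "\<exists>p. real_polynomial_function p \<and> (\<forall>x\<in>{-C..C}. \<bar>g x - p x\<bar> < 1 / Suc n)" for n
  proof -
    have "compact {-C..C}" "continuous_on {-C..C} g" "0 < 1 / real (Suc n)"
      using continuous_on_subset[OF g] by auto
    from Stone_Weierstrass_real_polynomial_function[OF this] show ?thesis by metis
  qed
  then obtain p where p: "\<And>n. real_polynomial_function (p n)"
    "\<And>n x. x \<in> {-C..C} \<Longrightarrow> \<bar>g x - p n x\<bar> < 1 / Suc n" by metis
  have "compact (g ` {-C..C})" using continuous_on_subset[OF g] by (intro compact_continuous_image) auto
  then obtain D where "\<forall>z\<in>g ` {-C..C}. norm z \<le> D"
    using compact_imp_bounded bounded_iff by blast
  then have D: "\<And>x. x \<in> {-C..C} \<Longrightarrow> \<bar>g x\<bar> \<le> D" by auto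
  show ?thesis
  proof (rule cl_LIMSEQ[where F = "\<lambda>n \<omega>. complex_of_real (p n (y \<omega>))" and C = "D + 1"])
    show "(\<lambda>\<omega>. complex_of_real (p n (y \<omega>))) \<in> cl" for n by (rule cl_polynomial[OF p(1) y])
    fix \<omega> assume \<omega>: "\<omega> \<in> space M"
    then have y: "y \<omega> \<in> {-C..C}" using C by (auto simp: abs_le_iff minus_le_iff)
    have "1 / real (Suc n) \<le> 1" for n by simp
    then show "norm (complex_of_real (p n (y \<omega>))) \<le> D + 1" for n
      using p(2)[OF y, of n] D[OF y] by (smt (verit) norm_of_real)
    have "(\<lambda>n. p n (y \<omega>)) \<longlonglongrightarrow> g (y \<omega>)"
    proof (rule LIM_zero_cancel, rule Lim_null_comparison[OF _ LIMSEQ_inverse_real_of_nat])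
      show "\<forall>\<^sub>F n in sequentially. norm (p n (y \<omega>) - g (y \<omega>)) \<le> inverse (real (Suc n))"
        using p(2)[OF y] by (intro always_eventually) (auto simp: abs_minus_commute divide_inverse intro: less_imp_le)
    qed
    then show "(\<lambda>n. complex_of_real (p n (y \<omega>))) \<longlonglongrightarrow> complex_of_real (g (y \<omega>))"
      by (rule tendsto_of_real)
  qed
qed

definition cl_events :: "'a set set" where
  "cl_events = {A \<in> sets M. indicator A \<in> cl}"

lemma greater_in_cl_events:
  assumes y: "(\<lambda>\<omega>. complex_of_real (y \<omega>)) \<in> cl"
  shows "{\<omega> \<in> space M. c < y \<omega>} \<in> cl_events"
proof -
  have "(\<lambda>\<omega>. complex_of_real (y \<omega>)) \<in> borel_measurable M"
    using L1_closure_bounded[OF y] by (auto simp: bounded_rv_def)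
  from measurable_compose[OF this borel_measurable_Re] have [measurable]: "y \<in> borel_measurable M" by simp
  \<comment> \<open>Continuous ramps that converge pointwise to the indicator of
    \<open>c < v\<close>.\<close>
  define g where "g n v = max 0 (min 1 (real n * (v - c)))" for n :: nat and v :: real
  have "indicator {\<omega> \<in> space M. c < y \<omega>} \<in> cl"
  proof (rule cl_LIMSEQ[where F = "\<lambda>n \<omega>. complex_of_real (g n (y \<omega>))" and C = 1])
    show "(\<lambda>\<omega>. complex_of_real (g n (y \<omega>))) \<in> cl" for n
      unfolding g_def by (rule cl_continuous[OF _ y]) (intro continuous_intros)
    show "norm (complex_of_real (g n (y \<omega>))) \<le> 1" for n \<omega> by (auto simp: g_def)
    fix \<omega> assume \<omega>: "\<omega> \<in> space M"
    show "(\<lambda>n. complex_of_real (g n (y \<omega>))) \<longlonglongrightarrow> indicator {\<omega> \<in> space M. c < y \<omega>} \<omega>"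
    proof (cases "c < y \<omega>")
      case True
      obtain k where k: "1 < real k * (y \<omega> - c)" using reals_Archimedean3[of "y \<omega> - c"] True by auto
      have "g n (y \<omega>) = 1" if "n \<ge> k" for n
      proof -
        have "real k * (y \<omega> - c) \<le> real n * (y \<omega> - c)" using that True by (intro mult_right_mono) auto
        then show ?thesis using k by (simp add: g_def)
      qed
      then have "\<forall>\<^sub>F n in sequentially. complex_of_real (g n (y \<omega>)) = 1"
        by (auto simp: eventually_sequentially)
      then show ?thesis using True \<omega> by (auto intro: tendsto_eventually)
    next
      case False
      then have "real n * (y \<omega> - c) \<le> 0" for n by (intro mult_nonneg_nonpos) auto
      then have "g n (y \<omega>) = 0" for n unfolding g_def by (smt (verit))
      then show ?thesis using False by simp
    qed
  qed
  then show ?thesis by (simp add: cl_events_def)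
qed

lemma sigma_algebra_cl_events: "sigma_algebra (space M) cl_events"
proof -
  have compl: "space M - A \<in> cl_events" if "A \<in> cl_events" for A
  proof -
    have A: "A \<in> sets M" "indicator A \<in> cl" using that by (auto simp: cl_events_def)
    have "(\<lambda>\<omega>. 1 - indicator A \<omega>) \<in> cl" using A by (intro cl_diff cl_const)
    \<comment> \<open>The sequence is constant: the limit lemma serves only to replace
      \<open>1 - indicator A\<close> by a function that agrees with it on
      \<open>space M\<close>.\<close>
    then have "indicator (space M - A) \<in> cl"
      by (rule cl_LIMSEQ[where C = 1 and F = "\<lambda>_ \<omega>. 1 - indicator A \<omega>"])
        (auto split: split_indicator)
    then show ?thesis using A by (auto simp: cl_events_def)
  qed
  have inter: "A \<inter> B \<in> cl_events" if "A \<in> cl_events" "B \<in> cl_events" for A B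
  proof -
    have "indicator (A \<inter> B) = (\<lambda>\<omega>. indicator A \<omega> * indicator B \<omega> :: complex)"
      by (auto simp: indicator_def fun_eq_iff)
    then show ?thesis using that cl_mult[of "indicator A" "indicator B"] by (simp add: cl_events_def sets.Int)
  qed
  have union: "A \<union> B \<in> cl_events" if "A \<in> cl_events" "B \<in> cl_events" for A B
  proof -
    have "A \<subseteq> space M" "B \<subseteq> space M" using that by (auto simp: cl_events_def dest: sets.sets_into_space)
    then have "A \<union> B = space M - ((space M - A) \<inter> (space M - B))" by auto
    then show ?thesis using that by (simp add: compl inter)
  qed
  have empty: "{} \<in> cl_events" using cl_const[of 0] by (simp add: cl_events_def indicator_def[abs_def])
  show ?thesis
    unfolding sigma_algebra_iff2
  proof (intro conjI ballI allI impI compl empty)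
    show "cl_events \<subseteq> Pow (space M)" by (auto simp: cl_events_def dest: sets.sets_into_space)
    fix A :: "nat \<Rightarrow> 'a set" assume A: "range A \<subseteq> cl_events"
    have fin: "(\<Union>i<n. A i) \<in> cl_events" for n
      by (induction n) (use A in \<open>auto simp: empty lessThan_Suc intro!: union\<close>)
    have "indicator (\<Union>i. A i) \<in> cl"
    proof (rule cl_LIMSEQ[where F = "\<lambda>n. indicator (\<Union>i<n. A i)" and C = 1])
      show "indicator (\<Union>i<n. A i) \<in> cl" for n using fin by (simp add: cl_events_def)
      show "(\<lambda>n. indicator (\<Union>i<n. A i) \<omega> :: complex) \<longlonglongrightarrow> indicator (\<Union>i. A i) \<omega>" for \<omega>
        by (rule LIMSEQ_indicator_UN)
    qed (auto split: split_indicator)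
    moreover have "(\<Union>i. A i) \<in> sets M" using A by (auto simp: cl_events_def)
    ultimately show "(\<Union>i. A i) \<in> cl_events" by (simp add: cl_events_def)
  qed
qed

end

section \<open>Covariances along the shift\<close>

locale shifted_process = time_set T + P: prob_space P
  for T :: "real set" and P :: "'w measure" +
  fixes K :: "complex set" and \<theta> :: "real \<Rightarrow> 'w \<Rightarrow> 'w" and X :: "real \<Rightarrow> 'w \<Rightarrow> complex"
  assumes K_cases: "K = \<real> \<or> K = UNIV"
    and process: "process_on T K P X"
    and measurable_X: "measurable_process T P X"
    and shift: "shift_realization T P \<theta> X"
begin

lemma X_measurable: "t \<in> T \<Longrightarrow> X t \<in> borel_measurable P"
  and X_in_K: "t \<in> T \<Longrightarrow> \<omega> \<in> space P \<Longrightarrow> X t \<omega> \<in> K"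
  using process by (auto simp: process_on_def)

lemma \<theta>_measurable: "t \<in> T \<Longrightarrow> \<theta> t \<in> measurable P P"
  and distr_\<theta>: "t \<in> T \<Longrightarrow> distr P P (\<theta> t) = P"
  using shift by (auto simp: shift_realization_def)

lemma \<theta>_space: "t \<in> T \<Longrightarrow> \<omega> \<in> space P \<Longrightarrow> \<theta> t \<omega> \<in> space P"
  using \<theta>_measurable by (auto dest: measurable_space)

lemma X_\<theta>: "s \<in> T \<Longrightarrow> t \<in> T \<Longrightarrow> \<omega> \<in> space P \<Longrightarrow> X s (\<theta> t \<omega>) = X (s + t) \<omega>"
  using shift \<theta>_space[of t \<omega>] by (auto simp: shift_realization_def T_add)

lemma bounded_rv_\<theta>: "bounded_rv P F \<Longrightarrow> t \<in> T \<Longrightarrow> bounded_rv P (\<lambda>\<omega>. F (\<theta> t \<omega>))"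
  using measurable_compose[OF \<theta>_measurable] \<theta>_space unfolding bounded_rv_def by blast

lemma LINT_\<theta>:
  fixes F :: "'w \<Rightarrow> 'b::{banach, second_countable_topology}"
  assumes "F \<in> borel_measurable P" "t \<in> T"
  shows "(LINT \<omega>|P. F (\<theta> t \<omega>)) = (LINT \<omega>|P. F \<omega>)"
  using integral_distr[OF \<theta>_measurable[OF assms(2)] assms(1)] by (simp add: distr_\<theta> assms(2))

text \<open>No conjugation, so that it is complex linear in both arguments, as the closure rules of
  \<open>closed_class\<close> require.\<close>

definition cov :: "('w \<Rightarrow> complex) \<Rightarrow> ('w \<Rightarrow> complex) \<Rightarrow> real \<Rightarrow> complex" where
  "cov F G t = (LINT \<omega>|P. F \<omega> * G (\<theta> t \<omega>)) - (LINT \<omega>|P. F \<omega>) * (LINT \<omega>|P. G \<omega>)"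

lemma integrable_mult_\<theta>:
  "bounded_rv P F \<Longrightarrow> bounded_rv P G \<Longrightarrow> t \<in> T \<Longrightarrow> integrable P (\<lambda>\<omega>. F \<omega> * G (\<theta> t \<omega>))"
  by (intro P.bounded_rv_integrable bounded_rv_mult bounded_rv_\<theta>)

lemma cov_add:
  assumes "bounded_rv P F" "bounded_rv P F'" "bounded_rv P G" "t \<in> T"
  shows "cov (\<lambda>\<omega>. F \<omega> + F' \<omega>) G t = cov F G t + cov F' G t"
    "cov G (\<lambda>\<omega>. F \<omega> + F' \<omega>) t = cov G F t + cov G F' t"
  using assms by (simp_all add: cov_def integrable_mult_\<theta> P.bounded_rv_integrable algebra_simps)

lemma cov_scale:
  shows "cov (\<lambda>\<omega>. z * F \<omega>) G t = z * cov F G t" "cov F (\<lambda>\<omega>. z * G \<omega>) t = z * cov F G t"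
  by (simp_all add: cov_def algebra_simps)

lemma cov_diff:
  assumes "bounded_rv P F" "bounded_rv P F'" "bounded_rv P G" "t \<in> T"
  shows "cov (\<lambda>\<omega>. F \<omega> - F' \<omega>) G t = cov F G t - cov F' G t"
    "cov G (\<lambda>\<omega>. F \<omega> - F' \<omega>) t = cov G F t - cov G F' t"
  using assms by (simp_all add: cov_def integrable_mult_\<theta> P.bounded_rv_integrable algebra_simps)

text \<open>The bound is the same for all \<open>t\<close> because \<open>\<theta> t\<close>
  preserves \<open>P\<close>. Approximation in mean of one argument therefore approximates the
  covariance uniformly in time.\<close>

lemma norm_cov_le:
  assumes F: "bounded_rv P F" and G: "bounded_rv P G" and t: "t \<in> T"
    and C: "\<And>\<omega>. \<omega> \<in> space P \<Longrightarrow> norm (G \<omega>) \<le> C"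
  shows "norm (cov F G t) \<le> 2 * C * (LINT \<omega>|P. norm (F \<omega>))"
    "norm (cov G F t) \<le> 2 * C * (LINT \<omega>|P. norm (F \<omega>))"
proof -
  have Gt: "norm (G (\<theta> t \<omega>)) \<le> C" if "\<omega> \<in> space P" for \<omega> using C \<theta>_space[OF t that] by blast
  have "norm (LINT \<omega>|P. F \<omega> * G (\<theta> t \<omega>)) \<le> (LINT \<omega>|P. norm (G (\<theta> t \<omega>) * F \<omega>))"
    using integral_norm_bound[of P "\<lambda>\<omega>. F \<omega> * G (\<theta> t \<omega>)"] by (simp add: mult.commute)
  also have "\<dots> \<le> C * (LINT \<omega>|P. norm (F \<omega>))"
    by (intro P.LINT_norm_mult_le F bounded_rv_\<theta> G t Gt)
  finally have 1: "norm (LINT \<omega>|P. F \<omega> * G (\<theta> t \<omega>)) \<le> C * (LINT \<omega>|P. norm (F \<omega>))" .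
  have "norm (LINT \<omega>|P. G \<omega> * F (\<theta> t \<omega>)) \<le> (LINT \<omega>|P. norm (G \<omega> * F (\<theta> t \<omega>)))"
    by (rule integral_norm_bound)
  also have "\<dots> \<le> C * (LINT \<omega>|P. norm (F (\<theta> t \<omega>)))"
    by (intro P.LINT_norm_mult_le F bounded_rv_\<theta> G t C)
  also have "(LINT \<omega>|P. norm (F (\<theta> t \<omega>))) = (LINT \<omega>|P. norm (F \<omega>))"
    using F t by (intro LINT_\<theta>) (auto simp: bounded_rv_def)
  finally have 2: "norm (LINT \<omega>|P. G \<omega> * F (\<theta> t \<omega>)) \<le> C * (LINT \<omega>|P. norm (F \<omega>))" .
  have "norm (LINT \<omega>|P. G \<omega>) \<le> (LINT \<omega>|P. norm (G \<omega>))" by (rule integral_norm_bound)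
  also have "\<dots> \<le> (LINT \<omega>|P. C)"
    using G C by (intro integral_mono integrable_norm P.bounded_rv_integrable) auto
  finally have "norm (LINT \<omega>|P. G \<omega>) \<le> C" by (simp add: P.prob_space)
  then have 3: "norm ((LINT \<omega>|P. F \<omega>) * (LINT \<omega>|P. G \<omega>)) \<le> C * (LINT \<omega>|P. norm (F \<omega>))"
    unfolding norm_mult mult.commute[of C]
    by (intro mult_mono integral_norm_bound) auto
  have "norm (cov F G t) \<le> norm (LINT \<omega>|P. F \<omega> * G (\<theta> t \<omega>)) + norm ((LINT \<omega>|P. F \<omega>) * (LINT \<omega>|P. G \<omega>))"
    "norm (cov G F t) \<le> norm (LINT \<omega>|P. G \<omega> * F (\<theta> t \<omega>)) + norm ((LINT \<omega>|P. F \<omega>) * (LINT \<omega>|P. G \<omega>))"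
    unfolding cov_def mult.commute[of "LINT \<omega>|P. G \<omega>"] by (rule norm_triangle_ineq4)+
  with 1 2 3 show "norm (cov F G t) \<le> 2 * C * (LINT \<omega>|P. norm (F \<omega>))"
    "norm (cov G F t) \<le> 2 * C * (LINT \<omega>|P. norm (F \<omega>))"
    by linarith+
qed

lemma cov_cspan_in_class:
  assumes \<C>: "closed_class \<C>" and S: "\<And>F. F \<in> S \<Longrightarrow> bounded_rv P F"
    and base: "\<And>F G. F \<in> S \<Longrightarrow> G \<in> S \<Longrightarrow> cov F G \<in> \<C>"
    and F: "F \<in> cspan S" and G: "G \<in> cspan S"
  shows "cov F G \<in> \<C>"
proof -
  note b = bounded_rv_cspan[of _ S P, OF _ S]
  have *: "cov F G \<in> \<C>" if G: "G \<in> S" for G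
    using F
  proof induction
    case (base F)
    then show ?case using assms(3) G by blast
  next
    case (add F F')
    then show ?case
      by (intro closed_class_cong[OF \<C> closed_classD(1)[OF \<C> add.IH]] cov_add b S[OF G])
  next
    case (scale F z)
    then show ?case
      by (intro closed_class_cong[OF \<C> closed_classD(2)[OF \<C> scale.IH, where z = z]] cov_scale)
  qed
  show ?thesis
    using G
  proof induction
    case (base G)
    then show ?case by (rule *)
  next
    case (add G G')
    then show ?case
      by (intro closed_class_cong[OF \<C> closed_classD(1)[OF \<C> add.IH]] cov_add b F)
  next
    case (scale G z)
    then show ?case
      by (intro closed_class_cong[OF \<C> closed_classD(2)[OF \<C> scale.IH, where z = z]] cov_scale)
  qed
qed

lemma cov_approx_in_class:
  assumes \<C>: "closed_class \<C>" and S: "\<And>F. F \<in> S \<Longrightarrow> bounded_rv P F"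
    and F: "F \<in> L1_closure P S" and G: "bounded_rv P G"
  shows "(\<And>p. p \<in> cspan S \<Longrightarrow> cov p G \<in> \<C>) \<Longrightarrow> cov F G \<in> \<C>"
    "(\<And>p. p \<in> cspan S \<Longrightarrow> cov G p \<in> \<C>) \<Longrightarrow> cov G F \<in> \<C>"
proof -
  note bF = P.L1_closure_bounded[OF F]
  obtain C where C: "\<And>\<omega>. \<omega> \<in> space P \<Longrightarrow> norm (G \<omega>) \<le> C" using G by (auto simp: bounded_rv_def)
  have approx: "\<exists>p\<in>cspan S. \<forall>t\<in>T. norm (cov F G t - cov p G t) \<le> \<epsilon> \<and> norm (cov G F t - cov G p t) \<le> \<epsilon>"
    if \<epsilon>: "\<epsilon> > 0" for \<epsilon> :: real
  proof -
    have "\<epsilon> / (2 * \<bar>C\<bar> + 1) > 0" using \<epsilon> by simp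
    then obtain p where p: "p \<in> cspan S" "(LINT \<omega>|P. norm (F \<omega> - p \<omega>)) \<le> \<epsilon> / (2 * \<bar>C\<bar> + 1)"
      using F unfolding L1_closure_def by blast
    have bp: "bounded_rv P p" using p(1) S by (rule bounded_rv_cspan)
    have "2 * C * (LINT \<omega>|P. norm (F \<omega> - p \<omega>)) \<le> (2 * \<bar>C\<bar> + 1) * (\<epsilon> / (2 * \<bar>C\<bar> + 1))"
      using p(2) by (intro mult_mono) (auto intro: integral_nonneg_AE)
    also have "\<dots> = \<epsilon>" by (simp add: add_nonneg_eq_0_iff)
    finally have "2 * C * (LINT \<omega>|P. norm (F \<omega> - p \<omega>)) \<le> \<epsilon>" .
    then have "\<forall>t\<in>T. norm (cov F G t - cov p G t) \<le> \<epsilon> \<and> norm (cov G F t - cov G p t) \<le> \<epsilon>"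
      using norm_cov_le[OF bounded_rv_diff[OF bF bp] G _ C] by (auto simp: cov_diff bF bp G intro: order_trans)
    then show ?thesis using p(1) by blast
  qed
  show "(\<And>p. p \<in> cspan S \<Longrightarrow> cov p G \<in> \<C>) \<Longrightarrow> cov F G \<in> \<C>"
    by (rule closed_classD(3)[OF \<C>]) (use approx in blast)
  show "(\<And>p. p \<in> cspan S \<Longrightarrow> cov G p \<in> \<C>) \<Longrightarrow> cov G F \<in> \<C>"
    by (rule closed_classD(3)[OF \<C>]) (use approx in blast)
qed

text \<open>One argument is approximated at a time: first \<open>F\<close> against the bounded
  \<open>G\<close>, then \<open>G\<close> against a fixed element of the span.\<close>

lemma cov_in_class:
  assumes \<C>: "closed_class \<C>" and S: "\<And>F. F \<in> S \<Longrightarrow> bounded_rv P F"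
    and base: "\<And>F G. F \<in> S \<Longrightarrow> G \<in> S \<Longrightarrow> cov F G \<in> \<C>"
    and F: "F \<in> L1_closure P S" and G: "G \<in> L1_closure P S"
  shows "cov F G \<in> \<C>"
proof (rule cov_approx_in_class(1)[OF \<C> S F P.L1_closure_bounded[OF G]])
  fix p assume p: "p \<in> cspan S"
  then show "cov p G \<in> \<C>"
    by (intro cov_approx_in_class(2)[OF \<C> S G] bounded_rv_cspan[OF p S] cov_cspan_in_class[OF \<C> S base])
qed

section \<open>Characters, events, and measurability of covariances in time\<close>

lemma K_scaleR: "z \<in> K \<Longrightarrow> of_real r * z \<in> K"
  using K_cases by auto

definition admissible :: "(complex \<times> real) list \<Rightarrow> bool" where
  "admissible l \<longleftrightarrow> set l \<subseteq> K \<times> T"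

definition character :: "(complex \<times> real) list \<Rightarrow> 'w \<Rightarrow> complex" where
  "character l \<omega> = exp (\<i> * of_real (Re (lin_comb l (\<lambda>t. X t \<omega>))))"

definition characters :: "('w \<Rightarrow> complex) set" where
  "characters = {character l |l. admissible l}"

definition event_indicators :: "('w \<Rightarrow> complex) set" where
  "event_indicators = {indicator A |A. A \<in> process_events T P X}"

lemma bounded_rv_character:
  assumes "admissible l"
  shows "bounded_rv P (character l)"
proof -
  have "(\<lambda>\<omega>. lin_comb l (\<lambda>t. X t \<omega>)) \<in> borel_measurable P"
    using assms X_measurable by (intro borel_measurable_lin_comb) (auto simp: admissible_def)
  then have "character l \<in> borel_measurable P"
    unfolding character_def[abs_def] by measurable
  then show ?thesis by (auto simp: bounded_rv_def character_def intro!: exI[of _ 1])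
qed

lemma character_append: "character (l @ l') \<omega> = character l \<omega> * character l' \<omega>"
  by (simp add: character_def exp_add[symmetric] algebra_simps)

lemma bounded_rv_characters: "F \<in> characters \<Longrightarrow> bounded_rv P F"
  by (auto simp: characters_def bounded_rv_character)

lemma mult_class_characters: "mult_class P characters"
proof
  fix F G assume "F \<in> characters" "G \<in> characters"
  then obtain l l' where l: "F = character l" "G = character l'" "admissible l" "admissible l'"
    by (auto simp: characters_def)
  then have "(\<lambda>\<omega>. F \<omega> * G \<omega>) = character (l @ l')" by (auto simp: character_append)
  moreover have "admissible (l @ l')" using l by (auto simp: admissible_def)
  ultimately show "(\<lambda>\<omega>. F \<omega> * G \<omega>) \<in> characters" by (auto simp: characters_def)
next
  have "(\<lambda>_. 1) = character []" by (auto simp: character_def)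
  moreover have "admissible []" by (simp add: admissible_def)
  ultimately show "(\<lambda>_. 1) \<in> characters" unfolding characters_def by blast
qed (rule bounded_rv_characters)

lemma process_events_subset: "process_events T P X \<subseteq> sets P"
  unfolding process_events_def
  by (rule sets.sigma_sets_subset) (auto intro!: measurable_sets X_measurable)

lemma sets_event_sigma:
  "sets (sigma (space P) {X t -` S \<inter> space P | t S. t \<in> T \<and> S \<in> sets borel}) = process_events T P X"
  unfolding process_events_def by (rule sets_measure_of) auto

text \<open>The sine of a multiple of \<open>Re (z * X t \<omega>)\<close> is a combination of two
  characters, so its superlevel sets are in \<open>cl_events\<close>. Rescaled sines converge to
  \<open>Re (z * X t \<omega>)\<close> itself, so each \<open>X t\<close> is measurable for the
  \<sigma>-algebra \<open>cl_events\<close>, which then contains all process events.\<close>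

lemma indicator_in_L1_closure_characters:
  assumes "A \<in> process_events T P X"
  shows "indicator A \<in> L1_closure P characters"
proof -
  interpret mult_class P characters by (rule mult_class_characters)
  interpret ce: sigma_algebra "space P" cl_events by (rule sigma_algebra_cl_events)
  define N where "N = sigma (space P) cl_events"
  have N: "sets N = cl_events" "space N = space P"
    by (simp_all add: N_def ce.space_closed)
  have Re_meas: "(\<lambda>\<omega>. Re (z * X t \<omega>)) \<in> borel_measurable N" if z: "z \<in> K" and t: "t \<in> T" for z t
  proof (rule borel_measurable_LIMSEQ_real[OF LIMSEQ_mult_sin])
    fix n
    define y where "y \<omega> = sin (Re (z * X t \<omega>) / real (Suc n))" for \<omega>
    define r where "r = 1 / real (Suc n)"
    have ch: "character [(of_real s * z, t)] \<in> cl" for s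
      by (rule P.L1_closure_base[OF cspan.base bounded_rv_characters])
        (use z t K_scaleR in \<open>auto simp: characters_def admissible_def\<close>)
    have "complex_of_real (y \<omega>) = - (\<i> / 2) * (character [(of_real r * z, t)] \<omega> - character [(of_real (- r) * z, t)] \<omega>)"
      for \<omega>
    proof -
      have ch_cis: "character [(of_real s * z, t)] \<omega> = cis (s * Re (z * X t \<omega>))" for s
        by (simp add: character_def cis_conv_exp mult.assoc del: times_complex.sel)
          (simp add: algebra_simps)
      have y_sin: "y \<omega> = sin (r * Re (z * X t \<omega>))" by (simp add: y_def r_def del: times_complex.sel)
      show ?thesis unfolding ch_cis y_sin by (simp add: complex_eq_iff)
    qed
    then have "(\<lambda>\<omega>. complex_of_real (y \<omega>)) \<in> cl"
      using cl_mult[OF cl_const[of "- (\<i> / 2)"] cl_diff[OF ch[of r] ch[of "- r"]]] by presburger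
    then have "y \<in> borel_measurable N"
      using greater_in_cl_events[of y] by (auto simp: borel_measurable_iff_greater N)
    then show "(\<lambda>\<omega>. real (Suc n) * sin (Re (z * X t \<omega>) / real (Suc n))) \<in> borel_measurable N"
      unfolding y_def[abs_def] by simp
  qed
  have "X t \<in> borel_measurable N" if t: "t \<in> T" for t
    unfolding borel_measurable_complex_iff
  proof
    have "1 \<in> K" using K_cases by auto
    then show "(\<lambda>\<omega>. Re (X t \<omega>)) \<in> borel_measurable N" using Re_meas[OF _ t, of 1] by simp
    show "(\<lambda>\<omega>. Im (X t \<omega>)) \<in> borel_measurable N"
    proof (cases "K = UNIV")
      case True
      \<comment> \<open>The imaginary part of \<open>X t \<omega>\<close> is the real part of
        \<open>- \<i> * X t \<omega>\<close>, and \<open>- \<i>\<close> is an allowed scalar in the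
        complex case.\<close>
      then show ?thesis using Re_meas[OF _ t, of "- \<i>"] by simp
    next
      case False
      then have "X t \<omega> \<in> \<real>" if "\<omega> \<in> space P" for \<omega> using X_in_K[OF t that] K_cases by auto
      then have "(\<lambda>\<omega>. Im (X t \<omega>)) \<in> borel_measurable N \<longleftrightarrow> (\<lambda>\<omega>. 0::real) \<in> borel_measurable N"
        by (intro measurable_cong) (auto simp: N complex_is_Real_iff)
      then show ?thesis by simp
    qed
  qed
  then have "X t -` S \<inter> space P \<in> cl_events" if "t \<in> T" "S \<in> sets borel" for t S
    using measurable_sets[of "X t" N borel S] that by (simp add: N)
  then have "process_events T P X \<subseteq> cl_events"
    unfolding process_events_def by (intro ce.sigma_sets_subset) auto
  then show ?thesis using assms by (auto simp: cl_events_def)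
qed

lemma bounded_rv_event_indicators: "F \<in> event_indicators \<Longrightarrow> bounded_rv P F"
  using process_events_subset by (auto simp: event_indicators_def intro!: bounded_rv_indicator)

text \<open>The density in the other direction, which turns ergodicity, stated for events, into a
  statement on characters. Simple functions are taken over the generated \<sigma>-algebra instead of
  \<open>P\<close>, so that their level sets are process events.\<close>

lemma character_in_L1_closure_events:
  assumes l: "admissible l"
  shows "character l \<in> L1_closure P event_indicators"
proof -
  define N where "N = sigma (space P) {X t -` S \<inter> space P | t S. t \<in> T \<and> S \<in> sets borel}"
  have N: "sets N = process_events T P X" "space N = space P"
    unfolding N_def by (rule sets_event_sigma) (simp add: space_measure_of_conv)
  have XN: "X t \<in> borel_measurable N" if "t \<in> T" for t
  proof (rule measurableI)
    fix S :: "complex set" assume "S \<in> sets borel"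
    then show "X t -` S \<inter> space N \<in> sets N"
      unfolding N process_events_def using that by (intro sigma_sets.Basic) auto
  qed simp
  have "(\<lambda>\<omega>. lin_comb l (\<lambda>t. X t \<omega>)) \<in> borel_measurable N"
    using l XN by (intro borel_measurable_lin_comb) (auto simp: admissible_def)
  then have meas: "character l \<in> borel_measurable N"
    unfolding character_def[abs_def] by measurable
  from borel_measurable_implies_sequence_metric[OF this, of 0]
  obtain s where "\<forall>i. simple_function N (s i)"
    "\<forall>\<omega>\<in>space N. (\<lambda>i. s i \<omega>) \<longlonglongrightarrow> character l \<omega>"
    "\<forall>i. \<forall>\<omega>\<in>space N. norm (s i \<omega>) \<le> 2 * norm (character l \<omega>)"
    by (auto simp: dist_norm)
  then have s: "\<And>i. simple_function N (s i)"
    "\<And>\<omega>. \<omega> \<in> space N \<Longrightarrow> (\<lambda>i. s i \<omega>) \<longlonglongrightarrow> character l \<omega>"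
    "\<And>i \<omega>. \<omega> \<in> space N \<Longrightarrow> norm (s i \<omega>) \<le> 2 * norm (character l \<omega>)"
    by auto
  show ?thesis
  proof (rule P.L1_closure_LIMSEQ[OF bounded_rv_event_indicators, where F = s and C = 2])
    fix i
    have sub: "s i -` {y} \<inter> space P \<in> process_events T P X" for y
      using simple_functionD(2)[OF s(1), of i "{y}"] by (simp add: N)
    define p :: "'w \<Rightarrow> complex" where
      "p = (\<lambda>\<omega>. \<Sum>y\<in>s i ` space P. y * indicator (s i -` {y} \<inter> space P) \<omega>)"
    have p: "p \<in> cspan event_indicators"
      unfolding p_def
      by (rule cspan_sum) (use simple_functionD(1)[OF s(1), of i] sub in \<open>auto simp: N event_indicators_def\<close>)
    have eq: "s i \<omega> = p \<omega>" if "\<omega> \<in> space P" for \<omega>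
    proof -
      have "p \<omega> = (\<Sum>y\<in>s i ` space P. if y = s i \<omega> then y else 0)"
        unfolding p_def using that by (intro sum.cong) auto
      then show ?thesis using that simple_functionD(1)[OF s(1), of i] by (simp add: N)
    qed
    have bp: "bounded_rv P p" by (rule bounded_rv_cspan[OF p bounded_rv_event_indicators])
    show "s i \<in> L1_closure P event_indicators"
    proof (rule P.L1_closure_closed[OF bounded_rv_event_indicators])
      show "bounded_rv P (s i)"
        using bp eq measurable_cong[of P "s i" p borel] unfolding bounded_rv_def by auto
      fix \<epsilon> :: real assume \<epsilon>: "\<epsilon> > 0"
      have "(LINT \<omega>|P. norm (s i \<omega> - p \<omega>)) = (LINT \<omega>|P. 0)"
        by (intro Bochner_Integration.integral_cong) (auto simp: eq)
      then show "\<exists>G\<in>L1_closure P event_indicators. (LINT \<omega>|P. norm (s i \<omega> - G \<omega>)) \<le> \<epsilon>"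
        using P.L1_closure_base[OF p bounded_rv_event_indicators] \<epsilon> by (intro bexI[of _ p]) auto
    qed
  next
    show "norm (s i \<omega>) \<le> 2" if "\<omega> \<in> space P" for i \<omega>
      using s(3)[of \<omega> i] that by (simp add: N character_def)
  qed (use s(2)[unfolded N] in auto)
qed

text \<open>A shift acts on a character by moving its times. For each fixed \<open>t\<close> the
  process may then be replaced by its jointly measurable modification \<open>Y\<close> without
  changing the integral, and Fubini gives measurability in \<open>t\<close>.\<close>

lemma cov_characters_measurable:
  assumes l: "admissible l" and l': "admissible l'"
  shows "cov (character l) (character l') \<in> borel_measurable tm"
proof -
  obtain Y where Y [measurable]: "(\<lambda>(t, \<omega>). Y t \<omega>) \<in> borel_measurable (tm \<Otimes>\<^sub>M P)"
    and YX: "\<And>t. t \<in> T \<Longrightarrow> AE \<omega> in P. Y t \<omega> = X t \<omega>"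
    using measurable_X by (auto simp: measurable_process_def)
  define G where "G t \<omega> = exp (\<i> * of_real (Re (lin_comb l' (\<lambda>s. Y (s + t) \<omega>))))" for t \<omega>
  have Ys: "(\<lambda>p. Y (s + fst p) (snd p)) \<in> borel_measurable (tm \<Otimes>\<^sub>M P)" if "s \<in> T" for s
  proof -
    have [measurable]: "(\<lambda>t. s + t) \<in> measurable tm tm"
      using distr_tm_add(1)[OF that] by (simp add: add.commute)
    have "(\<lambda>p. (s + fst p, snd p)) \<in> measurable (tm \<Otimes>\<^sub>M P) (tm \<Otimes>\<^sub>M P)" by measurable
    from measurable_compose[OF this Y] show ?thesis by simp
  qed
  have "(\<lambda>p. lin_comb l' (\<lambda>s. Y (s + fst p) (snd p))) \<in> borel_measurable (tm \<Otimes>\<^sub>M P)"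
    using l' Ys by (intro borel_measurable_lin_comb) (auto simp: admissible_def)
  then have [measurable]: "(\<lambda>p. G (fst p) (snd p)) \<in> borel_measurable (tm \<Otimes>\<^sub>M P)"
    unfolding G_def by measurable
  have [measurable]: "character l \<in> borel_measurable P"
    using bounded_rv_character[OF l] by (simp add: bounded_rv_def)
  have "(\<lambda>t. LINT \<omega>|P. character l \<omega> * G t \<omega>) \<in> borel_measurable tm"
  proof (rule P.borel_measurable_lebesgue_integral)
    have "(\<lambda>p. character l (snd p) * G (fst p) (snd p)) \<in> borel_measurable (tm \<Otimes>\<^sub>M P)" by measurable
    then show "(\<lambda>(t, \<omega>). character l \<omega> * G t \<omega>) \<in> borel_measurable (tm \<Otimes>\<^sub>M P)"
      by (simp add: case_prod_beta')
  qed
  moreover have "(LINT \<omega>|P. character l \<omega> * character l' (\<theta> t \<omega>)) = (LINT \<omega>|P. character l \<omega> * G t \<omega>)"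
    if t: "t \<in> T" for t
  proof (rule integral_cong_AE)
    have G_meas: "G t \<in> borel_measurable P"
      using measurable_compose[OF measurable_Pair1'[of t tm P] \<open>(\<lambda>p. G (fst p) (snd p)) \<in> _\<close>] t by simp
    then show "(\<lambda>\<omega>. character l \<omega> * G t \<omega>) \<in> borel_measurable P" by measurable
    show "(\<lambda>\<omega>. character l \<omega> * character l' (\<theta> t \<omega>)) \<in> borel_measurable P"
      using bounded_rv_\<theta>[OF bounded_rv_character[OF l'] t]
      by (intro borel_measurable_times) (auto simp: bounded_rv_def)
    \<comment> \<open>A character involves finitely many times, so the exceptional sets of the
      modification add up to a null set.\<close>
    have "AE \<omega> in P. \<forall>p\<in>set l'. Y (snd p + t) \<omega> = X (snd p + t) \<omega>"
    proof (intro AE_finite_allI)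
      fix p assume "p \<in> set l'"
      then have "p \<in> K \<times> T" using l' unfolding admissible_def by blast
      then have "snd p + t \<in> T" using t by auto
      then show "AE \<omega> in P. Y (snd p + t) \<omega> = X (snd p + t) \<omega>" by (rule YX)
    qed simp
    then show "AE \<omega> in P. character l \<omega> * character l' (\<theta> t \<omega>) = character l \<omega> * G t \<omega>"
      using AE_space
    proof eventually_elim
      case (elim \<omega>)
      have "lin_comb l' (\<lambda>s. X s (\<theta> t \<omega>)) = lin_comb l' (\<lambda>s. Y (s + t) \<omega>)"
        by (rule lin_comb_cong) (use elim l' t in \<open>force simp: admissible_def X_\<theta>\<close>)
      then show ?case by (simp add: character_def G_def)
    qed
  qed
  ultimately have "(\<lambda>t. LINT \<omega>|P. character l \<omega> * character l' (\<theta> t \<omega>)) \<in> borel_measurable tm"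
    by (subst measurable_cong[where g = "\<lambda>t. LINT \<omega>|P. character l \<omega> * G t \<omega>"]) auto
  then show ?thesis unfolding cov_def[abs_def] by simp
qed

definition joint_prob :: "'w set \<Rightarrow> 'w set \<Rightarrow> real \<Rightarrow> real" where
  "joint_prob A B t = measure P (A \<inter> (\<theta> t -` B \<inter> space P))"

lemma cov_indicator:
  assumes A: "A \<in> sets P" and B: "B \<in> sets P" and t: "t \<in> T"
  shows "cov (indicator A) (indicator B) t = of_real (joint_prob A B t - measure P A * measure P B)"
proof -
  have LINT_ind: "(LINT \<omega>|P. indicator C \<omega> :: complex) = of_real (measure P C)" if "C \<in> sets P" for C
    using that integral_of_real[where 'a = complex, of P "indicator C"] sets.sets_into_space[OF that]
    by (simp add: of_real_indicator Int_absorb2 P.emeasure_finite less_top[symmetric])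
  have "(LINT \<omega>|P. indicator A \<omega> * indicator B (\<theta> t \<omega>) :: complex)
    = (LINT \<omega>|P. indicator (A \<inter> (\<theta> t -` B \<inter> space P)) \<omega>)"
    by (intro Bochner_Integration.integral_cong) (auto split: split_indicator)
  also have "\<dots> = of_real (joint_prob A B t)"
    unfolding joint_prob_def
    by (rule LINT_ind) (use A measurable_sets[OF \<theta>_measurable[OF t] B] in auto)
  finally show ?thesis by (simp add: cov_def LINT_ind A B)
qed

lemma cov_events_measurable:
  assumes "A \<in> process_events T P X" "B \<in> process_events T P X"
  shows "cov (indicator A) (indicator B) \<in> borel_measurable tm"
proof (rule cov_in_class[OF closed_class_measurable bounded_rv_characters])
  show "cov F G \<in> borel_measurable tm" if "F \<in> characters" "G \<in> characters" for F G
    using that cov_characters_measurable by (auto simp: characters_def)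
qed (use assms in \<open>auto intro: indicator_in_L1_closure_characters\<close>)

lemma joint_prob_measurable:
  assumes A: "A \<in> process_events T P X" and B: "B \<in> process_events T P X"
  shows "joint_prob A B \<in> borel_measurable tm"
proof -
  have "joint_prob A B t = Re (cov (indicator A) (indicator B) t) + measure P A * measure P B"
    if "t \<in> T" for t
    using cov_indicator[OF _ _ that, of A B] A B process_events_subset by (auto simp: subset_eq)
  then show ?thesis
    using cov_events_measurable[OF A B] by (subst measurable_cong) auto
qed

lemma joint_prob_bounds: "0 \<le> joint_prob A B t" "joint_prob A B t \<le> 1"
  by (simp_all add: joint_prob_def)

lemma avg_const_tendsto: "((\<lambda>L. avg (\<lambda>_. z::real) L) \<longlongrightarrow> z) at_top"
proof -
  have "((\<lambda>L. measure tm ({0..<L} \<inter> T) / L) \<longlongrightarrow> 1) at_top"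
  proof (rule tendsto_sandwich)
    show "\<forall>\<^sub>F L in at_top. (L - 1) / L \<le> measure tm ({0..<L} \<inter> T) / L"
      using eventually_gt_at_top[of 0]
      by eventually_elim (use measure_interval in \<open>auto intro!: divide_right_mono\<close>)
    show "\<forall>\<^sub>F L in at_top. measure tm ({0..<L} \<inter> T) / L \<le> (L + 1) / L"
      using eventually_gt_at_top[of 0]
      by eventually_elim (use measure_interval in \<open>auto intro!: divide_right_mono\<close>)
    have inv: "((\<lambda>L::real. inverse L) \<longlongrightarrow> 0) at_top" by (rule tendsto_inverse_0_at_top) (rule filterlim_ident)
    have "((\<lambda>L::real. 1 - inverse L) \<longlongrightarrow> 1 - 0) at_top" "((\<lambda>L::real. 1 + inverse L) \<longlongrightarrow> 1 + 0) at_top"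
      by (intro tendsto_intros inv)+
    moreover have "\<forall>\<^sub>F L::real in at_top. 1 - inverse L = (L - 1) / L"
      "\<forall>\<^sub>F L::real in at_top. 1 + inverse L = (L + 1) / L"
      using eventually_gt_at_top[of 0] by (eventually_elim, simp add: field_simps)+
    ultimately show "((\<lambda>L::real. (L - 1) / L) \<longlongrightarrow> 1) at_top" "((\<lambda>L::real. (L + 1) / L) \<longlongrightarrow> 1) at_top"
      by (auto dest: Lim_transform_eventually)
  qed
  from tendsto_mult[OF this tendsto_const, of z]
  have "((\<lambda>L. measure tm ({0..<L} \<inter> T) / L * z) \<longlongrightarrow> z) at_top" by simp
  then show ?thesis
    by (rule Lim_transform_eventually)
      (use eventually_gt_at_top[of 0] in \<open>eventually_elim, simp add: avg_const\<close>)
qed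

lemma ergodic_process_altdef:
  "ergodic_process T P \<theta> X \<longleftrightarrow>
     (\<forall>A\<in>process_events T P X. \<forall>B\<in>process_events T P X.
        (avg (\<lambda>t. joint_prob A B t - measure P A * measure P B) \<longlongrightarrow> 0) at_top)"
proof -
  have "(avg (\<lambda>t. joint_prob A B t - measure P A * measure P B) \<longlongrightarrow> 0) at_top \<longleftrightarrow>
      ((\<lambda>L. 1 / L * (LINT t:{0..<L} \<inter> T|tm. measure P (A \<inter> (\<theta> t -` B \<inter> space P))))
          \<longlongrightarrow> measure P A * measure P B) at_top"
    if AB: "A \<in> process_events T P X" "B \<in> process_events T P X" for A B
  proof -
    let ?c = "measure P A * measure P B"
    have eq: "avg (\<lambda>t. joint_prob A B t - ?c) = (\<lambda>L. avg (joint_prob A B) L + avg (\<lambda>_. - ?c) L)"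
    proof
      fix L
      have "avg (\<lambda>t. joint_prob A B t + - ?c) L = avg (joint_prob A B) L + avg (\<lambda>_. - ?c) L"
        by (rule avg_add[where C = 1 and D = "\<bar>?c\<bar>"])
          (use joint_prob_measurable[OF AB] joint_prob_bounds[of A B] in auto)
      then show "avg (\<lambda>t. joint_prob A B t - ?c) L = avg (joint_prob A B) L + avg (\<lambda>_. - ?c) L"
        by simp
    qed
    have "1 / L * (LINT t:{0..<L} \<inter> T|tm. measure P (A \<inter> (\<theta> t -` B \<inter> space P))) = avg (joint_prob A B) L" for L
      by (simp add: avg_def joint_prob_def)
    moreover have "(avg (joint_prob A B) \<longlongrightarrow> ?c) at_top" if "((\<lambda>L. avg (joint_prob A B) L + avg (\<lambda>_. - ?c) L) \<longlongrightarrow> 0) at_top"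
      using tendsto_diff[OF that avg_const_tendsto[of "- ?c"]] by simp
    moreover have "((\<lambda>L. avg (joint_prob A B) L + avg (\<lambda>_. - ?c) L) \<longlongrightarrow> 0) at_top" if "(avg (joint_prob A B) \<longlongrightarrow> ?c) at_top"
      using tendsto_add[OF that avg_const_tendsto[of "- ?c"]] by simp
    ultimately show ?thesis unfolding eq by auto
  qed
  then show ?thesis unfolding ergodic_process_def by blast
qed

lemma weakly_mixing_process_altdef:
  "weakly_mixing_process T P \<theta> X \<longleftrightarrow>
     (\<forall>A\<in>process_events T P X. \<forall>B\<in>process_events T P X.
        (avg (\<lambda>t. \<bar>joint_prob A B t - measure P A * measure P B\<bar>) \<longlongrightarrow> 0) at_top)"
  by (simp add: weakly_mixing_process_def avg_def[abs_def] joint_prob_def)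

lemma weakly_mixing_imp_ergodic:
  assumes "weakly_mixing_process T P \<theta> X"
  shows "ergodic_process T P \<theta> X"
  unfolding ergodic_process_altdef
proof (intro ballI)
  fix A B assume AB: "A \<in> process_events T P X" "B \<in> process_events T P X"
  have "\<forall>\<^sub>F L in at_top. norm (avg (\<lambda>t. joint_prob A B t - measure P A * measure P B) L)
    \<le> avg (\<lambda>t. \<bar>joint_prob A B t - measure P A * measure P B\<bar>) L"
    using eventually_gt_at_top[of 0]
    by eventually_elim (use norm_avg_le[of _ "\<lambda>t. joint_prob A B t - measure P A * measure P B"] in simp)
  then show "(avg (\<lambda>t. joint_prob A B t - measure P A * measure P B) \<longlongrightarrow> 0) at_top"
    by (rule Lim_null_comparison) (use assms AB in \<open>auto simp: weakly_mixing_process_altdef\<close>)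
qed

lemma avg_cong: "(\<And>t. t \<in> T \<Longrightarrow> c t = d t) \<Longrightarrow> avg c = avg d"
  unfolding avg_def[abs_def] set_lebesgue_integral_def
  by (intro ext arg_cong2[where f = scaleR] Bochner_Integration.integral_cong refl)
    (auto split: split_indicator)

lemma weakly_mixing_if_characters:
  assumes "\<And>l l'. admissible l \<Longrightarrow> admissible l' \<Longrightarrow> cov (character l) (character l') \<in> density_zero_class"
  shows "weakly_mixing_process T P \<theta> X"
  unfolding weakly_mixing_process_altdef
proof (intro ballI)
  fix A B assume AB: "A \<in> process_events T P X" "B \<in> process_events T P X"
  then have sets: "A \<in> sets P" "B \<in> sets P" using process_events_subset by auto
  have "cov (indicator A) (indicator B) \<in> density_zero_class"
  proof (rule cov_in_class[OF closed_class_density_zero bounded_rv_characters])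
    show "cov F G \<in> density_zero_class" if "F \<in> characters" "G \<in> characters" for F G
      using that assms by (auto simp: characters_def)
  qed (use AB in \<open>auto intro: indicator_in_L1_closure_characters\<close>)
  then have "(avg (\<lambda>t. norm (cov (indicator A) (indicator B) t)) \<longlongrightarrow> 0) at_top"
    by (simp add: density_zero_class_def)
  also have "avg (\<lambda>t. norm (cov (indicator A) (indicator B) t))
    = avg (\<lambda>t. \<bar>joint_prob A B t - measure P A * measure P B\<bar>)"
    by (rule avg_cong) (simp add: cov_indicator sets del: of_real_diff of_real_mult)
  finally show "(avg (\<lambda>t. \<bar>joint_prob A B t - measure P A * measure P B\<bar>) \<longlongrightarrow> 0) at_top" .
qed

lemma ergodic_imp_characters:
  assumes erg: "ergodic_process T P \<theta> X" and l: "admissible l" "admissible l'"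
  shows "cov (character l) (character l') \<in> mean_zero_class"
proof (rule cov_in_class[OF closed_class_mean_zero, where S = event_indicators])
  fix F G assume "F \<in> event_indicators" "G \<in> event_indicators"
  then obtain A B where AB: "A \<in> process_events T P X" "B \<in> process_events T P X"
    "F = indicator A" "G = indicator B" by (auto simp: event_indicators_def)
  then have sets: "A \<in> sets P" "B \<in> sets P" using process_events_subset by auto
  let ?c = "\<lambda>t. joint_prob A B t - measure P A * measure P B"
  have "avg (cov F G) = avg (\<lambda>t. complex_of_real (?c t))"
    unfolding AB(3,4) by (rule avg_cong) (simp add: cov_indicator sets)
  also have "\<dots> = (\<lambda>L. of_real (avg ?c L))"
    by (simp add: fun_eq_iff avg_def set_lebesgue_integral_def scaleR_conv_of_real
        of_real_mult[symmetric] del: of_real_diff of_real_mult)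
  finally have "avg (cov F G) = (\<lambda>L. of_real (avg ?c L))" .
  moreover have "(avg ?c \<longlongrightarrow> 0) at_top" using erg AB by (auto simp: ergodic_process_altdef)
  then have "((\<lambda>L. complex_of_real (avg ?c L)) \<longlongrightarrow> 0) at_top" using tendsto_of_real by fastforce
  moreover have "bdd (cov F G)"
    unfolding bdd_def
  proof (intro exI ballI)
    fix t assume t: "t \<in> T"
    have "0 \<le> measure P A * measure P B" "measure P A * measure P B \<le> 1"
      by (auto intro: mult_le_one)
    then have "\<bar>joint_prob A B t - measure P A * measure P B\<bar> \<le> 1"
      using joint_prob_bounds[of A B t] by linarith
    then show "norm (cov F G t) \<le> 1"
      using t sets by (simp add: AB cov_indicator del: of_real_diff of_real_mult)
  qed
  ultimately show "cov F G \<in> mean_zero_class"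
    using cov_events_measurable[OF AB(1,2)] by (simp add: mean_zero_class_def AB(3,4))
qed (use l in \<open>auto intro: bounded_rv_event_indicators character_in_L1_closure_events\<close>)

end

section \<open>Kernels of nonsingular flows\<close>

locale stable_flow = shifted_process T P K \<theta> X + m: sigma_finite_measure m
  for T :: "real set" and P :: "'w measure" and K :: "complex set"
    and \<theta> :: "real \<Rightarrow> 'w \<Rightarrow> 'w" and X :: "real \<Rightarrow> 'w \<Rightarrow> complex" and m :: "'e measure" +
  fixes \<alpha> :: real and \<phi> :: "real \<Rightarrow> 'e \<Rightarrow> 'e" and a :: "real \<Rightarrow> 'e \<Rightarrow> complex" and f :: "'e \<Rightarrow> complex"
  assumes \<alpha>: "0 < \<alpha>" "\<alpha> < 2"
    and flow: "nonsingular_flow T m \<phi>"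
    and cocycle: "flow_cocycle T K m \<phi> a"
    and f_L_alpha: "f \<in> L_alpha K \<alpha> m"
    and representation: "integral_representation T K \<alpha> P X m (flow_kernel \<alpha> m \<phi> a f)"
begin

abbreviation F :: "real \<Rightarrow> 'e \<Rightarrow> complex" where
  "F \<equiv> flow_kernel \<alpha> m \<phi> a f"

text \<open>Infinite values of the derivative become 0 under \<open>enn2real\<close>. They occur
  only on a null set, because the image measure is \<sigma>-finite, so \<open>Dr t\<close> is still
  a density.\<close>

definition Dr :: "real \<Rightarrow> 'e \<Rightarrow> real" where
  "Dr t x = enn2real (RN_deriv m (distr m m (\<phi> (- t))) x)"

section \<open>The flow and its Radon-Nikodym derivatives\<close>

lemma \<phi>_measurable [measurable (raw)]:
  assumes "t \<in> T" shows "\<phi> t \<in> measurable m m"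
proof -
  have *: "(\<lambda>(t, x). \<phi> t x) \<in> measurable (tm \<Otimes>\<^sub>M m) m"
    using flow by (auto simp: nonsingular_flow_def)
  have "Pair t \<in> measurable m (tm \<Otimes>\<^sub>M m)" using assms by (intro measurable_Pair1') simp
  from measurable_compose[OF this *] show ?thesis by simp
qed

lemma \<phi>_space: "t \<in> T \<Longrightarrow> x \<in> space m \<Longrightarrow> \<phi> t x \<in> space m"
  using measurable_space[OF \<phi>_measurable] by blast

lemma \<phi>_add: "s \<in> T \<Longrightarrow> t \<in> T \<Longrightarrow> x \<in> space m \<Longrightarrow> \<phi> (t + s) x = \<phi> t (\<phi> s x)"
  and \<phi>_0: "x \<in> space m \<Longrightarrow> \<phi> 0 x = x"
  using flow by (auto simp: nonsingular_flow_def)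

lemma \<phi>_minus: "t \<in> T \<Longrightarrow> x \<in> space m \<Longrightarrow> \<phi> (- t) (\<phi> t x) = x"
  "t \<in> T \<Longrightarrow> x \<in> space m \<Longrightarrow> \<phi> t (\<phi> (- t) x) = x"
  using \<phi>_add[of t "- t" x] \<phi>_add[of "- t" t x] by (auto simp: \<phi>_0 T_minus)

lemma funpow_\<phi>: "x \<in> space m \<Longrightarrow> (\<phi> 1 ^^ k) x = \<phi> (real k) x"
  by (induction k) (auto simp: \<phi>_0 \<phi>_add \<phi>_space)

lemma null_sets_\<phi>: "t \<in> T \<Longrightarrow> null_sets (distr m m (\<phi> t)) = null_sets m"
  using flow by (auto simp: nonsingular_flow_def)

lemma AE_\<phi>:
  assumes "t \<in> T" "AE x in m. Q x"
  shows "AE x in m. Q (\<phi> t x)"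
proof -
  have "AE x in distr m m (\<phi> t). Q x"
    by (rule absolutely_continuous_AE[OF _ _ assms(2)])
      (use null_sets_\<phi>[OF assms(1)] in \<open>auto simp: absolutely_continuous_def\<close>)
  then show ?thesis by (rule AE_distrD[OF \<phi>_measurable[OF assms(1)]])
qed

lemma distr_\<phi>_compose:
  assumes "s \<in> T" "t \<in> T" "sets M = sets m"
  shows "distr (distr M m (\<phi> s)) m (\<phi> t) = distr M m (\<phi> (t + s))"
proof -
  have sp: "space M = space m" using assms(3) by (rule sets_eq_imp_space_eq)
  have "\<phi> s \<in> measurable M m" using \<phi>_measurable[OF assms(1)] measurable_cong_sets[OF assms(3) refl] by blast
  then have "distr (distr M m (\<phi> s)) m (\<phi> t) = distr M m (\<phi> t \<circ> \<phi> s)"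
    by (intro distr_distr \<phi>_measurable assms)
  also have "\<dots> = distr M m (\<phi> (t + s))"
    using assms sp by (intro distr_cong) (auto simp: \<phi>_add)
  finally show ?thesis .
qed

lemma distr_\<phi>_0: "sets M = sets m \<Longrightarrow> distr M m (\<phi> 0) = M"
  using sets_eq_imp_space_eq[of M m]
  by (subst distr_cong[where g = "\<lambda>x. x"]) (auto simp: \<phi>_0 distr_id2)

text \<open>An image of a \<sigma>-finite measure need not be \<sigma>-finite; here pushing it back
  by \<open>\<phi> (- t)\<close> returns \<open>m\<close>.\<close>

lemma sigma_finite_distr_\<phi>:
  assumes "t \<in> T"
  shows "sigma_finite_measure (distr m m (\<phi> t))"
proof (rule sigma_finite_measure_distr)
  show "\<phi> (- t) \<in> measurable (distr m m (\<phi> t)) m" using assms \<phi>_measurable by (simp add: T_minus)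
  have "distr (distr m m (\<phi> t)) m (\<phi> (- t)) = m"
    using assms by (subst distr_\<phi>_compose) (auto simp: distr_\<phi>_0)
  then show "sigma_finite_measure (distr (distr m m (\<phi> t)) m (\<phi> (- t)))"
    using m.sigma_finite_measure_axioms by simp
qed

lemma Dr_measurable [measurable]: "Dr t \<in> borel_measurable m"
  unfolding Dr_def[abs_def] by measurable

lemma Dr_nonneg [simp]: "0 \<le> Dr t x"
  by (simp add: Dr_def)

lemma density_Dr:
  assumes t: "t \<in> T"
  shows "density m (\<lambda>x. ennreal (Dr t x)) = distr m m (\<phi> (- t))"
proof -
  let ?N = "distr m m (\<phi> (- t))"
  have ac: "absolutely_continuous m ?N" "sets ?N = sets m"
    using null_sets_\<phi>[OF T_minus[OF t]] by (auto simp: absolutely_continuous_def)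
  have "AE x in m. RN_deriv m ?N x \<noteq> \<infinity>"
    by (rule m.RN_deriv_finite[OF sigma_finite_distr_\<phi>[OF T_minus[OF t]] ac])
  then have "AE x in m. ennreal (Dr t x) = RN_deriv m ?N x"
    by eventually_elim (auto simp: Dr_def less_top)
  then have "density m (\<lambda>x. ennreal (Dr t x)) = density m (RN_deriv m ?N)"
    by (intro density_cong) auto
  also have "\<dots> = ?N" by (rule m.density_RN_deriv[OF ac])
  finally show ?thesis .
qed

lemma Dr_pos:
  assumes t: "t \<in> T"
  shows "AE x in m. 0 < Dr t x"
proof -
  let ?Z = "{x \<in> space m. Dr t x = 0}"
  have Z: "?Z \<in> sets m" by measurable
  have "emeasure (density m (\<lambda>x. ennreal (Dr t x))) ?Z = (\<integral>\<^sup>+x. ennreal (Dr t x) * indicator ?Z x \<partial>m)"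
    using Z by (intro emeasure_density) auto
  also have "\<dots> = (\<integral>\<^sup>+x. 0 \<partial>m)" by (intro nn_integral_cong) (auto split: split_indicator)
  finally have "?Z \<in> null_sets (distr m m (\<phi> (- t)))"
    using Z by (auto simp: density_Dr[OF t] null_sets_def)
  then have "?Z \<in> null_sets m" using null_sets_\<phi>[OF T_minus[OF t]] by simp
  then show ?thesis
    by (rule AE_I') (auto simp: less_le)
qed

text \<open>Change of variables for measures. With uniqueness of densities it gives the chain rule
  \<open>Dr_cocycle\<close>, and later the transformation rule for the density of an invariant
  measure.\<close>

lemma distr_density_\<phi>:
  assumes u: "u \<in> T" and g [measurable]: "g \<in> borel_measurable m"
  shows "distr (density m g) m (\<phi> (- u)) = density m (\<lambda>x. ennreal (Dr u x) * g (\<phi> u x))"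
proof (rule measure_eqI)
  fix A assume "A \<in> sets (distr (density m g) m (\<phi> (- u)))"
  then have A [measurable]: "A \<in> sets m" by simp
  have [measurable]: "\<phi> u \<in> measurable m m" "\<phi> (- u) \<in> measurable m m"
    using u by (auto intro: \<phi>_measurable)
  have "emeasure (distr (density m g) m (\<phi> (- u))) A = emeasure (density m g) (\<phi> (- u) -` A \<inter> space m)"
    by (subst emeasure_distr) auto
  also have "\<dots> = (\<integral>\<^sup>+x. g x * indicator (\<phi> (- u) -` A \<inter> space m) x \<partial>m)"
    by (rule emeasure_density) auto
  also have "\<dots> = (\<integral>\<^sup>+x. g (\<phi> u (\<phi> (- u) x)) * indicator A (\<phi> (- u) x) \<partial>m)"
    using u by (intro nn_integral_cong) (auto simp: \<phi>_minus split: split_indicator)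
  also have "\<dots> = (\<integral>\<^sup>+y. g (\<phi> u y) * indicator A y \<partial>distr m m (\<phi> (- u)))"
    by (subst nn_integral_distr) auto
  also have "\<dots> = (\<integral>\<^sup>+y. ennreal (Dr u y) * (g (\<phi> u y) * indicator A y) \<partial>m)"
    unfolding density_Dr[OF u, symmetric] by (rule nn_integral_density) auto
  also have "\<dots> = emeasure (density m (\<lambda>x. ennreal (Dr u x) * g (\<phi> u x))) A"
    by (subst emeasure_density) (auto simp: mult.assoc)
  finally show "emeasure (distr (density m g) m (\<phi> (- u))) A
    = emeasure (density m (\<lambda>x. ennreal (Dr u x) * g (\<phi> u x))) A" .
qed simp

lemma LINT_\<phi>:
  fixes v :: "'e \<Rightarrow> real"
  assumes u: "u \<in> T" and v [measurable]: "v \<in> borel_measurable m"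
  shows "(LINT x|m. Dr u x * v (\<phi> u x)) = (LINT x|m. v x)"
proof -
  have [measurable]: "\<phi> u \<in> measurable m m" "\<phi> (- u) \<in> measurable m m"
    using u by (auto intro: \<phi>_measurable)
  have "(LINT x|m. Dr u x * v (\<phi> u x)) = (LINT x|density m (\<lambda>x. ennreal (Dr u x)). v (\<phi> u x))"
    by (subst integral_real_density) auto
  also have "\<dots> = (LINT x|m. v (\<phi> u (\<phi> (- u) x)))"
    unfolding density_Dr[OF u] by (subst integral_distr) auto
  also have "\<dots> = (LINT x|m. v x)"
    using u by (intro Bochner_Integration.integral_cong) (auto simp: \<phi>_minus)
  finally show ?thesis .
qed

lemma Dr_cocycle:
  assumes s: "s \<in> T" and u: "u \<in> T"
  shows "AE x in m. Dr (s + u) x = Dr u x * Dr s (\<phi> u x)"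
proof -
  have [measurable]: "\<phi> u \<in> measurable m m" using u by (rule \<phi>_measurable)
  have "density m (\<lambda>x. ennreal (Dr (s + u) x)) = distr m m (\<phi> (- u + - s))"
    using density_Dr[OF T_add[OF s u]] by (simp add: minus_add[of s u] add.commute)
  also have "\<dots> = distr (distr m m (\<phi> (- s))) m (\<phi> (- u))"
    using s u by (subst distr_\<phi>_compose) auto
  also have "\<dots> = density m (\<lambda>x. ennreal (Dr u x) * ennreal (Dr s (\<phi> u x)))"
    unfolding density_Dr[OF s, symmetric] by (rule distr_density_\<phi>[OF u]) auto
  finally have "AE x in m. ennreal (Dr (s + u) x) = ennreal (Dr u x) * ennreal (Dr s (\<phi> u x))"
    by (rule m.density_unique[rotated 2]) auto
  then show ?thesis
    by eventually_elim (simp add: ennreal_mult[symmetric])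
qed

section \<open>Transformation of the kernel and characteristic exponents\<close>

lemma F_L_alpha: "t \<in> T \<Longrightarrow> F t \<in> L_alpha K \<alpha> m"
  using representation by (auto simp: integral_representation_def)

lemma F_measurable: "t \<in> T \<Longrightarrow> F t \<in> borel_measurable m"
  using F_L_alpha by (auto simp: L_alpha_def)

lemma F_altdef: "F t x = a t x * of_real (Dr t x powr (1 / \<alpha>)) * f (\<phi> t x)"
  by (simp add: flow_kernel_def Dr_def)

lemma norm_a: "t \<in> T \<Longrightarrow> x \<in> space m \<Longrightarrow> norm (a t x) = 1"
  using cocycle by (auto simp: flow_cocycle_def)

text \<open>Time shift by \<open>u\<close> acts on the kernel as the isometry of
  \<open>L\<^sup>\<alpha>\<close> given by composition with \<open>\<phi> u\<close>, the weight
  \<open>Dr u\<close> and a factor of modulus one.\<close>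

lemma F_cocycle:
  assumes t: "t \<in> T" and u: "u \<in> T"
  shows "AE x in m. F (t + u) x = a u x * of_real (Dr u x powr (1 / \<alpha>)) * F t (\<phi> u x)"
proof -
  have "AE x in m. a (t + u) x = a u x * a t (\<phi> u x)"
    using cocycle t u by (auto simp: flow_cocycle_def)
  then show ?thesis using Dr_cocycle[OF t u] AE_space
    by eventually_elim (simp add: F_altdef \<phi>_add t u powr_mult)
qed

text \<open>The integral of \<open>H l t\<close> is the exponent in the characteristic function of
  the combination \<open>l\<close> of the process shifted by \<open>t\<close>. As a density it is
  blind to the cocycle \<open>a\<close>, so it transforms under \<open>\<phi> u\<close> by
  \<open>Dr u\<close> alone.\<close>

definition H :: "(complex \<times> real) list \<Rightarrow> real \<Rightarrow> 'e \<Rightarrow> real" where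
  "H l t x = norm (lin_comb l (\<lambda>s. F (s + t) x)) powr \<alpha>"

lemma H_nonneg [simp]: "0 \<le> H l t x"
  by (simp add: H_def)

lemma lin_comb_F_measurable:
  assumes "admissible l" "t \<in> T"
  shows "(\<lambda>x. lin_comb l (\<lambda>s. F (s + t) x)) \<in> borel_measurable m"
  using assms by (intro borel_measurable_lin_comb F_measurable) (auto simp: admissible_def)

lemma H_measurable: "admissible l \<Longrightarrow> t \<in> T \<Longrightarrow> H l t \<in> borel_measurable m"
  unfolding H_def[abs_def] using lin_comb_F_measurable by measurable

lemma H_cocycle:
  assumes l: "admissible l" and t: "t \<in> T" and u: "u \<in> T"
  shows "AE x in m. H l (t + u) x = Dr u x * H l t (\<phi> u x)"
proof -
  have "AE x in m. \<forall>p\<in>set l. F ((snd p + t) + u) x = a u x * of_real (Dr u x powr (1 / \<alpha>)) * F (snd p + t) (\<phi> u x)"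
  proof (intro AE_finite_allI F_cocycle u)
    fix p assume "p \<in> set l"
    then have "p \<in> K \<times> T" using l unfolding admissible_def by blast
    then show "snd p + t \<in> T" using t by auto
  qed simp
  then show ?thesis using AE_space
  proof eventually_elim
    case (elim x)
    have "lin_comb l (\<lambda>s. F (s + (t + u)) x)
      = lin_comb l (\<lambda>s. (a u x * of_real (Dr u x powr (1 / \<alpha>))) * F (s + t) (\<phi> u x))"
      by (rule lin_comb_cong) (use elim in \<open>force simp: add.assoc\<close>)
    also have "\<dots> = (a u x * of_real (Dr u x powr (1 / \<alpha>))) * lin_comb l (\<lambda>s. F (s + t) (\<phi> u x))"
      by (induction l) (auto simp: algebra_simps)
    finally show ?case
      using elim \<alpha> by (simp add: H_def norm_mult norm_a u powr_mult powr_powr)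
  qed
qed

lemma integrable_norm_powr_add:
  fixes g h :: "'e \<Rightarrow> complex"
  assumes "integrable m (\<lambda>x. norm (g x) powr \<alpha>)" "integrable m (\<lambda>x. norm (h x) powr \<alpha>)"
    and [measurable]: "g \<in> borel_measurable m" "h \<in> borel_measurable m"
  shows "integrable m (\<lambda>x. norm (g x + h x) powr \<alpha>)"
proof (rule Bochner_Integration.integrable_bound)
  \<comment> \<open>The constant is 1 + 4/2: the cross term \<open>4 * (?u * ?v)\<close> is at most
    twice the sum of the squares.\<close>
  show "integrable m (\<lambda>x. 3 * (norm (g x) powr \<alpha> + norm (h x) powr \<alpha>))"
    using assms by auto
  show "AE x in m. norm (norm (g x + h x) powr \<alpha>) \<le> norm (3 * (norm (g x) powr \<alpha> + norm (h x) powr \<alpha>))"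
  proof (rule AE_I2)
    fix x
    let ?u = "norm (g x) powr (\<alpha> / 2)" and ?v = "norm (h x) powr (\<alpha> / 2)"
    have "norm (g x + h x) powr \<alpha> \<le> norm (g x) powr \<alpha> + norm (h x) powr \<alpha> + 4 * (?u * ?v)"
      using abs_norm_powr_add_le[OF \<alpha>, of "g x" "h x"] by linarith
    moreover have "2 * (?u * ?v) \<le> norm (g x) powr \<alpha> + norm (h x) powr \<alpha>"
      using sum_squares_bound[of ?u ?v]
      by (simp add: power2_eq_square powr_add[symmetric])
    ultimately have "norm (g x + h x) powr \<alpha> \<le> 3 * (norm (g x) powr \<alpha> + norm (h x) powr \<alpha>)"
      by simp
    then show "norm (norm (g x + h x) powr \<alpha>) \<le> norm (3 * (norm (g x) powr \<alpha> + norm (h x) powr \<alpha>))"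
      by simp
  qed
qed measurable

lemma H_integrable:
  assumes "admissible l" "t \<in> T"
  shows "integrable m (H l t)"
  using assms(1) unfolding H_def[abs_def]
proof (induction l)
  case Nil
  then show ?case using \<alpha> by simp
next
  case (Cons p l)
  obtain z s where p: "p = (z, s)" by (cases p)
  have s: "s + t \<in> T" and l: "admissible l" using Cons.prems assms(2) by (auto simp: p admissible_def)
  have "integrable m (\<lambda>x. norm z powr \<alpha> * norm (F (s + t) x) powr \<alpha>)"
    using F_L_alpha[OF s] by (simp add: L_alpha_def)
  then have "integrable m (\<lambda>x. norm (z * F (s + t) x) powr \<alpha>)"
    by (simp add: norm_mult powr_mult)
  moreover have "(\<lambda>x. z * F (s + t) x) \<in> borel_measurable m" using F_measurable[OF s] by simp
  ultimately show ?case
    using Cons.IH[OF l] lin_comb_F_measurable[OF l assms(2)] integrable_norm_powr_add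
    by (simp add: p)
qed

text \<open>Moving the set and the time together leaves the mass unchanged. With the whole space
  this is stationarity of the exponents; with a weakly wandering set it rewrites the mass on a
  preimage as the mass on the original set at an earlier time.\<close>

lemma LINT_H_vimage:
  assumes l: "admissible l" and t: "t \<in> T" and u: "u \<in> T" and A: "A \<in> sets m"
  shows "(LINT x|m. indicator (\<phi> u -` A \<inter> space m) x * H l (t + u) x) = (LINT x|m. indicator A x * H l t x)"
proof -
  have [measurable]: "\<phi> u \<in> measurable m m" using u by (rule \<phi>_measurable)
  note [measurable] = A H_measurable[OF l t] H_measurable[OF l T_add[OF t u]]
  have "(LINT x|m. indicator (\<phi> u -` A \<inter> space m) x * H l (t + u) x)
    = (LINT x|m. Dr u x * (indicator A (\<phi> u x) * H l t (\<phi> u x)))"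
  proof (rule integral_cong_AE)
    show "AE x in m. indicator (\<phi> u -` A \<inter> space m) x * H l (t + u) x
        = Dr u x * (indicator A (\<phi> u x) * H l t (\<phi> u x))"
      using H_cocycle[OF l t u] AE_space by eventually_elim (auto split: split_indicator)
  qed measurable
  also have "\<dots> = (LINT x|m. indicator A x * H l t x)"
    using LINT_\<phi>[OF u, of "\<lambda>x. indicator A x * H l t x"] by simp
  finally show ?thesis .
qed

lemma LINT_H:
  assumes l: "admissible l" and t: "t \<in> T"
  shows "(LINT x|m. H l t x) = (LINT x|m. H l 0 x)"
proof -
  have eq: "(LINT x|m. indicator (space m) x * H l t x) = (LINT x|m. H l t x)" for t
    by (intro Bochner_Integration.integral_cong) auto
  have "\<phi> t -` space m \<inter> space m = space m" using \<phi>_space[OF t] by auto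
  then show ?thesis
    using LINT_H_vimage[OF l T_0 t, of "space m"] by (simp add: eq)
qed

lemma expectation_character:
  assumes l: "admissible l"
  shows "(LINT \<omega>|P. character l \<omega>) = of_real (exp (- (LINT x|m. H l 0 x)))"
proof -
  have *: "fst (l ! j) \<in> K \<and> snd (l ! j) \<in> T" if "j < length l" for j
  proof -
    have "l ! j \<in> K \<times> T" using l nth_mem[OF that] unfolding admissible_def by blast
    then show ?thesis by auto
  qed
  have "\<forall>(n::nat) t \<theta>. (\<forall>j<n. t j \<in> T \<and> \<theta> j \<in> K) \<longrightarrow>
        (LINT \<omega>|P. exp (\<i> * of_real (Re (\<Sum>j<n. \<theta> j * X (t j) \<omega>)))) =
        of_real (exp (- (LINT x|m. norm (\<Sum>j<n. \<theta> j * F (t j) x) powr \<alpha>)))"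
    using representation by (simp add: integral_representation_def)
  from this[rule_format, of "length l" "\<lambda>j. snd (l ! j)" "\<lambda>j. fst (l ! j)"] *
  show ?thesis by (simp add: character_def H_def lin_comb_conv_sum)
qed

text \<open>Joint exponent of \<open>l\<close> at time 0 and \<open>l'\<close> at time
  \<open>t\<close>. It would be the sum of the two separate exponents if these parts of the process
  were independent.\<close>

definition J :: "(complex \<times> real) list \<Rightarrow> (complex \<times> real) list \<Rightarrow> real \<Rightarrow> real" where
  "J l l' t = (LINT x|m. norm (lin_comb l (\<lambda>s. F s x) + lin_comb l' (\<lambda>s. F (s + t) x)) powr \<alpha>)"

lemma cov_characters:
  assumes l: "admissible l" and l': "admissible l'" and t: "t \<in> T"
  shows "(LINT \<omega>|P. character l \<omega> * character l' (\<theta> t \<omega>)) = of_real (exp (- J l l' t))"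
    "cov (character l) (character l') t
      = of_real (exp (- J l l' t) - exp (- ((LINT x|m. H l 0 x) + (LINT x|m. H l' 0 x))))"
proof -
  define l'' where "l'' = map (\<lambda>(z, s). (z, s + t)) l'"
  have l'': "admissible (l @ l'')" using l l' t unfolding admissible_def l''_def by auto
  have "character l \<omega> * character l' (\<theta> t \<omega>) = character (l @ l'') \<omega>" if "\<omega> \<in> space P" for \<omega>
  proof -
    have "lin_comb l' (\<lambda>s. X s (\<theta> t \<omega>)) = lin_comb l' (\<lambda>s. X (s + t) \<omega>)"
    proof (rule lin_comb_cong)
      fix z s assume "(z, s) \<in> set l'"
      then have "s \<in> T" using l' unfolding admissible_def by blast
      then show "X s (\<theta> t \<omega>) = X (s + t) \<omega>" using X_\<theta> t that by blast
    qed
    then have "character l' (\<theta> t \<omega>) = character l'' \<omega>"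
      by (simp add: character_def l''_def lin_comb_map_shift)
    then show ?thesis by (simp add: character_append)
  qed
  then have "(LINT \<omega>|P. character l \<omega> * character l' (\<theta> t \<omega>)) = (LINT \<omega>|P. character (l @ l'') \<omega>)"
    by (intro Bochner_Integration.integral_cong) auto
  also have "\<dots> = of_real (exp (- J l l' t))"
    by (subst expectation_character[OF l'']) (simp add: J_def H_def[abs_def] l''_def lin_comb_map_shift)
  finally show *: "(LINT \<omega>|P. character l \<omega> * character l' (\<theta> t \<omega>)) = of_real (exp (- J l l' t))" .
  show "cov (character l) (character l') t
      = of_real (exp (- J l l' t) - exp (- ((LINT x|m. H l 0 x) + (LINT x|m. H l' 0 x))))"
    unfolding cov_def * expectation_character[OF l] expectation_character[OF l']
    by (simp add: exp_add[symmetric] exp_of_real[symmetric])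
qed

lemma J_integrable:
  assumes l: "admissible l" and l': "admissible l'" and t: "t \<in> T"
  shows "integrable m (\<lambda>x. norm (lin_comb l (\<lambda>s. F s x) + lin_comb l' (\<lambda>s. F (s + t) x)) powr \<alpha>)"
  using H_integrable[OF l T_0] H_integrable[OF l' t] lin_comb_F_measurable[OF l T_0]
    lin_comb_F_measurable[OF l' t]
  by (intro integrable_norm_powr_add) (simp_all add: H_def[abs_def])

lemma J_nonneg: "0 \<le> J l l' t"
  unfolding J_def by (intro integral_nonneg_AE) simp

end

section \<open>Null flows\<close>

context time_set
begin

text \<open>A packing argument: \<open>J\<close> copies of a window of length \<open>N\<close>,
  moved by \<open>n j\<close>, all fit into a window of length \<open>N + n J\<close>. There the
  copies together contribute at most \<open>M\<close> at each time, so the mean is at most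
  \<open>M / J\<close> plus a term of order \<open>1 / N\<close>, with \<open>J\<close>
  arbitrary.\<close>

lemma cesaro_tendsto_0_of_disjoint_shifts:
  fixes b :: "real \<Rightarrow> real" and n :: "nat \<Rightarrow> nat"
  assumes b: "\<And>t. t \<in> T \<Longrightarrow> 0 \<le> b t"
    and n: "strict_mono n" and M: "\<And>t J. t \<in> T \<Longrightarrow> (\<Sum>j<J. b (t - real (n j))) \<le> M"
    and s: "s \<in> T"
  shows "(\<lambda>N. (\<Sum>k<N. b (s + real k)) / real N) \<longlonglongrightarrow> 0"
proof (rule tendsto_0_approx)
  fix \<epsilon> :: real assume \<epsilon>: "\<epsilon> > 0"
  have T': "s + real k - real i \<in> T" for k i using s by blast
  obtain J where J: "\<bar>M\<bar> / \<epsilon> < real J" "J > 0"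
    using reals_Archimedean2[of "\<bar>M\<bar> / \<epsilon>"] \<epsilon> by (metis gr0I of_nat_0 abs_ge_zero divide_nonneg_pos not_less)
  have key: "real J * (\<Sum>k<N. b (s + real k)) \<le> M * (real N + real (n J))" for N
  proof -
    have "(\<Sum>k<N. b (s + real k)) \<le> (\<Sum>k<N + n J. b (s + real k - real (n j)))" if "j < J" for j
    proof -
      \<comment> \<open>The reindexed window lies in \<open>{..<N + n J}\<close> because
        \<open>n j < n J\<close>; nonnegativity of \<open>b\<close> allows the enlargement.\<close>
      have "(\<Sum>k<N. b (s + real k)) = (\<Sum>k\<in>{n j..<N + n j}. b (s + real k - real (n j)))"
        using sum.shift_bounds_nat_ivl[of "\<lambda>k. b (s + real k - real (n j))" 0 "n j" N]
        by (simp add: atLeast0LessThan)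
      also have "\<dots> \<le> (\<Sum>k<N + n J. b (s + real k - real (n j)))"
        using strict_monoD[OF n that] by (intro sum_mono2 b T') auto
      finally show ?thesis .
    qed
    then have "(\<Sum>j<J. \<Sum>k<N. b (s + real k)) \<le> (\<Sum>j<J. \<Sum>k<N + n J. b (s + real k - real (n j)))"
      by (intro sum_mono) auto
    also have "\<dots> = (\<Sum>k<N + n J. \<Sum>j<J. b (s + real k - real (n j)))"
      by (rule sum.swap)
    also have "\<dots> \<le> (\<Sum>k<N + n J. M)"
      using s by (intro sum_mono M) auto
    finally show ?thesis by (simp add: algebra_simps)
  qed
  define h where "h N = M * real (n J) / real J * inverse (real N)" for N
  have "h \<longlonglongrightarrow> M * real (n J) / real J * 0"
    unfolding h_def by (intro tendsto_mult tendsto_const lim_inverse_n)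
  moreover have "\<forall>\<^sub>F N in sequentially. norm ((\<Sum>k<N. b (s + real k)) / real N) \<le> norm (h N) + 2 * \<epsilon>"
    using eventually_gt_at_top[of 0]
  proof eventually_elim
    case (elim N)
    have "0 \<le> (\<Sum>k<N. b (s + real k))" using s by (intro sum_nonneg b) auto
    then have "norm ((\<Sum>k<N. b (s + real k)) / real N) = (\<Sum>k<N. b (s + real k)) / real N" by simp
    also have "\<dots> \<le> M / real J + h N"
      using key[of N] elim J(2) by (simp add: h_def field_simps)
    also have "\<dots> \<le> norm (h N) + 2 * \<epsilon>"
    proof -
      have "M / real J \<le> \<epsilon>" using J \<epsilon> by (simp add: field_simps)
      then show ?thesis using \<epsilon> by simp
    qed
    finally show ?case .
  qed
  ultimately show "\<exists>h::nat \<Rightarrow> real. h \<longlonglongrightarrow> 0 \<and> (\<forall>\<^sub>F N in sequentially. norm ((\<Sum>k<N. b (s + real k)) / real N) \<le> norm (h N) + 2 * \<epsilon>)"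
    by auto
qed

end

context stable_flow
begin

text \<open>Weighted arithmetic-geometric mean inequality for the overlap, with the large weight
  \<open>1 / \<eta>\<close> placed on the translate inside \<open>A\<close> and on the fixed
  function outside \<open>A\<close>. If the first has little mass on \<open>A\<close> and the second
  little off \<open>A\<close>, only the \<eta> term remains.\<close>

lemma abs_J_diff_le:
  assumes l: "admissible l" and l': "admissible l'" and t: "t \<in> T" and A: "A \<in> sets m" and \<eta>: "0 < \<eta>"
  shows "\<bar>J l l' t - ((LINT x|m. H l 0 x) + (LINT x|m. H l' 0 x))\<bar>
    \<le> 4 * \<eta> * ((LINT x|m. H l 0 x) + (LINT x|m. H l' 0 x))
      + 4 / \<eta> * ((LINT x|m. indicator A x * H l' t x) + (LINT x|m. indicator (space m - A) x * H l 0 x))"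
proof -
  define g where "g x = lin_comb l (\<lambda>s. F s x)" for x
  define h where "h x = lin_comb l' (\<lambda>s. F (s + t) x)" for x
  have HG: "H l 0 = (\<lambda>x. norm (g x) powr \<alpha>)" "H l' t = (\<lambda>x. norm (h x) powr \<alpha>)"
    by (simp_all add: H_def[abs_def] g_def h_def)
  have int: "integrable m (H l 0)" "integrable m (H l' t)" using l l' t by (auto intro: H_integrable)
  have intJ: "integrable m (\<lambda>x. norm (g x + h x) powr \<alpha>)"
    using J_integrable[OF l l' t] by (simp add: g_def h_def)
  have intA: "integrable m (\<lambda>x. indicator A x * H l' t x)" "integrable m (\<lambda>x. indicator (space m - A) x * H l 0 x)"
    using int A by (auto intro!: integrable_mult_indicator[where 'b = real, simplified])
  have "\<bar>J l l' t - ((LINT x|m. H l 0 x) + (LINT x|m. H l' 0 x))\<bar>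
    = \<bar>LINT x|m. norm (g x + h x) powr \<alpha> - H l 0 x - H l' t x\<bar>"
    using int intJ LINT_H[OF l' t] by (simp add: J_def g_def h_def)
  also have "\<dots> \<le> (LINT x|m. \<bar>norm (g x + h x) powr \<alpha> - H l 0 x - H l' t x\<bar>)"
    by (rule integral_abs_bound)
  also have "\<dots> \<le> (LINT x|m. 4 * \<eta> * (H l 0 x + H l' t x)
      + 4 / \<eta> * (indicator A x * H l' t x + indicator (space m - A) x * H l 0 x))"
  proof (rule integral_mono)
    fix x assume x: "x \<in> space m"
    let ?u = "norm (g x) powr (\<alpha> / 2)" and ?v = "norm (h x) powr (\<alpha> / 2)"
    have sq: "H l 0 x = ?u\<^sup>2" "H l' t x = ?v\<^sup>2"
      by (simp_all add: HG power2_eq_square powr_add[symmetric])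
    have amgm: "u * v \<le> \<eta> * u\<^sup>2 + v\<^sup>2 / \<eta>" if "0 \<le> u" "0 \<le> v" for u v
    proof -
      have "2 * (u * v) \<le> \<eta> * u\<^sup>2 + v\<^sup>2 / \<eta>"
        using sum_squares_bound[of "sqrt \<eta> * u" "v / sqrt \<eta>"] \<eta> by (simp add: power_mult_distrib power_divide)
      then show ?thesis using that mult_nonneg_nonneg[OF that] by linarith
    qed
    have le1: "?u * ?v \<le> \<eta> * (?u\<^sup>2 + ?v\<^sup>2) + (indicator A x * ?v\<^sup>2 + indicator (space m - A) x * ?u\<^sup>2) / \<eta>"
    proof (cases "x \<in> A")
      case True
      have "0 \<le> \<eta> * ?v\<^sup>2" using \<eta> by simp
      then show ?thesis using amgm[of ?u ?v] True by (simp add: distrib_left)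
    next
      case False
      have "0 \<le> \<eta> * ?u\<^sup>2" using \<eta> by simp
      then show ?thesis using amgm[of ?v ?u] False x by (simp add: distrib_left mult.commute)
    qed
    have "\<bar>norm (g x + h x) powr \<alpha> - H l 0 x - H l' t x\<bar> \<le> 4 * (?u * ?v)"
      unfolding HG by (rule abs_norm_powr_add_le[OF \<alpha>])
    also have "\<dots> \<le> 4 * (\<eta> * (?u\<^sup>2 + ?v\<^sup>2) + (indicator A x * ?v\<^sup>2 + indicator (space m - A) x * ?u\<^sup>2) / \<eta>)"
      using le1 by (intro mult_left_mono) auto
    finally have "\<bar>norm (g x + h x) powr \<alpha> - H l 0 x - H l' t x\<bar>
      \<le> 4 * (\<eta> * (?u\<^sup>2 + ?v\<^sup>2) + (indicator A x * ?v\<^sup>2 + indicator (space m - A) x * ?u\<^sup>2) / \<eta>)" .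
    then show "\<bar>norm (g x + h x) powr \<alpha> - H l 0 x - H l' t x\<bar> \<le> 4 * \<eta> * (H l 0 x + H l' t x)
      + 4 / \<eta> * (indicator A x * H l' t x + indicator (space m - A) x * H l 0 x)"
      unfolding sq by (simp add: distrib_left add_divide_distrib mult.assoc)
  qed (use int intJ intA in auto)
  also have "\<dots> = 4 * \<eta> * ((LINT x|m. H l 0 x) + (LINT x|m. H l' 0 x))
      + 4 / \<eta> * ((LINT x|m. indicator A x * H l' t x) + (LINT x|m. indicator (space m - A) x * H l 0 x))"
    using int intA LINT_H[OF l' t] by simp
  finally show ?thesis .
qed

lemma norm_cov_characters_le:
  assumes l: "admissible l" and l': "admissible l'" and t: "t \<in> T"
  shows "norm (cov (character l) (character l') t)
      \<le> \<bar>J l l' t - ((LINT x|m. H l 0 x) + (LINT x|m. H l' 0 x))\<bar>"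
    "norm (cov (character l) (character l') t) \<le> 1"
proof -
  let ?M = "(LINT x|m. H l 0 x) + (LINT x|m. H l' 0 x)"
  have M: "0 \<le> ?M" by (intro add_nonneg_nonneg integral_nonneg_AE) auto
  have eq: "norm (cov (character l) (character l') t) = \<bar>exp (- J l l' t) - exp (- ?M)\<bar>"
    unfolding cov_characters(2)[OF l l' t] norm_of_real ..
  show "norm (cov (character l) (character l') t) \<le> \<bar>J l l' t - ?M\<bar>"
    unfolding eq by (rule abs_exp_minus_diff_le[OF J_nonneg M])
  have "0 < exp (- J l l' t)" "exp (- J l l' t) \<le> 1" "0 < exp (- ?M)" "exp (- ?M) \<le> 1"
    using J_nonneg[of l l' t] M by (simp_all only: exp_gt_zero exp_le_one_iff neg_le_0_iff_le)
  then show "norm (cov (character l) (character l') t) \<le> 1" unfolding eq by linarith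
qed

text \<open>The set \<open>A\<close> of \<open>abs_J_diff_le\<close> is a finite union of the
  preimages \<open>D j\<close>: enough of them to carry almost all of \<open>H l 0\<close>, yet
  finitely many, so that the mass of the translate on \<open>A\<close> is a finite sum of functions
  with Cesaro mean zero.\<close>

lemma cov_characters_density_zero:
  assumes l: "admissible l" and l': "admissible l'"
    and ww: "weakly_wandering_along m (\<phi> 1) B n"
    and cover: "AE x in m. x \<in> (\<Union>k. (\<phi> 1 ^^ n k) -` B \<inter> space m)"
  shows "cov (character l) (character l') \<in> density_zero_class"
proof -
  define D where "D j = \<phi> (real (n j)) -` B \<inter> space m" for j
  have D_eq: "(\<phi> 1 ^^ n j) -` B \<inter> space m = D j" for j
    by (auto simp: D_def funpow_\<phi>)
  have B [measurable]: "B \<in> sets m" and n: "strict_mono n" and disj: "disjoint_family D"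
    using ww by (auto simp: weakly_wandering_along_def D_eq)
  have D_sets [measurable]: "D j \<in> sets m" for j
    unfolding D_def using \<phi>_measurable[OF T_of_nat] B by (rule measurable_sets)
  have coverD: "AE x in m. x \<in> (\<Union>k. D k)" using cover by (simp add: D_eq)
  define b where "b t = (LINT x|m. indicator B x * H l' t x)" for t
  define M1 where "M1 = (LINT x|m. H l 0 x)"
  define M2 where "M2 = (LINT x|m. H l' 0 x)"
  have M: "0 \<le> M1" "0 \<le> M2" unfolding M1_def M2_def by (auto intro!: integral_nonneg_AE)
  have b_nonneg: "0 \<le> b t" for t unfolding b_def by (intro integral_nonneg_AE) auto
  \<comment> \<open>Mass on the \<open>j\<close>-th preimage at time \<open>t\<close> is mass on
    \<open>B\<close> at time \<open>t - real (n j)\<close>; disjointness of the preimages then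
    becomes a bound on sums of shifted values of \<open>b\<close>.\<close>
  have b_shift: "(LINT x|m. indicator (D j) x * H l' t x) = b (t - real (n j))" if "t \<in> T" for t j
    using LINT_H_vimage[OF l' T_diff[OF that T_of_nat[of "n j"]] T_of_nat[of "n j"] B] by (simp add: b_def D_def)
  have int: "integrable m (\<lambda>x. indicator (D j) x * H l' t x)" if "t \<in> T" for t j
    using integrable_mult_indicator[OF D_sets H_integrable[OF l' that]] by simp
  have union: "(LINT x|m. indicator (\<Union>j<i. D j) x * H l' t x) = (\<Sum>j<i. b (t - real (n j)))"
    if t: "t \<in> T" for t i
  proof -
    have "disjoint_family_on D {..<i}" using disj by (rule disjoint_family_on_mono[OF subset_UNIV])
    then have "(LINT x|m. indicator (\<Union>j<i. D j) x * H l' t x) = (LINT x|m. (\<Sum>j<i. indicator (D j) x * H l' t x))"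
      by (simp add: indicator_UN_disjoint sum_distrib_right)
    also have "\<dots> = (\<Sum>j<i. LINT x|m. indicator (D j) x * H l' t x)"
      by (rule Bochner_Integration.integral_sum) (rule int[OF t])
    also have "\<dots> = (\<Sum>j<i. b (t - real (n j)))"
      by (simp add: b_shift[OF t])
    finally show ?thesis .
  qed
  have sum_b: "(\<Sum>j<i. b (t - real (n j))) \<le> M2" if t: "t \<in> T" for t i
    unfolding union[OF t, symmetric] M2_def LINT_H[OF l' t, symmetric]
    by (rule integral_mono') (auto simp: H_integrable[OF l' t] split: split_indicator)
  have cesaro_b: "(\<lambda>N. (\<Sum>k<N. b (s + real k)) / real N) \<longlonglongrightarrow> 0" if "s \<in> T" for s
    by (rule cesaro_tendsto_0_of_disjoint_shifts[OF b_nonneg n sum_b that])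
  have tail: "(\<lambda>i. LINT x|m. indicator (space m - (\<Union>j<i. D j)) x * H l 0 x) \<longlonglongrightarrow> (LINT x|m. 0)"
  proof (rule integral_dominated_convergence[where w = "H l 0"])
    show "integrable m (H l 0)" by (rule H_integrable[OF l T_0])
    show "AE x in m. (\<lambda>i. indicator (space m - (\<Union>j<i. D j)) x * H l 0 x) \<longlonglongrightarrow> 0"
      using coverD
    proof eventually_elim
      case (elim x)
      then obtain k where k: "x \<in> D k" by blast
      have "\<forall>\<^sub>F i in sequentially. indicator (space m - (\<Union>j<i. D j)) x * H l 0 x = 0"
        using eventually_gt_at_top[of k] by eventually_elim (use k in \<open>auto simp: indicator_def\<close>)
      then show ?case by (rule tendsto_eventually)
    qed
  qed (use H_measurable[OF l T_0] in \<open>auto split: split_indicator\<close>)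
  define c where "c t = norm (cov (character l) (character l') t)" for t
  have "(avg c \<longlongrightarrow> 0) at_top"
  proof (rule avg_tendsto_0I[where C = 1])
    show "c \<in> borel_measurable tm"
      unfolding c_def[abs_def] using cov_characters_measurable[OF l l'] by measurable
    fix s assume s: "s \<in> T"
    show "(\<lambda>N. (\<Sum>k<N. c (s + real k)) / real N) \<longlonglongrightarrow> 0"
    proof (rule tendsto_0_approx)
      fix \<epsilon> :: real assume \<epsilon>: "\<epsilon> > 0"
      \<comment> \<open>Makes the \<eta> term of \<open>abs_J_diff_le\<close> at most \<epsilon>;
        the added 1 keeps the denominator positive when both masses are 0.\<close>
      define \<eta> where "\<eta> = \<epsilon> / (4 * (M1 + M2 + 1))"
      have \<eta>: "0 < \<eta>" using \<epsilon> M by (simp add: \<eta>_def)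
      have "4 * \<eta> * (M1 + M2) \<le> 4 * \<eta> * (M1 + M2 + 1)" using \<eta> by (intro mult_left_mono) auto
      also have "\<dots> = \<epsilon>" using M by (simp add: \<eta>_def field_simps)
      finally have \<eta>1: "4 * \<eta> * (M1 + M2) \<le> \<epsilon>" .
      \<comment> \<open>The threshold cancels the factor \<open>4 / \<eta>\<close>, so the tail
        costs a second \<epsilon>. Hence \<eta> is fixed before \<open>i\<close>.\<close>
      have "\<forall>\<^sub>F i in sequentially. (LINT x|m. indicator (space m - (\<Union>j<i. D j)) x * H l 0 x) < \<epsilon> * \<eta> / 4"
        using order_tendstoD(2)[OF tail, of "\<epsilon> * \<eta> / 4"] \<epsilon> \<eta> by simp
      then obtain i where i: "(LINT x|m. indicator (space m - (\<Union>j<i. D j)) x * H l 0 x) < \<epsilon> * \<eta> / 4"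
        using eventually_happens'[OF sequentially_bot] by blast
      have c_le: "c t \<le> 4 / \<eta> * (\<Sum>j<i. b (t - real (n j))) + 2 * \<epsilon>" if t: "t \<in> T" for t
      proof -
        have "(\<Union>j<i. D j) \<in> sets m" by measurable
        then have "c t \<le> 4 * \<eta> * (M1 + M2) + 4 / \<eta> * ((\<Sum>j<i. b (t - real (n j)))
          + (LINT x|m. indicator (space m - (\<Union>j<i. D j)) x * H l 0 x))"
          unfolding c_def M1_def M2_def union[OF t, symmetric]
          by (intro order_trans[OF norm_cov_characters_le(1) abs_J_diff_le] l l' t \<eta>)
        also have "\<dots> \<le> \<epsilon> + 4 / \<eta> * ((\<Sum>j<i. b (t - real (n j))) + \<epsilon> * \<eta> / 4)"
          using i \<eta>1 \<eta> by (intro add_mono mult_left_mono) auto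
        also have "\<dots> = 4 / \<eta> * (\<Sum>j<i. b (t - real (n j))) + 2 * \<epsilon>"
          using \<eta> by (simp add: field_simps)
        finally show ?thesis .
      qed
      define h where "h N = 4 / \<eta> * (\<Sum>j<i. (\<Sum>k<N. b ((s - real (n j)) + real k)) / real N)" for N
      have "h \<longlonglongrightarrow> 4 / \<eta> * (\<Sum>j<i. 0)"
        unfolding h_def by (intro tendsto_mult tendsto_const tendsto_sum cesaro_b T_diff s T_of_nat)
      moreover have "\<forall>\<^sub>F N in sequentially. norm ((\<Sum>k<N. c (s + real k)) / real N) \<le> norm (h N) + 2 * \<epsilon>"
        using eventually_gt_at_top[of 0]
      proof eventually_elim
        case (elim N)
        have "(\<Sum>k<N. c (s + real k)) \<le> (\<Sum>k<N. 4 / \<eta> * (\<Sum>j<i. b (s + real k - real (n j))) + 2 * \<epsilon>)"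
          by (intro sum_mono c_le T_add s T_of_nat)
        also have "\<dots> = 4 / \<eta> * (\<Sum>k<N. \<Sum>j<i. b (s + real k - real (n j))) + real N * (2 * \<epsilon>)"
          by (simp add: sum.distrib sum_distrib_left)
        also have "(\<Sum>k<N. \<Sum>j<i. b (s + real k - real (n j))) = (\<Sum>j<i. \<Sum>k<N. b ((s - real (n j)) + real k))"
          by (subst sum.swap) (simp add: algebra_simps)
        finally have "(\<Sum>k<N. c (s + real k)) / real N
          \<le> (4 / \<eta> * (\<Sum>j<i. \<Sum>k<N. b ((s - real (n j)) + real k)) + real N * (2 * \<epsilon>)) / real N"
          by (rule divide_right_mono) simp
        also have "\<dots> = h N + 2 * \<epsilon>"
          using elim by (simp add: h_def sum_divide_distrib[symmetric] add_divide_distrib)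
        finally have "(\<Sum>k<N. c (s + real k)) / real N \<le> h N + 2 * \<epsilon>" .
        moreover have "0 \<le> (\<Sum>k<N. c (s + real k)) / real N"
          by (intro divide_nonneg_nonneg sum_nonneg) (auto simp: c_def)
        ultimately show ?case by simp
      qed
      ultimately show "\<exists>h::nat \<Rightarrow> real. h \<longlonglongrightarrow> 0 \<and> (\<forall>\<^sub>F N in sequentially. norm ((\<Sum>k<N. c (s + real k)) / real N) \<le> norm (h N) + 2 * \<epsilon>)"
        by auto
    qed
  qed (auto simp: c_def norm_cov_characters_le(2)[OF l l'])
  then show ?thesis
    using cov_characters_measurable[OF l l'] norm_cov_characters_le(2)[OF l l']
    by (auto simp: density_zero_class_def bdd_def c_def[abs_def])
qed

end

section \<open>Ergodicity and finite invariant measures\<close>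

context stable_flow
begin

definition overlap :: "real \<Rightarrow> real \<Rightarrow> real" where
  "overlap u t = (LINT x|m. min (norm (F u x) powr \<alpha>) (norm (F t x) powr \<alpha>))"

lemma integrable_F: "t \<in> T \<Longrightarrow> integrable m (\<lambda>x. norm (F t x) powr \<alpha>)"
  using F_L_alpha by (auto simp: L_alpha_def)

lemma overlap_nonneg: "0 \<le> overlap u t"
  unfolding overlap_def by (intro integral_nonneg_AE) auto

lemma integrable_overlap:
  assumes "u \<in> T" "t \<in> T"
  shows "integrable m (\<lambda>x. min (norm (F u x) powr \<alpha>) (norm (F t x) powr \<alpha>))"
  by (rule Bochner_Integration.integrable_bound[OF integrable_F[OF assms(1)]])
    (use F_measurable assms in auto)

text \<open>
  Ergodicity pushes both \<open>\<parallel>F u + F t\<parallel>\<^sup>\<alpha>\<close> and \<open>\<parallel>F u - F t\<parallel>\<^sup>\<alpha>\<close> up to their independent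
  value \<open>2\<parallel>F 0\<parallel>\<^sup>\<alpha>\<close> on average, which for \<open>\<alpha> < 2\<close> leaves no room for the supports to overlap.
\<close>

lemma ergodic_overlap:
  assumes erg: "ergodic_process T P \<theta> X" and u: "u \<in> T"
  shows "\<exists>d C. d \<in> borel_measurable tm \<and> (\<forall>t\<in>T. overlap u t \<le> d t) \<and> (\<forall>t\<in>T. d t \<le> C) \<and>
    (avg d \<longlongrightarrow> 0) at_top"
proof -
  define w where "w = (LINT x|m. norm (F 0 x) powr \<alpha>)"
  have one_K: "1 \<in> K" "- 1 \<in> K" using K_cases by auto
  have norm_F: "(LINT x|m. norm (F t x) powr \<alpha>) = w" if "t \<in> T" for t
    using LINT_H[of "[(1, 0)]" t] that one_K by (simp add: H_def admissible_def w_def)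
  have w0: "0 \<le> w" unfolding w_def by (intro integral_nonneg_AE) auto
  define I where "I z t = (LINT x|m. norm (F u x + z * F t x) powr \<alpha>)" for z t
  define e where "e z t = exp (- I z t) - exp (- (2 * w))" for z t
  \<comment> \<open>The deficit in the integrated parallelogram inequality. It stands in for
    \<open>overlap u t\<close> because its measurability in \<open>t\<close> can be read off from
    covariances.\<close>
  define d where "d t = (4 * w - I 1 t - I (- 1) t) / (2 - \<alpha>)" for t
  have e: "e z \<in> borel_measurable tm" "(avg (e z) \<longlongrightarrow> 0) at_top"
    "\<And>t. t \<in> T \<Longrightarrow> norm (e z t) \<le> 1" if z: "z = 1 \<or> z = - 1" for z
  proof -
    have adm: "admissible [(1, u)]" "admissible [(z, 0)]" using u z one_K by (auto simp: admissible_def)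
    let ?c = "cov (character [(1, u)]) (character [(z, 0)])"
    have c: "?c \<in> mean_zero_class" by (rule ergodic_imp_characters[OF erg adm])
    have "(LINT x|m. H [(1, u)] 0 x) = w" "(LINT x|m. H [(z, 0)] 0 x) = w"
      using z norm_F[OF u] norm_F[OF T_0] by (auto simp: H_def norm_mult)
    then have ce: "?c t = of_real (e z t)" if "t \<in> T" for t
      unfolding cov_characters(2)[OF adm that] by (simp add: J_def I_def e_def)
    have "(\<lambda>t. Re (?c t)) \<in> borel_measurable tm" using c by (auto simp: mean_zero_class_def)
    then show "e z \<in> borel_measurable tm"
      by (rule measurable_cong[THEN iffD1, rotated]) (simp add: ce)
    have I0: "0 \<le> I z t" for t unfolding I_def by (intro integral_nonneg_AE) auto
    show "norm (e z t) \<le> 1" if "t \<in> T" for t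
    proof -
      have "0 < exp (- I z t)" "exp (- I z t) \<le> 1" "0 < exp (- (2 * w))" "exp (- (2 * w)) \<le> 1"
        using I0[of t] mult_nonneg_nonneg[OF zero_le_numeral w0] by (simp_all only: exp_gt_zero exp_le_one_iff neg_le_0_iff_le)
      then show ?thesis unfolding e_def real_norm_def by linarith
    qed
    have "avg ?c = avg (\<lambda>t. complex_of_real (e z t))" by (rule avg_cong) (rule ce)
    also have "\<dots> = (\<lambda>L. of_real (avg (e z) L))"
      by (simp add: fun_eq_iff avg_def set_lebesgue_integral_def scaleR_conv_of_real
          of_real_mult[symmetric] del: of_real_mult)
    finally have "((\<lambda>L. Re (complex_of_real (avg (e z) L))) \<longlongrightarrow> Re 0) at_top"
      using c by (intro tendsto_Re) (simp add: mean_zero_class_def)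
    then show "(avg (e z) \<longlongrightarrow> 0) at_top" by simp
  qed
  \<comment> \<open>Convexity, in the form \<open>1 + x \<le> exp x\<close>, linearizes the
    exponential: only averages of \<open>e z\<close> are known to vanish, which yields a one-sided
    bound. It suffices because \<open>d\<close> is nonnegative.\<close>
  have I_le: "2 * w - I z t \<le> exp (2 * w) * e z t" for z t
  proof -
    have "exp (2 * w) * e z t = exp (2 * w - I z t) - 1"
      by (simp add: e_def right_diff_distrib exp_add[symmetric])
    then show ?thesis using exp_ge_add_one_self[of "2 * w - I z t"] by linarith
  qed
  have overlap_le: "overlap u t \<le> d t" if t: "t \<in> T" for t
  proof -
    have adm: "admissible [(1, u)]" "admissible [(1, 0)]" "admissible [(- 1, 0)]"
      using u one_K by (auto simp: admissible_def)
    have int: "integrable m (\<lambda>x. norm (F u x + F t x) powr \<alpha>)" "integrable m (\<lambda>x. norm (F u x - F t x) powr \<alpha>)"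
      using J_integrable[OF adm(1,2) t] J_integrable[OF adm(1,3) t] by simp_all
    note int2 = integrable_F[OF u] integrable_F[OF t] integrable_overlap[OF u t]
    have "(2 - \<alpha>) * overlap u t
      = (LINT x|m. (2 - \<alpha>) * min (norm (F u x) powr \<alpha>) (norm (F t x) powr \<alpha>))"
      by (simp add: overlap_def)
    also have "\<dots> \<le> (LINT x|m. 2 * (norm (F u x) powr \<alpha> + norm (F t x) powr \<alpha>)
        - norm (F u x + F t x) powr \<alpha> - norm (F u x - F t x) powr \<alpha>)"
    proof (rule integral_mono)
      fix x
      show "(2 - \<alpha>) * min (norm (F u x) powr \<alpha>) (norm (F t x) powr \<alpha>)
        \<le> 2 * (norm (F u x) powr \<alpha> + norm (F t x) powr \<alpha>)
          - norm (F u x + F t x) powr \<alpha> - norm (F u x - F t x) powr \<alpha>"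
        using norm_powr_parallelogram_le[OF \<alpha>, of "F u x" "F t x"] by linarith
    qed (use int int2 in auto)
    also have "\<dots> = 4 * w - I 1 t - I (- 1) t"
      using int int2 by (simp add: I_def norm_F u t)
    finally show ?thesis using \<alpha> by (simp add: d_def field_simps)
  qed
  have d0: "0 \<le> d t" if "t \<in> T" for t
    using overlap_le[OF that] overlap_nonneg[of u t] by linarith
  \<comment> \<open>Linear in \<open>e 1\<close> and \<open>e (- 1)\<close>, so its averages tend to
    0; \<open>d\<close> is squeezed between 0 and \<open>D\<close>.\<close>
  define D where "D t = exp (2 * w) / (2 - \<alpha>) * (e 1 t + e (- 1) t)" for t
  have d_le_D: "d t \<le> D t" for t
  proof -
    have "d t \<le> (exp (2 * w) * e 1 t + exp (2 * w) * e (- 1) t) / (2 - \<alpha>)"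
      unfolding d_def using I_le[of 1 t] I_le[of "- 1" t] \<alpha> by (intro divide_right_mono) auto
    then show ?thesis by (simp add: D_def distrib_left add_divide_distrib)
  qed
  have D_bound: "norm (D t) \<le> exp (2 * w) / (2 - \<alpha>) * 2" if "t \<in> T" for t
    unfolding D_def norm_mult using e(3)[OF _ that, of 1] e(3)[OF _ that, of "- 1"] \<alpha>
    by (intro mult_mono) auto
  have d_meas: "d \<in> borel_measurable tm"
  proof -
    have "I z \<in> borel_measurable tm" if z: "z = 1 \<or> z = - 1" for z
    proof -
      \<comment> \<open>The exponent is recovered from the measurable covariance by a logarithm,
        which avoids joint measurability of the kernel.\<close>
      have "I z = (\<lambda>t. - ln (e z t + exp (- (2 * w))))" by (auto simp: e_def)
      moreover have "(\<lambda>t. - ln (e z t + exp (- (2 * w)))) \<in> borel_measurable tm"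
        using e(1)[OF z] by measurable
      ultimately show ?thesis by simp
    qed
    then have [measurable]: "I 1 \<in> borel_measurable tm" "I (- 1) \<in> borel_measurable tm" by auto
    show ?thesis unfolding d_def[abs_def] by measurable
  qed
  have D_meas: "D \<in> borel_measurable tm"
    unfolding D_def[abs_def] using e(1)[of 1] e(1)[of "- 1"] by measurable
  have D_lim: "(avg D \<longlongrightarrow> 0) at_top"
  proof -
    have "avg D L = exp (2 * w) / (2 - \<alpha>) * (avg (e 1) L + avg (e (- 1)) L)" for L
    proof -
      have "avg D L = exp (2 * w) / (2 - \<alpha>) * avg (\<lambda>t. e 1 t + e (- 1) t) L"
        unfolding D_def[abs_def] by (simp add: avg_def set_lebesgue_integral_def mult.left_commute)
      also have "avg (\<lambda>t. e 1 t + e (- 1) t) L = avg (e 1) L + avg (e (- 1)) L"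
        by (rule avg_add[where C = 1 and D = 1]) (use e in auto)
      finally show ?thesis .
    qed
    then have "avg D = (\<lambda>L. exp (2 * w) / (2 - \<alpha>) * (avg (e 1) L + avg (e (- 1)) L))" by auto
    moreover have "((\<lambda>L. exp (2 * w) / (2 - \<alpha>) * (avg (e 1) L + avg (e (- 1)) L))
      \<longlongrightarrow> exp (2 * w) / (2 - \<alpha>) * (0 + 0)) at_top"
      by (intro tendsto_mult tendsto_add tendsto_const e(2)) auto
    ultimately show ?thesis by simp
  qed
  have "\<forall>\<^sub>F L in at_top. norm (avg d L) \<le> avg D L"
    using eventually_gt_at_top[of 0]
  proof eventually_elim
    case (elim L)
    have d_bound: "norm (d t) \<le> exp (2 * w) / (2 - \<alpha>) * 2" if "t \<in> T" for t
      using d0[OF that] d_le_D[of t] D_bound[OF that] by simp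
    have "norm (avg d L) \<le> avg (\<lambda>t. norm (d t)) L" by (rule norm_avg_le[OF elim])
    also have "\<dots> = avg d L" using d0 by (subst avg_cong[of _ d]) auto
    also have "\<dots> \<le> avg D L" by (rule avg_mono[OF d_meas d_bound D_meas D_bound d_le_D elim])
    finally show ?case .
  qed
  then have d_lim: "(avg d \<longlongrightarrow> 0) at_top" using D_lim by (rule Lim_null_comparison)
  have d_le: "d t \<le> exp (2 * w) / (2 - \<alpha>) * 2" if "t \<in> T" for t
    using d_le_D[of t] D_bound[OF that] by simp
  show ?thesis
    by (intro exI[of _ d] exI[of _ "exp (2 * w) / (2 - \<alpha>) * 2"] conjI ballI d_meas overlap_le d_le d_lim)
qed

text \<open>A single time \<open>s\<close> is the natural output: averages over real time carry no
  information about an individual residue modulo 1.\<close>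

lemma ergodic_kernel_vanishes:
  assumes erg: "ergodic_process T P \<theta> X"
    and N: "finite_measure N" "sets N = sets m" "absolutely_continuous m N" "distr N m (\<phi> 1) = N"
  shows "\<exists>s\<in>T. AE x in N. F s x = 0"
proof -
  interpret N: finite_measure N by (rule N(1))
  have space_N: "space N = space m" using N(2) by (rule sets_eq_imp_space_eq)
  define r where "r x = enn2real (RN_deriv m N x)" for x
  have r_meas [measurable]: "r \<in> borel_measurable m" unfolding r_def by measurable
  have r0: "0 \<le> r x" for x by (simp add: r_def)
  have dens: "density m (\<lambda>x. ennreal (r x)) = N"
  proof -
    have "AE x in m. RN_deriv m N x \<noteq> \<infinity>"
      by (rule m.RN_deriv_finite[OF N.sigma_finite_measure_axioms N(3,2)])
    then have "AE x in m. ennreal (r x) = RN_deriv m N x"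
      by eventually_elim (auto simp: r_def less_top)
    then have "density m (\<lambda>x. ennreal (r x)) = density m (RN_deriv m N)"
      by (intro density_cong) auto
    also have "\<dots> = N" by (rule m.density_RN_deriv[OF N(3,2)])
    finally show ?thesis .
  qed
  have AE_N: "AE x in N. Q x" if "AE x in m. Q x" for Q
    using absolutely_continuous_AE[OF N(2,3) that] .
  have r_cocycle: "AE x in m. r x = Dr 1 x * r (\<phi> 1 x)"
  proof -
    have [measurable]: "\<phi> 1 \<in> measurable m m" by (intro \<phi>_measurable) simp
    have "distr (distr N m (\<phi> 1)) m (\<phi> (- 1)) = N"
      using N(2) by (subst distr_\<phi>_compose) (auto simp: distr_\<phi>_0 T_minus)
    then have "density m (\<lambda>x. ennreal (r x)) = distr (density m (\<lambda>x. ennreal (r x))) m (\<phi> (- 1))"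
      by (simp add: N(4) dens)
    also have "\<dots> = density m (\<lambda>x. ennreal (Dr 1 x) * ennreal (r (\<phi> 1 x)))"
      by (rule distr_density_\<phi>) auto
    finally have "AE x in m. ennreal (r x) = ennreal (Dr 1 x) * ennreal (r (\<phi> 1 x))"
      by (rule m.density_unique[rotated 2]) auto
    then show ?thesis by eventually_elim (simp add: ennreal_mult[symmetric] r0)
  qed
  \<comment> \<open>On \<open>B k u \<inter> B k t\<close> the density \<open>r\<close> of
    \<open>N\<close> is below \<open>Suc k\<close> times the smaller of the two kernel masses, whose
    integral is \<open>overlap u t\<close>. Over all \<open>k\<close> the sets \<open>B k s\<close>
    exhaust the points with \<open>F s x \<noteq> 0\<close>.\<close>
  define B where "B k t = {x \<in> space m. r x < real (Suc k) * norm (F t x) powr \<alpha>}" for k t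
  have B_sets [measurable]: "B k t \<in> sets m" if "t \<in> T" for k t
    unfolding B_def using F_measurable[OF that] by measurable
  \<comment> \<open>By invariance of \<open>N\<close>, the density \<open>r\<close> obeys the same
    rule under \<open>\<phi> 1\<close> as the kernel mass, with the common positive factor
    \<open>Dr 1\<close>. The inequality defining \<open>B\<close> is therefore carried along the
    orbit.\<close>
  have B_step: "measure N (B k (t + 1)) = measure N (B k t)" if t: "t \<in> T" for k t
  proof -
    have adm: "admissible [(1, 0)]" using K_cases by (auto simp: admissible_def)
    have meas: "\<phi> 1 \<in> measurable N m"
      using \<phi>_measurable[OF T_1] measurable_cong_sets[OF N(2) refl] by blast
    have "AE x in m. norm (F (t + 1) x) powr \<alpha> = Dr 1 x * norm (F t (\<phi> 1 x)) powr \<alpha>"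
      using H_cocycle[OF adm t T_1] by (simp add: H_def)
    then have "AE x in m. x \<in> B k (t + 1) \<longleftrightarrow> x \<in> \<phi> 1 -` B k t \<inter> space N"
      using r_cocycle Dr_pos[OF T_1] AE_space
    proof eventually_elim
      case (elim x)
      have "r x < real (Suc k) * norm (F (t + 1) x) powr \<alpha>
        \<longleftrightarrow> Dr 1 x * r (\<phi> 1 x) < Dr 1 x * (real (Suc k) * norm (F t (\<phi> 1 x)) powr \<alpha>)"
        using elim(1,2) by (simp add: mult.left_commute)
      also have "\<dots> \<longleftrightarrow> r (\<phi> 1 x) < real (Suc k) * norm (F t (\<phi> 1 x)) powr \<alpha>"
        using elim(3) by (rule mult_less_cancel_left_pos)
      finally show ?case using elim(4) \<phi>_space[OF T_1 elim(4)] by (auto simp: B_def space_N)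
    qed
    then have "measure N (B k (t + 1)) = measure N (\<phi> 1 -` B k t \<inter> space N)"
      using measurable_sets[OF meas B_sets[OF t]] B_sets[OF T_add[OF t T_1]]
      by (intro measure_eq_AE AE_N) (auto simp: N(2))
    also have "\<dots> = measure (distr N m (\<phi> 1)) (B k t)"
      using meas t by (subst measure_distr) auto
    finally show ?thesis by (simp add: N(4))
  qed
  have B_shift: "measure N (B k (s + real j)) = measure N (B k s)" if s: "s \<in> T" for k s j
  proof (induction j)
    case (Suc j)
    then show ?case using B_step[OF T_add[OF s T_of_nat], of k j] by (simp add: ac_simps)
  qed simp
  have B_overlap: "measure N (B k u \<inter> B k t) \<le> real (Suc k) * overlap u t"
    if u: "u \<in> T" and t: "t \<in> T" for k u t
  proof -
    have sets: "B k u \<inter> B k t \<in> sets m" using u t by auto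
    have "measure N (B k u \<inter> B k t) = (LINT x|N. indicator (B k u \<inter> B k t) x)"
      using sets sets.sets_into_space[OF sets] by (simp add: space_N Int_absorb2)
    also have "\<dots> = (LINT x|m. r x * indicator (B k u \<inter> B k t) x)"
      unfolding dens[symmetric] using sets r0 by (subst integral_real_density) auto
    also have "\<dots> \<le> (LINT x|m. real (Suc k) * min (norm (F u x) powr \<alpha>) (norm (F t x) powr \<alpha>))"
    proof (rule integral_mono')
      show "r x * indicator (B k u \<inter> B k t) x \<le> real (Suc k) * min (norm (F u x) powr \<alpha>) (norm (F t x) powr \<alpha>)"
        for x by (auto simp: B_def min_def split: split_indicator)
    qed (use integrable_overlap[OF u t] r0 in auto)
    also have "\<dots> = real (Suc k) * overlap u t" by (simp add: overlap_def)
    finally show ?thesis .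
  qed
  \<comment> \<open>Otherwise times can be chosen one after another, each adding at least
    \<open>\<eta> / 2\<close> to the \<open>N\<close>-mass of the union of the sets
    \<open>B k t\<close>, against finiteness of \<open>N\<close>.\<close>
  have small: "AE s in tm. s \<in> {0..<1} \<longrightarrow> measure N (B k s) < \<eta>" if \<eta>: "0 < \<eta>" for k and \<eta> :: real
  proof (rule ccontr)
    assume not_small: "\<not> ?thesis"
    have "\<exists>A. finite A \<and> A \<subseteq> T \<and> real j * \<eta> / 2 \<le> measure N (\<Union>t\<in>A. B k t)" for j
    proof (induction j)
      case 0
      then show ?case by (intro exI[of _ "{}"]) auto
    next
      case (Suc j)
      then obtain A where A: "finite A" "A \<subseteq> T" "real j * \<eta> / 2 \<le> measure N (\<Union>t\<in>A. B k t)" by blast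
      have "\<forall>u\<in>A. \<exists>d. \<exists>C. d \<in> borel_measurable tm \<and> (\<forall>t\<in>T. overlap u t \<le> d t) \<and>
        (\<forall>t\<in>T. d t \<le> C) \<and> (avg d \<longlongrightarrow> 0) at_top"
      proof
        fix u assume "u \<in> A"
        then have "u \<in> T" using A(2) by blast
        then show "\<exists>d C. d \<in> borel_measurable tm \<and> (\<forall>t\<in>T. overlap u t \<le> d t) \<and>
          (\<forall>t\<in>T. d t \<le> C) \<and> (avg d \<longlongrightarrow> 0) at_top"
          by (rule ergodic_overlap[OF erg])
      qed
      from bchoice[OF this] obtain d where "\<forall>u\<in>A. \<exists>C. d u \<in> borel_measurable tm \<and>
        (\<forall>t\<in>T. overlap u t \<le> d u t) \<and> (\<forall>t\<in>T. d u t \<le> C) \<and> (avg (d u) \<longlongrightarrow> 0) at_top" by blast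
      from bchoice[OF this] obtain C where dC: "\<forall>u\<in>A. d u \<in> borel_measurable tm \<and>
        (\<forall>t\<in>T. overlap u t \<le> d u t) \<and> (\<forall>t\<in>T. d u t \<le> C u) \<and> (avg (d u) \<longlongrightarrow> 0) at_top" by blast
      then have d: "\<And>u. u \<in> A \<Longrightarrow> d u \<in> borel_measurable tm"
        "\<And>u t. u \<in> A \<Longrightarrow> t \<in> T \<Longrightarrow> overlap u t \<le> d u t"
        "\<And>u t. u \<in> A \<Longrightarrow> t \<in> T \<Longrightarrow> d u t \<le> C u"
        "\<And>u. u \<in> A \<Longrightarrow> (avg (d u) \<longlongrightarrow> 0) at_top" by auto
      have d0: "0 \<le> d u t" if "u \<in> A" "t \<in> T" for u t
        using overlap_nonneg[of u t] d(2)[OF that] by linarith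
      define D where "D t = (\<Sum>u\<in>A. d u t)" for t
      have avg_D: "avg (\<lambda>t. \<Sum>u\<in>A'. d u t) = (\<lambda>L. \<Sum>u\<in>A'. avg (d u) L)" if "A' \<subseteq> A" for A'
        using finite_subset[OF that A(1)] that
      proof (induction A')
        case empty
        then show ?case by (simp add: avg_def[abs_def] set_lebesgue_integral_def)
      next
        case (insert u A')
        show ?case
        proof
          fix L
          have "avg (\<lambda>t. d u t + (\<Sum>u\<in>A'. d u t)) L = avg (d u) L + avg (\<lambda>t. \<Sum>u\<in>A'. d u t) L"
          proof (rule avg_add[where C = "C u" and D = "\<Sum>u\<in>A'. C u"])
            show "norm (\<Sum>u\<in>A'. d u t) \<le> (\<Sum>u\<in>A'. C u)" if "t \<in> T" for t
              using insert.prems d(3) d0 that by (intro sum_norm_le) (auto simp: subset_eq)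
          qed (use insert.prems d d0 in \<open>auto simp: subset_eq\<close>)
          then show "avg (\<lambda>t. \<Sum>u\<in>insert u A'. d u t) L = (\<Sum>u\<in>insert u A'. avg (d u) L)"
            using insert by simp
        qed
      qed
      have D_lim: "(avg D \<longlongrightarrow> 0) at_top"
      proof -
        have "((\<lambda>L. \<Sum>u\<in>A. avg (d u) L) \<longlongrightarrow> (\<Sum>u\<in>A. 0)) at_top" by (intro tendsto_sum d)
        then show ?thesis unfolding D_def[abs_def] avg_D[OF order_refl] by simp
      qed
      \<comment> \<open>Almost every offset reaches, after some integer time \<open>i\<close>, small
        total overlap with the times already in \<open>A\<close>. The offsets with large
        \<open>B k s\<close> are not negligible, so one offset has both properties, and adding
        \<open>i\<close> does not change the mass. The threshold becomes \<open>\<eta> / 2\<close>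
        after the factor \<open>Suc k\<close> of \<open>B_overlap\<close>.\<close>
      have "AE s in tm. s \<in> {0..<1} \<longrightarrow> (\<exists>i. D (s + real i) < \<eta> / (2 * real (Suc k)))"
      proof (rule avg_tendsto_0_AE)
        show "D \<in> borel_measurable tm" unfolding D_def[abs_def] using d(1) by (rule borel_measurable_sum)
        show "0 \<le> D t" if "t \<in> T" for t unfolding D_def using d0 that by (intro sum_nonneg) auto
        show "D t \<le> (\<Sum>u\<in>A. C u)" if "t \<in> T" for t unfolding D_def using d(3) that by (intro sum_mono) auto
        show "(\<lambda>n. avg D (real n)) \<longlonglongrightarrow> 0"
          by (rule filterlim_compose[OF D_lim filterlim_real_sequentially])
      qed (use \<eta> in simp)
      then have "\<exists>s\<in>T. s \<in> {0..<1} \<and> \<eta> \<le> measure N (B k s) \<and> (\<exists>i. D (s + real i) < \<eta> / (2 * real (Suc k)))"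
      proof (rule contrapos_pp)
        assume *: "\<not> (\<exists>s\<in>T. s \<in> {0..<1} \<and> \<eta> \<le> measure N (B k s) \<and> (\<exists>i. D (s + real i) < \<eta> / (2 * real (Suc k))))"
        show "\<not> (AE s in tm. s \<in> {0..<1} \<longrightarrow> (\<exists>i. D (s + real i) < \<eta> / (2 * real (Suc k))))"
        proof
          assume "AE s in tm. s \<in> {0..<1} \<longrightarrow> (\<exists>i. D (s + real i) < \<eta> / (2 * real (Suc k)))"
          with AE_space have "AE s in tm. s \<in> {0..<1} \<longrightarrow> measure N (B k s) < \<eta>"
            by eventually_elim (use * in \<open>force simp: not_le\<close>)
          with not_small show False by contradiction
        qed
      qed
      then obtain s i where s: "s \<in> T" "\<eta> \<le> measure N (B k s)" "D (s + real i) < \<eta> / (2 * real (Suc k))"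
        by blast
      define t where "t = s + real i"
      have t: "t \<in> T" "\<eta> \<le> measure N (B k t)" using s B_shift[OF s(1)] by (auto simp: t_def)
      let ?U = "\<Union>u\<in>A. B k u"
      have U: "?U \<in> sets N" "B k t \<in> sets N" using A t unfolding N(2) by (auto intro!: sets.finite_UN)
      have "?U \<inter> B k t = (\<Union>u\<in>A. B k u \<inter> B k t)" by auto
      then have "measure N (?U \<inter> B k t) = measure N (\<Union>u\<in>A. B k u \<inter> B k t)" by (rule arg_cong)
      also have "\<dots> \<le> (\<Sum>u\<in>A. measure N (B k u \<inter> B k t))"
        using A t by (intro N.finite_measure_subadditive_finite) (auto simp: N(2))
      also have "\<dots> \<le> (\<Sum>u\<in>A. real (Suc k) * d u t)"
        using A t d(2) by (intro sum_mono order_trans[OF B_overlap] mult_left_mono) auto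
      also have "\<dots> = real (Suc k) * D t" by (simp add: D_def sum_distrib_left)
      also have "\<dots> \<le> \<eta> / 2" using s(3) by (simp add: t_def[symmetric] field_simps del: of_nat_Suc)
      finally have "measure N (?U \<inter> B k t) \<le> \<eta> / 2" .
      moreover have "measure N (?U \<union> B k t) = measure N ?U + measure N (B k t) - measure N (?U \<inter> B k t)"
        using N.finite_measure_Union'[OF U] N.finite_measure_Diff'[OF U(2,1)] by (simp only: Int_commute[of "B k t"])
      ultimately have "real (Suc j) * \<eta> / 2 \<le> measure N (?U \<union> B k t)"
        using A(3) t(2) by (simp add: field_simps)
      then show ?case using A(1,2) t(1) by (intro exI[of _ "insert t A"]) (auto simp: Un_commute)
    qed
    then have le: "real j * \<eta> / 2 \<le> measure N (space N)" for j
      using N.bounded_measure order_trans by blast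
    obtain j where "measure N (space N) < real j * (\<eta> / 2)"
      using reals_Archimedean3[of "\<eta> / 2"] \<eta> by auto
    then show False using le[of j] by simp
  qed
  \<comment> \<open>The countably many almost-everywhere statements hold together, and the unit cell
    has mass 1, so some offset satisfies all of them.\<close>
  have "\<exists>s\<in>T. \<forall>k. measure N (B k s) < 1 / real (Suc k)"
  proof (rule ccontr)
    assume *: "\<not> (\<exists>s\<in>T. \<forall>k. measure N (B k s) < 1 / real (Suc k))"
    have "AE s in tm. \<forall>k. s \<in> {0..<1} \<longrightarrow> measure N (B k s) < 1 / real (Suc k)"
      unfolding AE_all_countable by (intro allI small) simp
    then have "AE s in tm. s \<notin> {0..<1} \<inter> T" by eventually_elim (use * in blast)
    then have "emeasure tm ({0..<1} \<inter> T) = 0"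
      by (subst AE_iff_measurable[symmetric, of _ _ "\<lambda>s. s \<notin> {0..<1} \<inter> T"]) auto
    then show False by (simp add: emeasure_unit)
  qed
  then obtain s where s: "s \<in> T" "\<And>k. measure N (B k s) < 1 / real (Suc k)" by blast
  \<comment> \<open>\<open>B k s\<close> increases with \<open>k\<close>, so its mass is below
    \<open>1 / real (Suc i)\<close> for every \<open>i \<ge> k\<close>.\<close>
  have "measure N (B k s) = 0" for k
  proof -
    have "measure N (B k s) \<le> inverse (real (Suc i))" if "i \<ge> k" for i
    proof -
      have "B k s \<subseteq> B i s"
        using that by (auto simp: B_def intro: less_le_trans[OF _ mult_right_mono])
      then have "measure N (B k s) \<le> measure N (B i s)"
        using B_sets[OF s(1)] by (intro N.finite_measure_mono) (auto simp: N(2))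
      then show ?thesis using s(2)[of i] by (simp add: divide_inverse)
    qed
    then have "measure N (B k s) \<le> 0"
      by (intro LIMSEQ_le_const[OF LIMSEQ_inverse_real_of_nat] exI[of _ k]) auto
    then show ?thesis by (simp add: measure_le_0_iff)
  qed
  then have "AE x in N. \<forall>k. x \<notin> B k s"
    using B_sets[OF s(1)]
    by (subst AE_all_countable) (auto intro!: AE_not_in simp: null_sets_def N(2) N.emeasure_eq_measure)
  then have "AE x in N. F s x = 0"
    using AE_space
  proof eventually_elim
    case (elim x)
    show ?case
    proof (rule ccontr)
      assume "F s x \<noteq> 0"
      then have "0 < norm (F s x) powr \<alpha>" by simp
      then obtain k where "r x < real k * norm (F s x) powr \<alpha>" using reals_Archimedean3 by blast
      also have "\<dots> \<le> real (Suc k) * norm (F s x) powr \<alpha>" by (intro mult_right_mono) auto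
      finally have "x \<in> B k s" using elim(2) by (simp add: B_def space_N)
      then show False using elim(1) by blast
    qed
  qed
  then show ?thesis using s(1) by blast
qed

end

text \<open>If the cosine of \<open>u * Z\<close> has mean 1 it equals 1 almost surely, so the sine
  vanishes. Countably many \<open>u = 1 / real (Suc n)\<close> then determine \<open>Z\<close> by
  \<open>LIMSEQ_mult_sin\<close>.\<close>

lemma (in prob_space) AE_zero_if_trivial_char:
  assumes Z [measurable]: "Z \<in> borel_measurable M"
    and char: "\<And>u::real. (LINT \<omega>|M. exp (\<i> * of_real (u * Z \<omega>))) = 1"
  shows "AE \<omega> in M. Z \<omega> = 0"
proof -
  have sin_0: "AE \<omega> in M. sin (u * Z \<omega>) = 0" for u
  proof -
    have int: "integrable M (\<lambda>\<omega>. exp (\<i> * of_real (u * Z \<omega>)))"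
      by (rule integrable_const_bound[where B = 1]) auto
    have "(LINT \<omega>|M. cos (u * Z \<omega>)) = 1"
      using integral_Re[OF int] unfolding char by (simp add: cis_conv_exp[symmetric] del: of_real_mult)
    then have "(LINT \<omega>|M. 1 - cos (u * Z \<omega>)) = 0"
      using integrable_const_bound[of "\<lambda>\<omega>. cos (u * Z \<omega>)" 1] by (simp add: prob_space)
    moreover have "integrable M (\<lambda>\<omega>. 1 - cos (u * Z \<omega>))"
      by (intro Bochner_Integration.integrable_diff integrable_const integrable_const_bound[where B = 1]) auto
    ultimately have "AE \<omega> in M. 1 - cos (u * Z \<omega>) = 0"
      by (subst (asm) integral_nonneg_eq_0_iff_AE) auto
    then show ?thesis
    proof eventually_elim
      case (elim \<omega>)
      then show ?case using sin_cos_squared_add[of "u * Z \<omega>"] by simp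
    qed
  qed
  have "AE \<omega> in M. sin (Z \<omega> / real (Suc n)) = 0" for n
    using sin_0[of "1 / real (Suc n)"] by simp
  then have "AE \<omega> in M. \<forall>n. sin (Z \<omega> / real (Suc n)) = 0"
    unfolding AE_all_countable by (rule allI)
  then show ?thesis
  proof eventually_elim
    case (elim \<omega>)
    then have "(\<lambda>n. real (Suc n) * sin (Z \<omega> / real (Suc n))) = (\<lambda>_. 0)" by auto
    then show ?case using LIMSEQ_unique[OF LIMSEQ_mult_sin[of "Z \<omega>"]] by auto
  qed
qed

section \<open>Vanishing kernels and vanishing components\<close>

context stable_flow
begin

text \<open>Extends the single time found under ergodicity to all times: \<open>F t\<close> is a
  multiple of \<open>F s\<close> composed with \<open>\<phi> (t - s)\<close>, which preserves both
  \<open>A\<close> and null sets.\<close>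

lemma kernel_vanishes_on_invariant_set:
  assumes A: "\<And>t. t \<in> T \<Longrightarrow> \<phi> t -` A \<inter> space m = A"
    and s: "s \<in> T" "AE x in m. x \<in> A \<longrightarrow> F s x = 0" and t: "t \<in> T"
  shows "AE x in m. x \<in> A \<longrightarrow> F t x = 0"
proof -
  have u: "t - s \<in> T" using s t by auto
  have "AE x in m. F t x = a (t - s) x * of_real (Dr (t - s) x powr (1 / \<alpha>)) * F s (\<phi> (t - s) x)"
    using F_cocycle[OF s(1) u] by simp
  then show ?thesis
    using AE_\<phi>[OF u s(2)]
  proof eventually_elim
    case (elim x)
    then show ?case using A[OF u] by auto
  qed
qed

text \<open>The factors \<open>a t\<close> and \<open>Dr t\<close> are nonzero almost everywhere, so
  \<open>F t\<close> and \<open>f\<close> composed with \<open>\<phi> t\<close> have the same zeros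
  up to null sets.\<close>

lemma null_set_if_kernel_vanishes:
  assumes supp: "full_support T m \<phi> f" and A: "A \<in> sets m"
    and vanish: "\<And>t. t \<in> T \<Longrightarrow> AE x in m. x \<in> A \<longrightarrow> F t x = 0"
  shows "A \<in> null_sets m"
proof -
  have "AE x in m. x \<in> A \<longrightarrow> f (\<phi> t x) = 0" if t: "t \<in> T" for t
    using vanish[OF t] Dr_pos[OF t] AE_space
  proof eventually_elim
    case (elim x)
    show ?case
    proof
      assume "x \<in> A"
      then have "a t x * of_real (Dr t x powr (1 / \<alpha>)) * f (\<phi> t x) = 0" using elim by (simp add: F_altdef)
      moreover have "a t x \<noteq> 0" using norm_a[OF t elim(3)] by auto
      ultimately show "f (\<phi> t x) = 0" using elim(2) by simp
    qed
  qed
  then have "\<not> 0 < emeasure m A" using supp A unfolding full_support_def by blast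
  then show ?thesis using A by (auto simp: null_sets_def)
qed

lemma ergodic_kernel_vanishes_on_positive_part:
  assumes erg: "ergodic_process T P \<theta> X"
    and A: "A \<in> sets m" and pos: "positive_map (restrict_space m A) (\<phi> 1)"
  shows "\<exists>s\<in>T. AE x in m. x \<in> A \<longrightarrow> F s x = 0"
proof -
  have A_sub: "A \<subseteq> space m" using A by (rule sets.sets_into_space)
  obtain \<nu> where \<nu>: "finite_measure \<nu>" "sets \<nu> = sets (restrict_space m A)"
    "null_sets \<nu> = null_sets (restrict_space m A)" "distr \<nu> \<nu> (\<phi> 1) = \<nu>"
    using pos by (auto simp: positive_map_def)
  interpret \<nu>: finite_measure \<nu> by (rule \<nu>(1))
  have space_\<nu>: "space \<nu> = A" using sets_eq_imp_space_eq[OF \<nu>(2)] A_sub by (auto simp: space_restrict_space)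
  have id: "(\<lambda>x. x) \<in> measurable \<nu> m"
    using measurable_restrict_space1[of "\<lambda>x. x" m m A] measurable_cong_sets[OF \<nu>(2) refl] by auto
  \<comment> \<open>The invariant measure lives on the restricted space \<open>A\<close>; pushing it
    forward by the inclusion extends it by zero to the whole space, where its null sets are those
    meeting \<open>A\<close> in an \<open>m\<close>-null set.\<close>
  define N where "N = distr \<nu> m (\<lambda>x. x)"
  have emeasure_N: "emeasure N B = emeasure \<nu> (B \<inter> A)" if "B \<in> sets m" for B
    unfolding N_def using id that by (subst emeasure_distr) (auto simp: space_\<nu> vimage_def Int_def)
  have null_N: "B \<in> null_sets N \<longleftrightarrow> B \<inter> A \<in> null_sets m" if B: "B \<in> sets m" for B
  proof -
    have "B \<inter> A \<in> sets \<nu>" using B A by (auto simp: \<nu>(2) sets_restrict_space_iff)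
    then have "B \<in> null_sets N \<longleftrightarrow> B \<inter> A \<in> null_sets \<nu>"
      using B by (auto simp: null_sets_def emeasure_N) (auto simp: N_def)
    also have "\<dots> \<longleftrightarrow> B \<inter> A \<in> null_sets m"
      unfolding \<nu>(3) using A by (subst null_sets_restrict_space) auto
    finally show ?thesis .
  qed
  have ac: "absolutely_continuous m N"
    unfolding absolutely_continuous_def
  proof
    fix B assume B: "B \<in> null_sets m"
    then have "B \<inter> A \<in> null_sets m" using A by (auto intro: null_set_Int2)
    then show "B \<in> null_sets N" using null_N B by auto
  qed
  have meas: "\<phi> 1 \<in> measurable \<nu> \<nu>"
  proof -
    have "\<phi> 1 \<in> measurable (restrict_space m A) (restrict_space m A)"
      using pos by (simp add: positive_map_def nonsingular_map_def)
    then show ?thesis using measurable_cong_sets[OF \<nu>(2) \<nu>(2)] by blast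
  qed
  have \<phi>1: "\<phi> 1 \<in> measurable m m" by (intro \<phi>_measurable) simp
  have "distr N m (\<phi> 1) = distr \<nu> m (\<phi> 1)"
    unfolding N_def using \<phi>1 id by (subst distr_distr) (auto simp: o_def)
  also have "\<dots> = distr (distr \<nu> \<nu> (\<phi> 1)) m (\<lambda>x. x)"
    using meas id by (subst distr_distr) (auto simp: o_def)
  also have "\<dots> = N" by (simp add: \<nu>(4) N_def)
  finally have inv: "distr N m (\<phi> 1) = N" .
  have "finite_measure N" unfolding N_def using id by (rule \<nu>.finite_measure_distr)
  from ergodic_kernel_vanishes[OF erg this _ ac inv]
  obtain s where s: "s \<in> T" "AE x in N. F s x = 0" by (auto simp: N_def)
  have Z: "{x \<in> space m. F s x \<noteq> 0} \<in> sets m" using F_measurable[OF s(1)] by measurable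
  have "{x \<in> space m. F s x \<noteq> 0} \<in> null_sets N"
    using s(2) Z by (subst (asm) AE_iff_null) (auto simp: N_def)
  then have "{x \<in> space m. F s x \<noteq> 0} \<inter> A \<in> null_sets m" using null_N[OF Z] by simp
  then have "AE x in m. x \<notin> {x \<in> space m. F s x \<noteq> 0} \<inter> A" by (rule AE_not_in)
  then have "AE x in m. x \<in> A \<longrightarrow> F s x = 0" by eventually_elim (use A_sub in auto)
  with s(1) show ?thesis by blast
qed

text \<open>From left to right the scalar 1 suffices, since a zero exponent makes a nonnegative
  integrand vanish. Conversely all real multiples of \<open>z\<close> are used, with
  \<open>z = 1\<close> and, in the complex case, also \<open>z = - \<i>\<close> to reach the
  imaginary part.\<close>

lemma vanishes_iff_kernel_vanishes:
  fixes Q :: "'q measure" and Y :: "real \<Rightarrow> 'q \<Rightarrow> complex"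
  assumes A: "A \<in> sets m" and rep: "integral_representation T K \<alpha> Q Y (restrict_space m A) F"
  shows "vanishes T Q Y \<longleftrightarrow> (\<forall>t\<in>T. AE x in m. x \<in> A \<longrightarrow> F t x = 0)"
proof -
  have A_sub: "A \<inter> space m \<in> sets m" using A by auto
  have Q: "process_on T K Q Y" using rep by (simp add: integral_representation_def)
  interpret Q: prob_space Q using Q by (simp add: process_on_def)
  have Y_meas: "Y t \<in> borel_measurable Q" and Y_K: "\<And>\<omega>. \<omega> \<in> space Q \<Longrightarrow> Y t \<omega> \<in> K" if "t \<in> T" for t
    using Q that by (auto simp: process_on_def)
  have char_Y: "(LINT \<omega>|Q. exp (\<i> * of_real (Re (z * Y t \<omega>))))
    = of_real (exp (- (LINT x|restrict_space m A. norm (z * F t x) powr \<alpha>)))" if "t \<in> T" "z \<in> K" for t z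
  proof -
    have "\<forall>(n::nat) t \<theta>. (\<forall>j<n. t j \<in> T \<and> \<theta> j \<in> K) \<longrightarrow>
        (LINT \<omega>|Q. exp (\<i> * of_real (Re (\<Sum>j<n. \<theta> j * Y (t j) \<omega>)))) =
        of_real (exp (- (LINT x|restrict_space m A. norm (\<Sum>j<n. \<theta> j * F (t j) x) powr \<alpha>)))"
      using rep by (simp add: integral_representation_def)
    from this[rule_format, of 1 "\<lambda>_. t" "\<lambda>_. z"] that show ?thesis by simp
  qed
  have restrict: "(AE x in restrict_space m A. F t x = 0) \<longleftrightarrow> (AE x in m. x \<in> A \<longrightarrow> F t x = 0)" for t
    using AE_restrict_space_iff[OF A_sub] by simp
  show ?thesis
  proof
    assume v: "vanishes T Q Y"
    show "\<forall>t\<in>T. AE x in m. x \<in> A \<longrightarrow> F t x = 0"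
    proof
      fix t assume t: "t \<in> T"
      have "AE \<omega> in Q. exp (\<i> * of_real (Re (1 * Y t \<omega>))) = 1"
        using v t by (auto simp: vanishes_def)
      then have "(LINT \<omega>|Q. exp (\<i> * of_real (Re (1 * Y t \<omega>)))) = (LINT \<omega>|Q. 1)"
        using Y_meas[OF t] by (intro integral_cong_AE) auto
      moreover have "1 \<in> K" using K_cases by auto
      ultimately have "(LINT x|restrict_space m A. norm (F t x) powr \<alpha>) = 0"
        using char_Y[OF t, of 1] by (simp add: Q.prob_space complex_eq_iff)
      moreover have "integrable (restrict_space m A) (\<lambda>x. norm (F t x) powr \<alpha>)"
        using rep t by (auto simp: integral_representation_def L_alpha_def)
      ultimately have "AE x in restrict_space m A. norm (F t x) powr \<alpha> = 0"
        by (subst (asm) integral_nonneg_eq_0_iff_AE) auto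
      then show "AE x in m. x \<in> A \<longrightarrow> F t x = 0"
        unfolding restrict[symmetric] by eventually_elim simp
    qed
  next
    assume v: "\<forall>t\<in>T. AE x in m. x \<in> A \<longrightarrow> F t x = 0"
    have Re_0: "AE \<omega> in Q. Re (z * Y t \<omega>) = 0" if t: "t \<in> T" and z: "z \<in> K" for t z
    proof (rule Q.AE_zero_if_trivial_char)
      show "(\<lambda>\<omega>. Re (z * Y t \<omega>)) \<in> borel_measurable Q" using Y_meas[OF t] by simp
      fix u :: real
      have "AE x in restrict_space m A. norm ((of_real u * z) * F t x) powr \<alpha> = 0"
        using v t unfolding restrict[symmetric] by (auto elim: eventually_mono)
      then have "(LINT x|restrict_space m A. norm ((of_real u * z) * F t x) powr \<alpha>) = 0"
        by (rule integral_eq_zero_AE)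
      then have "(LINT \<omega>|Q. exp (\<i> * of_real (Re ((of_real u * z) * Y t \<omega>)))) = 1"
        using char_Y[OF t K_scaleR[OF z, of u]] by simp
      moreover have eq: "Re ((of_real u * z) * Y t \<omega>) = u * Re (z * Y t \<omega>)" for \<omega>
        by (simp add: algebra_simps)
      ultimately show "(LINT \<omega>|Q. exp (\<i> * of_real (u * Re (z * Y t \<omega>)))) = 1"
        by (simp only: eq)
    qed
    show "vanishes T Q Y"
      unfolding vanishes_def
    proof
      fix t assume t: "t \<in> T"
      have "1 \<in> K" using K_cases by auto
      from Re_0[OF t this] have Re_Y: "AE \<omega> in Q. Re (Y t \<omega>) = 0" by simp
      have Im_Y: "AE \<omega> in Q. Im (Y t \<omega>) = 0"
      proof (cases "K = UNIV")
        case True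
        then show ?thesis using Re_0[OF t, of "- \<i>"] by simp
      next
        case False
        then show ?thesis
          using K_cases Y_K[OF t] by (intro AE_I2) (auto simp: complex_is_Real_iff)
      qed
      from Re_Y Im_Y show "AE \<omega> in Q. Y t \<omega> = 0"
        by eventually_elim (simp add: complex_eq_iff)
    qed
  qed
qed

end

theorem theorem3p1:
  fixes T :: "real set" and K :: "complex set" and \<alpha> :: real
    and P :: "'w measure" and \<theta> :: "real \<Rightarrow> 'w \<Rightarrow> 'w" and X :: "real \<Rightarrow> 'w \<Rightarrow> complex"
    and m :: "'e measure" and \<phi> :: "real \<Rightarrow> 'e \<Rightarrow> 'e" and a :: "real \<Rightarrow> 'e \<Rightarrow> complex"
    and f :: "'e \<Rightarrow> complex" and Pos Nul :: "'e set"
    and Q :: "'q measure" and XP XN :: "real \<Rightarrow> 'q \<Rightarrow> complex"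
  assumes "0 < \<alpha>" and "\<alpha> < 2"
    and "T = \<int> \<or> T = UNIV"
    and "K = \<real> \<or> K = UNIV"
    and "SaS_process T K \<alpha> P X"
    and "stationary_process T P X"
    and "measurable_process T P X"
    and "shift_realization T P \<theta> X"
    and "full_support_flow_representation T K \<alpha> P X m \<phi> a f"
    and "positive_null_parts_flow T m \<phi> Pos Nul"
    and "positive_null_components T K \<alpha> m (flow_kernel \<alpha> m \<phi> a f) Pos Nul Q XP XN"
  shows "(ergodic_process T P \<theta> X \<longleftrightarrow> vanishes T Q XP) \<and>
         (weakly_mixing_process T P \<theta> X \<longleftrightarrow> vanishes T Q XP)"
proof -
  have process: "process_on T K P X" and "prob_space P"
    using assms(5) by (auto simp: SaS_process_def process_on_def)
  then interpret P: prob_space P by simp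
  have supp: "full_support T m \<phi> f" and "sigma_finite_measure m"
    using assms(9) by (auto simp: full_support_flow_representation_def)
  then interpret m: sigma_finite_measure m by simp
  interpret stable_flow T P K \<theta> X m \<alpha> \<phi> a f
    by unfold_locales
      (use assms process in \<open>auto simp: full_support_flow_representation_def\<close>)
  have Pos: "Pos \<in> sets m" "\<And>t. t \<in> T \<Longrightarrow> \<phi> t -` Pos \<inter> space m = Pos"
    using assms(10) by (auto simp: positive_null_parts_flow_def)
  have "\<forall>t\<in>T. t > 0 \<longrightarrow> (\<exists>Pos' Nul'. positive_null_parts_map m (\<phi> t) Pos' Nul' \<and>
        (Pos - Pos') \<union> (Pos' - Pos) \<in> null_sets m \<and> (Nul - Nul') \<union> (Nul' - Nul) \<in> null_sets m)"
    using assms(10) by (simp add: positive_null_parts_flow_def)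
  \<comment> \<open>\<open>Pos'\<close> and \<open>Nul'\<close> carry the invariant measure and the
    weakly wandering set of \<open>\<phi> 1\<close>, while \<open>Pos\<close> is invariant under the
    whole flow and defines \<open>XP\<close>. They agree only up to null sets, so statements are
    moved between them by \<open>AE_eq\<close>.\<close>
  from this[rule_format, OF T_1] obtain Pos' Nul' where parts: "positive_null_parts_map m (\<phi> 1) Pos' Nul'"
    and diff: "(Pos - Pos') \<union> (Pos' - Pos) \<in> null_sets m" by auto
  have Pos': "Pos' \<in> sets m" "positive_map (restrict_space m Pos') (\<phi> 1)" "Pos' \<union> Nul' = space m"
    using parts by (auto simp: positive_null_parts_map_def)
  have AE_eq: "AE x in m. x \<in> Pos \<longleftrightarrow> x \<in> Pos'"
    using AE_not_in[OF diff] by eventually_elim auto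
  have rep: "integral_representation T K \<alpha> Q XP (restrict_space m Pos) F"
    using assms(11) by (simp add: positive_null_components_def)
  note vanishes_iff = vanishes_iff_kernel_vanishes[OF Pos(1) rep]
  have "weakly_mixing_process T P \<theta> X" if "vanishes T Q XP"
  proof (rule weakly_mixing_if_characters)
    have "AE x in m. x \<in> Pos \<longrightarrow> F t x = 0" if "t \<in> T" for t
      using \<open>vanishes T Q XP\<close> that by (simp add: vanishes_iff)
    then have "Pos \<in> null_sets m" by (rule null_set_if_kernel_vanishes[OF supp Pos(1)])
    from AE_not_in[OF this] AE_eq AE_space have AE_Nul: "AE x in m. x \<in> Nul'"
      by eventually_elim (use Pos'(3) in auto)
    obtain B n where "weakly_wandering_along m (\<phi> 1) B n" "Nul' = (\<Union>k. (\<phi> 1 ^^ n k) -` B \<inter> space m)"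
      using parts by (auto simp: positive_null_parts_map_def)
    then show "cov (character l) (character l') \<in> density_zero_class"
      if "admissible l" "admissible l'" for l l'
      using cov_characters_density_zero[OF that] AE_Nul by simp
  qed
  moreover have "vanishes T Q XP" if erg: "ergodic_process T P \<theta> X"
  proof -
    from ergodic_kernel_vanishes_on_positive_part[OF erg Pos'(1,2)]
    obtain s where s: "s \<in> T" "AE x in m. x \<in> Pos' \<longrightarrow> F s x = 0" by blast
    from s(2) AE_eq have "AE x in m. x \<in> Pos \<longrightarrow> F s x = 0" by eventually_elim auto
    then show ?thesis
      unfolding vanishes_iff using kernel_vanishes_on_invariant_set[OF Pos(2) s(1)] by blast
  qed
  \<comment> \<open>The implications form a cycle: vanishing gives weak mixing, which gives
    ergodicity, which gives vanishing. The equivalence of the two mixing properties is thus a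
    by-product.\<close>
  ultimately show ?thesis using weakly_mixing_imp_ergodic by blast
qed

end
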